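(* Let $\mathbf{k}$ be a field, let $n\ge 2$, and let $\iota\colon \mathrm{Bir}(\mathbb{P}^n_{\mathbf{k}})\to \mathrm{Bir}(\mathbb{P}^{n+1}_{\mathbf{k}})$ be a linear embedding. (1) If $n$ is even, then $\iota(G_n(\mathbf{k}))\not\subset G_{n+1}(\mathbf{k})$. (2) If $n$ is odd and $\mathrm{char}(\mathbf{k})\neq 2$, then $\iota(G_n(\mathbf{k}))\subset G_{n+1}(\mathbf{k})$.
   Context: For each $m\geq 2$, $\sigma_m\colon [x_0:\dots:x_m]\dashrightarrow [\frac{1}{x_0}:\dots:\frac{1}{x_m}]$ is the standard involution and $G_m(\mathbf{k})=\langle \sigma_m,\mathrm{Aut}(\mathbb{P}^m_{\mathbf{k}})\rangle\subset \mathrm{Bir}(\mathbb{P}^m_{\mathbf{k}})$. The canonical injection $\iota_n\colon \mathrm{Bir}(\mathbb{A}^n_{\mathbf{k}})\to \mathrm{Bir}(\mathbb{A}^{n+1}_{\mathbf{k}})$ is given by $(\iota_n(\varphi))(x_1,\dots,x_{n+1})=(\varphi(x_1,\dots,x_n),x_{n+1})$. A linear open embedding $\mathbb{A}^i_{\mathbf{k}}\to\mathbb{P}^i_{\mathbf{k}}$ is an open embedding such that the pull-back of a general hyperplane is a hyperplane. An injective group homomorphism $\iota\colon \mathrm{Bir}(\mathbb{P}^n_{\mathbf{k}})\to \mathrm{Bir}(\mathbb{P}^{n+1}_{\mathbf{k}})$ is called a linear embedding if there exist linear open embeddings $\tau_n\colon \mathbb{A}^n_{\mathbf{k}}\to \mathbb{P}^{n}_{\mathbf{k}}$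 and $\tau_{n+1}\colon \mathbb{A}^{n+1}_{\mathbf{k}}\to \mathbb{P}^{n+1}_{\mathbf{k}}$ such that $$\iota(\varphi)=\tau_{n+1}\, \iota_n\big((\tau_n)^{-1} \varphi\, \tau_n\big)\,(\tau_{n+1})^{-1}$$ for each $\varphi\in \mathrm{Bir}(\mathbb{P}^n_{\mathbf{k}})$. *)

theory Defs
  imports
    "HOL-Library.Poly_Mapping"
    "HOL-Algebra.Generated_Groups"
    "HOL-Algebra.Algebraic_Closure_Type"
begin

section \<open>Polynomials in the variables \<open>x_0, x_1, \<dots>\<close>\<close>

type_synonym 'a mpoly = "(nat \<Rightarrow>\<^sub>0 nat) \<Rightarrow>\<^sub>0 'a"

definition mconst :: "'a::zero \<Rightarrow> 'a mpoly"
  where "mconst c = Poly_Mapping.single 0 c"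

definition mvar :: "nat \<Rightarrow> 'a::zero_neq_one mpoly"
  where "mvar i = Poly_Mapping.single (Poly_Mapping.single i 1) 1"

definition mvars :: "'a::zero mpoly \<Rightarrow> nat set"
  where "mvars p = (\<Union>m\<in>Poly_Mapping.keys p. Poly_Mapping.keys m)"

definition mon_deg :: "(nat \<Rightarrow>\<^sub>0 nat) \<Rightarrow> nat"
  where "mon_deg m = (\<Sum>l\<in>Poly_Mapping.keys m. Poly_Mapping.lookup m l)"

definition homogeneous :: "nat \<Rightarrow> 'a::zero mpoly \<Rightarrow> bool"
  where "homogeneous d p \<longleftrightarrow> (\<forall>m\<in>Poly_Mapping.keys p. mon_deg m = d)"

text \<open>Evaluation at \<open>v\<close>, the coefficients being mapped into the target ring by \<open>h\<close>.\<close>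

definition mp_eval :: "('a::zero \<Rightarrow> 'b::comm_ring_1) \<Rightarrow> (nat \<Rightarrow> 'b) \<Rightarrow> 'a mpoly \<Rightarrow> 'b"
  where "mp_eval h v p = (\<Sum>m\<in>Poly_Mapping.keys p.
           h (Poly_Mapping.lookup p m) *
           (\<Prod>l\<in>Poly_Mapping.keys m. v l ^ Poly_Mapping.lookup m l))"


section \<open>Rational maps between affine and projective spaces\<close>

text \<open>
  The affine space \<open>Aff n\<close> has coordinates \<open>x_1, \<dots>, x_n\<close>, the projective space \<open>Proj n\<close>
  has homogeneous coordinates \<open>x_0, \<dots>, x_n\<close>. In both cases a rational map into an
  \<open>n\<close>-dimensional space is represented by a tuple \<open>(F_0, \<dots>, F_n)\<close> of polynomials in the
  coordinates of the source (padded by zeros): it stands for \<open>[F_0 : \<dots> : F_n]\<close> if the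
  target is \<open>Proj n\<close>, and for \<open>(F_1/F_0, \<dots>, F_n/F_0)\<close> if the target is \<open>Aff n\<close>. If the
  source is projective, the \<open>F_i\<close> are homogeneous of the same degree.
\<close>

datatype space = Aff nat | Proj nat

fun space_dim :: "space \<Rightarrow> nat"
  where "space_dim (Aff n) = n" | "space_dim (Proj n) = n"

fun space_coords :: "space \<Rightarrow> nat set"
  where "space_coords (Aff n) = {1..n}" | "space_coords (Proj n) = {0..n}"

type_synonym 'a tuple = "nat \<Rightarrow> 'a mpoly"

definition rat_reps :: "space \<Rightarrow> space \<Rightarrow> ('a::field) tuple set"
  where "rat_reps S T = {F.
     (\<forall>i. mvars (F i) \<subseteq> space_coords S) \<and>
     (\<forall>i. space_dim T < i \<longrightarrow> F i = 0) \<and>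
     (case S of Aff _ \<Rightarrow> True | Proj _ \<Rightarrow> (\<exists>d. \<forall>i. homogeneous d (F i))) \<and>
     (case T of Aff _ \<Rightarrow> F 0 \<noteq> 0 | Proj _ \<Rightarrow> (\<exists>i. F i \<noteq> 0))}"

definition proportional :: "('a::field) tuple \<Rightarrow> 'a tuple \<Rightarrow> bool"
  where "proportional F G \<longleftrightarrow> (\<forall>i j. F i * G j = F j * G i)"

type_synonym 'a ratmap = "'a tuple set"

definition rat_class :: "space \<Rightarrow> space \<Rightarrow> ('a::field) tuple \<Rightarrow> 'a ratmap"
  where "rat_class S T F = {G \<in> rat_reps S T. proportional F G}"

definition RatMaps :: "space \<Rightarrow> space \<Rightarrow> ('a::field) ratmap set"
  where "RatMaps S T = rat_class S T ` rat_reps S T"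

definition tuple_deg :: "('a::field) tuple \<Rightarrow> nat"
  where "tuple_deg G = (LEAST d. \<forall>i. \<forall>m\<in>Poly_Mapping.keys (G i). mon_deg m \<le> d)"

text \<open>
  The composition of representatives, \<open>F\<close> first. If the intermediate space is affine,
  \<open>G_i(F_1/F_0, F_2/F_0, \<dots>)\<close> is multiplied by \<open>F_0\<close> to the power \<open>tuple_deg G\<close> in order
  to clear denominators. If it is projective, all monomials of \<open>G\<close> have degree
  \<open>tuple_deg G\<close>, so the formula is the plain substitution \<open>G_i(F_0, F_1, \<dots>)\<close>.
\<close>

definition tuple_comp :: "('a::field) tuple \<Rightarrow> 'a tuple \<Rightarrow> 'a tuple"
  where "tuple_comp G F = (\<lambda>i. \<Sum>m\<in>Poly_Mapping.keys (G i).
           mconst (Poly_Mapping.lookup (G i) m) * F 0 ^ (tuple_deg G - mon_deg m) *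
           (\<Prod>l\<in>Poly_Mapping.keys m. F l ^ Poly_Mapping.lookup m l))"

text \<open>
  The composition \<open>g \<circ> f\<close> of \<open>f\<close> from \<open>S\<close> to some \<open>T\<close> and \<open>g\<close> from \<open>T\<close> to \<open>U\<close>. It is empty
  (hence not a rational map) if the image of \<open>f\<close> lies in the indeterminacy locus of \<open>g\<close>.
\<close>

definition rat_comp :: "space \<Rightarrow> space \<Rightarrow> ('a::field) ratmap \<Rightarrow> 'a ratmap \<Rightarrow> 'a ratmap"
  where "rat_comp S U g f =
    (\<Union>{rat_class S U (tuple_comp G F) | F G.
          F \<in> f \<and> G \<in> g \<and> tuple_comp G F \<in> rat_reps S U})"

fun id_tuple :: "space \<Rightarrow> ('a::field) tuple"
  where
    "id_tuple (Aff n) = (\<lambda>i. if i = 0 then 1 else if i \<le> n then mvar i else 0)"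
  | "id_tuple (Proj n) = (\<lambda>i. if i \<le> n then mvar i else 0)"

definition rat_id :: "space \<Rightarrow> ('a::field) ratmap"
  where "rat_id S = rat_class S S (id_tuple S)"

definition rat_inverse_of :: "space \<Rightarrow> space \<Rightarrow> ('a::field) ratmap \<Rightarrow> 'a ratmap \<Rightarrow> bool"
  where "rat_inverse_of S T f g \<longleftrightarrow>
    g \<in> RatMaps T S \<and> rat_comp S S g f = rat_id S \<and> rat_comp T T f g = rat_id T"

definition birational :: "space \<Rightarrow> space \<Rightarrow> ('a::field) ratmap \<Rightarrow> bool"
  where "birational S T f \<longleftrightarrow> f \<in> RatMaps S T \<and> (\<exists>g. rat_inverse_of S T f g)"

definition rat_inv :: "space \<Rightarrow> space \<Rightarrow> ('a::field) ratmap \<Rightarrow> 'a ratmap"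
  where "rat_inv S T f = (THE g. rat_inverse_of S T f g)"

definition Bir :: "space \<Rightarrow> ('a::field) ratmap monoid"
  where "Bir S = \<lparr>carrier = {f. birational S S f},
                  monoid.mult = (\<lambda>g f. rat_comp S S g f),
                  one = rat_id S\<rparr>"


section \<open>Points and regularity\<close>

text \<open>
  Regularity is tested at the points over the algebraic closure of the ground field. Points
  of \<open>Proj n\<close> are given by nonzero vectors of homogeneous coordinates.
\<close>

fun space_points :: "space \<Rightarrow> (nat \<Rightarrow> ('a::field) alg_closure) set"
  where
    "space_points (Aff n) = {p. \<forall>i. i \<notin> {1..n} \<longrightarrow> p i = 0}"
  | "space_points (Proj n) = {p. (\<forall>i>n. p i = 0) \<and> (\<exists>i. p i \<noteq> 0)}"

definition tuple_at :: "('a::field) tuple \<Rightarrow> (nat \<Rightarrow> 'a alg_closure) \<Rightarrow> nat \<Rightarrow> 'a alg_closure"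
  where "tuple_at F p = (\<lambda>i. mp_eval to_ac p (F i))"

fun tuple_defined_at :: "space \<Rightarrow> ('a::field) tuple \<Rightarrow> (nat \<Rightarrow> 'a alg_closure) \<Rightarrow> bool"
  where
    "tuple_defined_at (Aff n) F p \<longleftrightarrow> tuple_at F p 0 \<noteq> 0"
  | "tuple_defined_at (Proj n) F p \<longleftrightarrow> (\<exists>i. tuple_at F p i \<noteq> 0)"

definition regular_at :: "space \<Rightarrow> ('a::field) ratmap \<Rightarrow> (nat \<Rightarrow> 'a alg_closure) \<Rightarrow> bool"
  where "regular_at T f p \<longleftrightarrow> (\<exists>F\<in>f. tuple_defined_at T F p)"

definition morphism :: "space \<Rightarrow> space \<Rightarrow> ('a::field) ratmap \<Rightarrow> bool"
  where "morphism S T f \<longleftrightarrow> f \<in> RatMaps S T \<and> (\<forall>p\<in>space_points S. regular_at T f p)"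


section \<open>The groups \<open>G_m(k)\<close>\<close>

definition Aut_Proj :: "nat \<Rightarrow> ('a::field) ratmap set"
  where "Aut_Proj m = {f \<in> carrier (Bir (Proj m)).
           morphism (Proj m) (Proj m) f \<and>
           morphism (Proj m) (Proj m) (rat_inv (Proj m) (Proj m) f)}"

text \<open>\<open>[1/x_0 : \<dots> : 1/x_m]\<close>, multiplied by \<open>x_0 \<cdots> x_m\<close>.\<close>

definition std_involution :: "nat \<Rightarrow> ('a::field) ratmap"
  where "std_involution m = rat_class (Proj m) (Proj m)
           (\<lambda>i. if i \<le> m then (\<Prod>j\<in>{0..m} - {i}. mvar j) else 0)"

definition G_group :: "nat \<Rightarrow> ('a::field) ratmap set"
  where "G_group m = generate (Bir (Proj m)) (insert (std_involution m) (Aut_Proj m))"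


section \<open>Linear embeddings\<close>

text \<open>
  \<open>(\<phi>, x_{n+1})\<close>; recall that \<open>F_0\<close> is the common denominator of the components.
\<close>

definition iota_aff :: "nat \<Rightarrow> ('a::field) ratmap \<Rightarrow> 'a ratmap"
  where "iota_aff n \<phi> = (\<Union>F\<in>\<phi>. rat_class (Aff (n + 1)) (Aff (n + 1))
                             (F(n + 1 := F 0 * mvar (n + 1))))"

text \<open>
  An open embedding of \<open>Aff n\<close> into \<open>Proj n\<close> is an isomorphism onto an open subset: a
  morphism that is birational and whose inverse is regular at each point of the image. The
  image is then the whole (open) domain of definition \<open>W\<close> of the inverse \<open>\<psi>\<close>, since
  \<open>\<tau> \<circ> \<psi>\<close> is the identity on \<open>W\<close>.
\<close>

definition open_embedding :: "nat \<Rightarrow> ('a::field) ratmap \<Rightarrow> bool"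
  where "open_embedding n \<tau> \<longleftrightarrow>
    morphism (Aff n) (Proj n) \<tau> \<and> birational (Aff n) (Proj n) \<tau> \<and>
    (\<forall>p\<in>space_points (Aff n). \<forall>F\<in>\<tau>. tuple_defined_at (Proj n) F p \<longrightarrow>
        regular_at (Aff n) (rat_inv (Aff n) (Proj n) \<tau>) (tuple_at F p))"

text \<open>
  The pull-back under \<open>\<tau>\<close> of the hyperplane \<open>a_0 x_0 + \<dots> + a_n x_n = 0\<close>. Hyperplanes are
  reduced, and so is the scheme-theoretic pull-back under an open embedding; hence both
  are determined by their sets of points.
\<close>

definition hyperplane_pullback ::
    "nat \<Rightarrow> ('a::field) ratmap \<Rightarrow> (nat \<Rightarrow> 'a alg_closure) \<Rightarrow> (nat \<Rightarrow> 'a alg_closure) set"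
  where "hyperplane_pullback n \<tau> a = {p \<in> space_points (Aff n).
           \<exists>F\<in>\<tau>. tuple_defined_at (Proj n) F p \<and> (\<Sum>i=0..n. a i * tuple_at F p i) = 0}"

definition affine_hyperplane :: "nat \<Rightarrow> (nat \<Rightarrow> ('a::field) alg_closure) set \<Rightarrow> bool"
  where "affine_hyperplane n H \<longleftrightarrow> (\<exists>b. (\<exists>i\<in>{1..n}. b i \<noteq> 0) \<and>
           H = {p \<in> space_points (Aff n). b 0 + (\<Sum>i=1..n. b i * p i) = 0})"

text \<open>
  A general hyperplane is one outside the zero locus of some nonzero homogeneous polynomial
  \<open>Q\<close> on the dual projective space. As the ground field may be finite, hyperplanes over
  the algebraic closure are considered.
\<close>

definition linear_open_embedding :: "nat \<Rightarrow> ('a::field) ratmap \<Rightarrow> bool"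
  where "linear_open_embedding n \<tau> \<longleftrightarrow> open_embedding n \<tau> \<and>
    (\<exists>Q :: 'a alg_closure mpoly. \<exists>d. Q \<noteq> 0 \<and> mvars Q \<subseteq> {0..n} \<and> homogeneous d Q \<and>
       (\<forall>a\<in>space_points (Proj n). mp_eval (\<lambda>c. c) a Q \<noteq> 0 \<longrightarrow>
          affine_hyperplane n (hyperplane_pullback n \<tau> a)))"

definition linear_embedding :: "nat \<Rightarrow> (('a::field) ratmap \<Rightarrow> 'a ratmap) \<Rightarrow> bool"
  where "linear_embedding n \<iota> \<longleftrightarrow>
    \<iota> \<in> hom (Bir (Proj n)) (Bir (Proj (n + 1))) \<and>
    inj_on \<iota> (carrier (Bir (Proj n))) \<and>
    (\<exists>\<tau> \<tau>'. linear_open_embedding n \<tau> \<and> linear_open_embedding (n + 1) \<tau>' \<and>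
      (\<forall>\<phi>\<in>carrier (Bir (Proj n)).
         let \<psi> = rat_comp (Aff n) (Aff n) (rat_inv (Aff n) (Proj n) \<tau>)
                   (rat_comp (Aff n) (Proj n) \<phi> \<tau>)
         in \<iota> \<phi> = rat_comp (Proj (n + 1)) (Proj (n + 1))
                   (rat_comp (Aff (n + 1)) (Proj (n + 1)) \<tau>' (iota_aff n \<psi>))
                   (rat_inv (Aff (n + 1)) (Proj (n + 1)) \<tau>')))"

end

theory Submission imports Defs "Jordan_Normal_Form.Determinant" "HOL-Computational_Algebra.Fraction_Field"
begin

text \<open>
  By unique factorization a rational map has a reduced representative, which represents it wherever it
  is defined. Hence an automorphism of projective space is linear: if \<open>G \<circ> F = h id\<close> with \<open>F\<close>, \<open>G\<close>
  reduced and \<open>F\<close> without zeros over the algebraic closure, then \<open>h\<close> has no zeros and is constant. A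
  linear open embedding is affine-linear, so that up to linear coordinate changes \<open>\<iota>\<close> is the suspension
  \<open>F \<mapsto> (x_0 F_0, \<dots>, x_0 F_n, x_m F_0)\<close>, where \<open>m = n + 1\<close> and the source of \<open>F\<close> has the coordinates
  \<open>x_0, \<dots>, x_n\<close>.

  For \<open>n\<close> even, the homogeneous Jacobian of a map in \<open>G_m\<close> is a constant times a square: the degree of
  a representative enters the Jacobian of \<open>g F\<close> only through \<open>g\<close> to the power \<open>m + 1\<close>, which is even. The
  suspension of the exchange of \<open>x_0\<close> and \<open>x_1\<close> is, up to a linear map, \<open>x_m \<mapsto> x_1 x_m / x_0\<close>, and
  violates this.

  For \<open>n\<close> odd, \<open>G_m\<close> contains \<open>x_m \<mapsto> x_1 x_m / x_0\<close>, which together with linear maps and the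
  standard involution yields the suspensions of all generators: elementary matrices and the standard
  involution give \<open>x_i \<mapsto> x_j^2 / x_i\<close>, hence \<open>x_i \<mapsto> (x_a / x_b)^2 x_i\<close>, hence
  \<open>x_i \<mapsto> x_i + \<mu> x_k\<close> for \<open>\<mu> = x_a / x_b\<close>, a combination of two squares if the
  characteristic is not \<open>2\<close>, hence the scaling of any two coordinates by \<open>\<mu>\<close>, and \<open>m\<close> is even.
\<close>

subsection \<open>Evaluation and homogeneity of polynomials\<close>

text \<open>The ground field may be finite, so identities of rational maps are tested not at
  rational points but at vectors over the field of rational functions at which no nonzero form
  vanishes. Dominant maps preserve these generic vectors, so maps are composed and inverted by
  computing with coordinates up to a common factor, and formulas with denominators are allowed.

  A linear open embedding is known only through point sets: the equation induced by a general
  hyperplane might be a proper power of a linear one, as for a Frobenius map. Restriction to a line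
  reduces linearity to a statement on curves, where birationality excludes inseparability.

  Parity enters twice. Multiplying a representative by \<open>h\<close> multiplies its Jacobian by
  \<open>h ^ (m + 1)\<close>, which is a square for odd \<open>m\<close>; then the Jacobian modulo
  squares belongs to the map. Conversely, dividing x_m by x_0 / x_1 is projectively the same as
  multiplying all other coordinates by x_0 / x_1; an inversion and an exchange settle x_0 and x_1,
  and the remaining \<open>m - 2\<close> coordinates can be scaled two at a time when
  \<open>m\<close> is even.\<close>

definition mon_val :: "(nat \<Rightarrow> 'b::comm_ring_1) \<Rightarrow> (nat \<Rightarrow>\<^sub>0 nat) \<Rightarrow> 'b"
  where "mon_val v m = (\<Prod>l\<in>Poly_Mapping.keys m. v l ^ Poly_Mapping.lookup m l)"

lemma mon_val_superset:
  assumes "finite S" "Poly_Mapping.keys m \<subseteq> S"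
  shows "mon_val v m = (\<Prod>l\<in>S. v l ^ Poly_Mapping.lookup m l)"
  unfolding mon_val_def
  by (rule prod.mono_neutral_left) (use assms in \<open>auto simp: in_keys_iff\<close>)

lemma mon_val_0 [simp]: "mon_val v 0 = 1"
  by (simp add: mon_val_def)

lemma mon_val_single [simp]: "mon_val v (Poly_Mapping.single i k) = v i ^ k"
  by (subst mon_val_superset[of "{i}"]) (auto simp: lookup_single)

lemma mon_val_add: "mon_val v (m + m') = mon_val v m * mon_val v m'"
proof -
  let ?S = "Poly_Mapping.keys m \<union> Poly_Mapping.keys m'"
  have "Poly_Mapping.keys (m + m') \<subseteq> ?S" by (rule keys_add)
  then show ?thesis
    by (simp add: mon_val_superset[of ?S] lookup_add power_add prod.distrib)
qed

lemma mp_eval_alt: "mp_eval h v p = (\<Sum>m\<in>Poly_Mapping.keys p. h (Poly_Mapping.lookup p m) * mon_val v m)"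
  by (simp add: mp_eval_def mon_val_def)

lemma poly_mapping_sum_single:
  "p = (\<Sum>m\<in>Poly_Mapping.keys p. Poly_Mapping.single m (Poly_Mapping.lookup p m))"
  by (rule poly_mapping_eqI) (simp add: lookup_sum lookup_single when_def in_keys_iff)

lemma mconst_0 [simp]: "mconst 0 = 0" by (simp add: mconst_def)
lemma mconst_1 [simp]: "mconst 1 = (1 :: 'a::{zero_neq_one} mpoly)" by (simp add: mconst_def single_one)
lemma mconst_add: "mconst (a + b) = mconst a + mconst (b :: 'a::comm_ring_1)"
  by (simp add: mconst_def single_add)
lemma mconst_mult: "mconst (a * b) = mconst a * mconst (b :: 'a::comm_ring_1)"
  by (simp add: mconst_def mult_single)

lemma comm_ring_hom_mconst: "comm_ring_hom (mconst :: 'a::comm_ring_1 \<Rightarrow> _)"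
  by unfold_locales (auto simp: mconst_add mconst_mult)

context comm_ring_hom
begin

lemma mp_eval_superset:
  assumes "finite S" "Poly_Mapping.keys p \<subseteq> S"
  shows "mp_eval hom v p = (\<Sum>m\<in>S. hom (Poly_Mapping.lookup p m) * mon_val v m)"
  unfolding mp_eval_alt
  by (rule sum.mono_neutral_left) (use assms in \<open>auto simp: in_keys_iff\<close>)

lemma mp_eval_single [simp]: "mp_eval hom v (Poly_Mapping.single m c) = hom c * mon_val v m"
  by (subst mp_eval_superset[of "{m}"]) auto

lemma mp_eval_add: "mp_eval hom v (p + q) = mp_eval hom v p + mp_eval hom v q"
proof -
  let ?S = "Poly_Mapping.keys p \<union> Poly_Mapping.keys q"
  have "Poly_Mapping.keys (p + q) \<subseteq> ?S" by (rule keys_add)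
  then show ?thesis
    by (simp add: mp_eval_superset[of ?S] lookup_add hom_distribs distrib_right sum.distrib)
qed

lemma mp_eval_0: "mp_eval hom v 0 = 0"
  by (simp add: mp_eval_def)

lemma mp_eval_sum_distrib: "mp_eval hom v (sum f A) = (\<Sum>a\<in>A. mp_eval hom v (f a))"
  by (induction A rule: infinite_finite_induct) (auto simp: mp_eval_add mp_eval_0)

lemma mp_eval_mult: "mp_eval hom v (p * q) = mp_eval hom v p * mp_eval hom v q"
proof -
  have "p * q = (\<Sum>m\<in>Poly_Mapping.keys p. \<Sum>m'\<in>Poly_Mapping.keys q.
      Poly_Mapping.single (m + m') (Poly_Mapping.lookup p m * Poly_Mapping.lookup q m'))"
    by (subst (1) poly_mapping_sum_single[of p], subst (1) poly_mapping_sum_single[of q])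
       (simp add: sum_product mult_single)
  then have "mp_eval hom v (p * q) = (\<Sum>m\<in>Poly_Mapping.keys p. \<Sum>m'\<in>Poly_Mapping.keys q.
     (hom (Poly_Mapping.lookup p m) * mon_val v m) * (hom (Poly_Mapping.lookup q m') * mon_val v m'))"
    by (simp add: mp_eval_sum_distrib hom_distribs mon_val_add mult_ac)
  then show ?thesis by (simp add: mp_eval_alt sum_product)
qed

lemma mp_eval_mconst [simp]: "mp_eval hom v (mconst c) = hom c"
  by (simp add: mconst_def)

lemma mp_eval_mvar [simp]: "mp_eval hom v (mvar i) = v i"
  by (simp add: mvar_def)

lemma comm_ring_hom_mp_eval: "comm_ring_hom (mp_eval hom v)"
  by unfold_locales (auto simp: mp_eval_add mp_eval_mult mp_eval_0 single_one[symmetric] simp del: single_one)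

end

lemma mp_eval_cong:
  assumes "\<And>i. i \<in> mvars p \<Longrightarrow> v i = w i"
  shows "mp_eval h v p = mp_eval h w p"
  unfolding mp_eval_def
  by (intro sum.cong prod.cong refl arg_cong2[of _ _ _ _ "(*)"] arg_cong2[of _ _ _ _ "(^)"] assms)
     (auto simp: mvars_def)

lemma hom_mp_eval:
  assumes "comm_ring_hom H"
  shows "H (mp_eval h v p) = mp_eval (\<lambda>c. H (h c)) (\<lambda>i. H (v i)) p"
proof -
  interpret comm_ring_hom H by fact
  show ?thesis by (simp add: mp_eval_def hom_distribs)
qed

lemma mon_val_mvar: "mon_val mvar m = Poly_Mapping.single m (1::'a::comm_ring_1)"
proof -
  have "(\<Prod>l\<in>S. mvar l ^ Poly_Mapping.lookup m l) =
      Poly_Mapping.single (\<Sum>l\<in>S. Poly_Mapping.single l (Poly_Mapping.lookup m l)) (1::'a)" if "finite S" for S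
    using that
  proof induction
    case empty show ?case by (simp add: single_one)
  next
    case (insert x S)
    have "mvar x ^ k = Poly_Mapping.single (Poly_Mapping.single x k) (1::'a)" for k
      by (induction k) (auto simp: single_one mvar_def mult_single single_add[symmetric])
    with insert show ?case by (simp add: mult_single)
  qed
  from this[of "Poly_Mapping.keys m"] show ?thesis
    unfolding mon_val_def by (simp add: poly_mapping_sum_single[symmetric])
qed

lemma mconst_mon_val_mvar: "mconst c * mon_val mvar m = Poly_Mapping.single m (c::'a::comm_ring_1)"
  by (simp add: mon_val_mvar mconst_def mult_single)

lemma mp_eval_mconst_mvar [simp]: "mp_eval mconst mvar p = (p :: 'a::comm_ring_1 mpoly)"
  by (simp add: mp_eval_alt mconst_mon_val_mvar poly_mapping_sum_single[symmetric])

text \<open>A polynomial is its own value at the variables, hence arises from constants and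
  variables by ring operations.\<close>

lemma mpoly_induct [consumes 1, case_names const var add mult]:
  fixes p :: "'a::comm_ring_1 mpoly"
  assumes "mvars p \<subseteq> V" and const: "\<And>c. P (mconst c)" and var: "\<And>i. i \<in> V \<Longrightarrow> P (mvar i)"
    and add: "\<And>p q. P p \<Longrightarrow> P q \<Longrightarrow> P (p + q)" and mult: "\<And>p q. P p \<Longrightarrow> P q \<Longrightarrow> P (p * q)"
  shows "P p"
proof -
  have 1: "P 1" using const[of 1] by simp
  have 0: "P 0" using const[of 0] by simp
  have pow: "P (a ^ k)" if "P a" for a k using that by (induction k) (auto intro: 1 mult)
  have pr: "P (prod f S)" if "\<And>s. s \<in> S \<Longrightarrow> P (f s)" for f and S :: "nat set"
    using that by (induction S rule: infinite_finite_induct) (auto intro: 1 mult)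
  have sm: "P (sum f S)" if "\<And>s. s \<in> S \<Longrightarrow> P (f s)" for f and S :: "(nat \<Rightarrow>\<^sub>0 nat) set"
    using that by (induction S rule: infinite_finite_induct) (auto intro: 0 add)
  have "P (mp_eval mconst mvar p)" unfolding mp_eval_def
    by (intro sm mult pr pow const var) (use assms(1) in \<open>auto simp: mvars_def\<close>)
  then show ?thesis by simp
qed

section \<open>Variables occurring in a polynomial\<close>

lemma mvars_0 [simp]: "mvars 0 = {}" by (simp add: mvars_def)
lemma mvars_mconst [simp]: "mvars (mconst c) = {}" by (simp add: mvars_def mconst_def)
lemma mvars_1 [simp]: "mvars (1 :: 'a::comm_ring_1 mpoly) = {}"
  using mvars_mconst[of "1::'a"] by simp
lemma mvars_mvar [simp]: "mvars (mvar i :: 'a::zero_neq_one mpoly) = {i}" by (simp add: mvars_def mvar_def)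
lemma mvars_add: "mvars (p + q) \<subseteq> mvars p \<union> mvars q"
  using keys_add[of p q] by (auto simp: mvars_def)
lemma mvars_mult: "mvars (p * q) \<subseteq> mvars p \<union> mvars q"
proof
  fix x assume "x \<in> mvars (p * q)"
  then obtain m where m: "m \<in> Poly_Mapping.keys (p * q)" "x \<in> Poly_Mapping.keys m" by (auto simp: mvars_def)
  then obtain a b where "a \<in> Poly_Mapping.keys p" "b \<in> Poly_Mapping.keys q" "m = a + b"
    using keys_mult[of p q] by blast
  moreover have "Poly_Mapping.keys (a + b) \<subseteq> Poly_Mapping.keys a \<union> Poly_Mapping.keys b" by (rule keys_add)
  ultimately show "x \<in> mvars p \<union> mvars q" using m(2) unfolding mvars_def by blast
qed
lemma mvars_uminus [simp]: "mvars (- p) = mvars (p :: 'a::comm_ring_1 mpoly)"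
  by (simp add: mvars_def in_keys_iff set_eq_iff)
lemma mvars_diff: "mvars (p - q) \<subseteq> mvars p \<union> mvars (q :: 'a::comm_ring_1 mpoly)"
  using mvars_add[of p "- q"] by simp
lemma finite_mvars [simp]: "finite (mvars p)" by (simp add: mvars_def)

lemma mvars_sum: "(\<And>a. a \<in> A \<Longrightarrow> mvars (f a) \<subseteq> V) \<Longrightarrow> mvars (sum f A) \<subseteq> V"
  by (induction A rule: infinite_finite_induct) (auto dest!: subsetD[OF mvars_add])
lemma mvars_prod: "(\<And>a. a \<in> A \<Longrightarrow> mvars (f a) \<subseteq> V) \<Longrightarrow> mvars (prod f A :: 'a::comm_ring_1 mpoly) \<subseteq> V"
  by (induction A rule: infinite_finite_induct) (auto dest!: subsetD[OF mvars_mult])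
lemma mvars_power: "mvars (p ^ k) \<subseteq> mvars (p :: 'a::comm_ring_1 mpoly)"
  by (induction k) (auto dest!: subsetD[OF mvars_mult])

interpretation mconst: comm_ring_hom mconst by (rule comm_ring_hom_mconst)

lemma mvars_mp_eval:
  assumes "\<And>i. i \<in> mvars p \<Longrightarrow> mvars (F i) \<subseteq> V"
  shows "mvars (mp_eval mconst F p :: 'a::comm_ring_1 mpoly) \<subseteq> V"
  using subset_refl
proof (induction p rule: mpoly_induct)
  case (add p q) then show ?case using mvars_add by (fastforce simp: mconst.mp_eval_add)
next
  case (mult p q) then show ?case using mvars_mult by (fastforce simp: mconst.mp_eval_mult)
qed (use assms in auto)

section \<open>Degree and homogeneity\<close>

lemma comm_ring_hom_const_poly: "comm_ring_hom (\<lambda>c. [:c:] :: 'a::comm_ring_1 poly)"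
  by unfold_locales (auto simp: one_pCons)
lemma comm_ring_hom_comp:
  assumes "comm_ring_hom f" "comm_ring_hom g" shows "comm_ring_hom (\<lambda>c. f (g c))"
proof -
  interpret f: comm_ring_hom f by fact
  interpret g: comm_ring_hom g by fact
  show ?thesis by unfold_locales (auto simp: f.hom_add f.hom_mult g.hom_add g.hom_mult)
qed

text \<open>This is p(t x_0, t x_1, ...) as a polynomial in t. The coefficient of t^k is the
  homogeneous component of degree k, so total degree and homogeneity become statements about
  univariate polynomials over an integral domain.\<close>

definition tscale :: "'a::comm_ring_1 mpoly \<Rightarrow> 'a mpoly poly"
  where "tscale = mp_eval (\<lambda>c. [:mconst c:]) (\<lambda>i. Polynomial.monom (mvar i) 1)"

interpretation mconst2: comm_ring_hom "\<lambda>c. [:mconst c:]"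
  by (intro comm_ring_hom_comp[OF comm_ring_hom_const_poly] comm_ring_hom_mconst)

interpretation tscale: comm_ring_hom tscale
  unfolding tscale_def by (rule mconst2.comm_ring_hom_mp_eval)

abbreviation tdeg :: "'a::comm_ring_1 mpoly \<Rightarrow> nat" where "tdeg p \<equiv> Polynomial.degree (tscale p)"

lemma mon_deg_superset: "finite S \<Longrightarrow> Poly_Mapping.keys m \<subseteq> S \<Longrightarrow> mon_deg m = (\<Sum>l\<in>S. Poly_Mapping.lookup m l)"
  unfolding mon_deg_def by (rule sum.mono_neutral_left) (auto simp: in_keys_iff)

lemma mon_deg_single [simp]: "mon_deg (Poly_Mapping.single i k) = k"
  by (subst mon_deg_superset[of "{i}"]) auto

lemma mon_deg_eq_0_iff [simp]: "mon_deg m = 0 \<longleftrightarrow> m = 0"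
  by (auto simp: mon_deg_def in_keys_iff intro!: poly_mapping_eqI)

lemma tscale_alt: "tscale p = (\<Sum>m\<in>Poly_Mapping.keys p.
    Polynomial.monom (Poly_Mapping.single m (Poly_Mapping.lookup p m)) (mon_deg m))"
proof -
  have *: "Polynomial.monom a i ^ k = Polynomial.monom (a ^ k) (i * k)" for a :: "'a mpoly" and i k
    by (induction k) (auto simp: mult_monom one_pCons monom_0)
  have "(\<Prod>l\<in>S. Polynomial.monom (mvar l :: 'a mpoly) 1 ^ Poly_Mapping.lookup m l) =
    Polynomial.monom (\<Prod>l\<in>S. mvar l ^ Poly_Mapping.lookup m l) (\<Sum>l\<in>S. Poly_Mapping.lookup m l)" if "finite S" for S m
    using that by induction (auto simp: mult_monom * one_pCons monom_0)
  then have "mon_val (\<lambda>i. Polynomial.monom (mvar i :: 'a mpoly) 1) m = Polynomial.monom (mon_val mvar m) (mon_deg m)" for m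
    by (simp add: mon_val_def mon_deg_def)
  moreover have "[:c:] * Polynomial.monom a k = Polynomial.monom (c * a) k" for c a :: "'a mpoly" and k
    by (simp add: smult_monom)
  ultimately show ?thesis
    by (simp add: tscale_def mp_eval_alt mconst_mon_val_mvar del: mult_pCons_left)
qed

lemma lookup_coeff_tscale:
  "Poly_Mapping.lookup (Polynomial.coeff (tscale p) k) m = (if mon_deg m = k then Poly_Mapping.lookup p m else 0)"
proof -
  have "Poly_Mapping.lookup (Polynomial.coeff (tscale p) k) m =
     (\<Sum>m'\<in>Poly_Mapping.keys p. if m' = m then (if mon_deg m = k then Poly_Mapping.lookup p m else 0) else 0)"
    unfolding tscale_alt coeff_sum lookup_sum
    by (rule sum.cong) (auto simp: coeff_monom lookup_single when_def)
  also have "\<dots> = (if mon_deg m = k then Poly_Mapping.lookup p m else 0)"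
    by (auto simp: in_keys_iff)
  finally show ?thesis .
qed

lemma homogeneous_iff: "homogeneous d p \<longleftrightarrow> tscale p = Polynomial.monom p d"
proof
  assume h: "homogeneous d p"
  then show "tscale p = Polynomial.monom p d"
    by (auto simp: poly_eq_iff coeff_monom lookup_coeff_tscale homogeneous_def in_keys_iff intro!: poly_mapping_eqI)
next
  assume *: "tscale p = Polynomial.monom p d"
  show "homogeneous d p" unfolding homogeneous_def
  proof
    fix m assume "m \<in> Poly_Mapping.keys p"
    then have "Poly_Mapping.lookup (Polynomial.coeff (tscale p) (mon_deg m)) m \<noteq> 0"
      by (simp add: lookup_coeff_tscale in_keys_iff)
    then show "mon_deg m = d" by (auto simp: * coeff_monom split: if_splits)
  qed
qed

lemma tscale_poly_1 [simp]: "poly (tscale p) 1 = p"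
proof -
  have "poly (tscale p) 1 = mp_eval (\<lambda>c. poly [:mconst c:] 1) (\<lambda>i. poly (Polynomial.monom (mvar i) 1) 1) p"
    unfolding tscale_def by (rule hom_mp_eval) (unfold_locales, auto)
  then show ?thesis by (simp add: poly_monom)
qed

lemma tscale_eq_0_iff [simp]: "tscale p = 0 \<longleftrightarrow> p = 0"
proof
  assume "tscale p = 0"
  then show "p = 0" using tscale_poly_1[of p] by simp
qed simp

lemma tdeg_mult: "p \<noteq> 0 \<Longrightarrow> q \<noteq> 0 \<Longrightarrow> tdeg (p * q) = tdeg p + tdeg (q :: 'a::idom mpoly)"
  by (simp add: tscale.hom_mult degree_mult_eq)

lemma mon_deg_le_tdeg: "m \<in> Poly_Mapping.keys p \<Longrightarrow> mon_deg m \<le> tdeg p"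
  by (rule le_degree) (use lookup_coeff_tscale[of p "mon_deg m" m] in \<open>auto simp: in_keys_iff\<close>)

lemma tdeg_le_iff: "tdeg p \<le> d \<longleftrightarrow> (\<forall>m\<in>Poly_Mapping.keys p. mon_deg m \<le> d)"
proof
  assume "\<forall>m\<in>Poly_Mapping.keys p. mon_deg m \<le> d"
  then show "tdeg p \<le> d"
    by (intro degree_le allI impI poly_mapping_eqI) (auto simp: lookup_coeff_tscale in_keys_iff not_le[symmetric])
qed (use mon_deg_le_tdeg le_trans in blast)

lemma homogeneous_tdeg: "homogeneous d p \<Longrightarrow> p \<noteq> 0 \<Longrightarrow> tdeg p = d"
  by (simp add: homogeneous_iff degree_monom_eq)

lemma homogeneous_0 [simp]: "homogeneous d 0" by (simp add: homogeneous_def)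
lemma homogeneous_mconst [simp]: "homogeneous 0 (mconst c)" by (simp add: homogeneous_def mconst_def)
lemma homogeneous_1 [simp]: "homogeneous 0 (1 :: 'a::comm_ring_1 mpoly)" using homogeneous_mconst[of "1::'a"] by simp
lemma homogeneous_mvar [simp]: "homogeneous (Suc 0) (mvar i)" by (simp add: homogeneous_def mvar_def)
lemma homogeneous_add: "homogeneous d p \<Longrightarrow> homogeneous d q \<Longrightarrow> homogeneous d (p + q :: 'a::comm_ring_1 mpoly)"
  by (simp add: homogeneous_iff tscale.hom_add add_monom)
lemma homogeneous_mult: "homogeneous d p \<Longrightarrow> homogeneous e q \<Longrightarrow> homogeneous (d + e) (p * q :: 'a::comm_ring_1 mpoly)"
  by (simp add: homogeneous_iff tscale.hom_mult mult_monom)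
lemma homogeneous_sum: "(\<And>a. a \<in> A \<Longrightarrow> homogeneous d (f a)) \<Longrightarrow> homogeneous d (sum f A :: 'a::comm_ring_1 mpoly)"
  by (induction A rule: infinite_finite_induct) (auto intro: homogeneous_add)
lemma homogeneous_power: "homogeneous d p \<Longrightarrow> homogeneous (d * k) (p ^ k :: 'a::comm_ring_1 mpoly)"
  by (induction k) (auto intro: homogeneous_mult)
lemma homogeneous_prod: "(\<And>a. a \<in> A \<Longrightarrow> homogeneous (d a) (f a)) \<Longrightarrow> homogeneous (sum d A) (prod f A :: 'a::comm_ring_1 mpoly)"
  by (induction A rule: infinite_finite_induct) (auto intro: homogeneous_mult)
lemma homogeneous_mult_mconst: "homogeneous d p \<Longrightarrow> homogeneous d (mconst c * p :: 'a::comm_ring_1 mpoly)"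
  using homogeneous_mult[of 0 "mconst c" d p] by simp

lemma homogeneous_unique:
  "homogeneous d p \<Longrightarrow> homogeneous e p \<Longrightarrow> p \<noteq> 0 \<Longrightarrow> d = (e :: nat)" for p :: "'a::comm_ring_1 mpoly"
  by (metis homogeneous_tdeg)

lemma homogeneous_mp_eval:
  fixes p :: "'a::comm_ring_1 mpoly"
  assumes "homogeneous e p" "\<And>i. i \<in> mvars p \<Longrightarrow> homogeneous d (F i)"
  shows "homogeneous (d * e) (mp_eval mconst F p)"
  unfolding mp_eval_def
proof (intro homogeneous_sum homogeneous_mult_mconst)
  fix m assume m: "m \<in> Poly_Mapping.keys p"
  have "homogeneous (\<Sum>l\<in>Poly_Mapping.keys m. d * Poly_Mapping.lookup m l) (\<Prod>l\<in>Poly_Mapping.keys m. F l ^ Poly_Mapping.lookup m l)"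
    by (intro homogeneous_prod homogeneous_power assms) (use m in \<open>auto simp: mvars_def\<close>)
  then show "homogeneous (d * e) (\<Prod>l\<in>Poly_Mapping.keys m. F l ^ Poly_Mapping.lookup m l)"
    using assms(1) m by (simp add: homogeneous_def[of e] mon_deg_def sum_distrib_left[symmetric])
qed

lemma (in comm_ring_hom) mp_eval_homogeneous_scale:
  assumes "homogeneous e p"
  shows "mp_eval hom (\<lambda>i. c * v i) p = c ^ e * mp_eval hom v p"
proof -
  have "mon_val (\<lambda>i. c * v i) m = c ^ mon_deg m * mon_val v m" for m
    by (simp add: mon_val_def mon_deg_def power_mult_distrib prod.distrib power_sum)
  then show ?thesis using assms by (simp add: mp_eval_alt sum_distrib_left homogeneous_def mult_ac)
qed

text \<open>In p(tx) q(tx) = t^d p q, both the orders at t = 0 and the degrees in t of the two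
  factors add up to d. As the order never exceeds the degree, they agree for each factor, which is
  therefore a monomial in t.\<close>

lemma homogeneous_factor:
  fixes p q :: "'a::idom mpoly"
  assumes "homogeneous d (p * q)" "p * q \<noteq> 0"
  obtains e where "homogeneous e p" "e + tdeg q = d"
proof -
  have nz: "tscale p \<noteq> 0" "tscale q \<noteq> 0" using assms by auto
  have eq: "tscale p * tscale q = Polynomial.monom (p * q) d"
    using assms by (simp add: homogeneous_iff tscale.hom_mult)
  have "tdeg p + tdeg q = d"
    using arg_cong[OF eq, of Polynomial.degree] assms(2) nz by (simp add: degree_mult_eq degree_monom_eq)
  moreover have "order 0 (tscale p) + order 0 (tscale q) = d"
    using arg_cong[OF eq, of "order 0"] assms(2) nz by (simp add: order_mult order_0_monom)
  moreover have "order 0 (tscale p) \<le> tdeg p" "order 0 (tscale q) \<le> tdeg q"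
    using nz by (auto intro: order_degree)
  ultimately have o: "order 0 (tscale p) = tdeg p" by linarith
  have "homogeneous (tdeg p) p"
  proof -
    define k where "k = tdeg p"
    obtain r where r: "tscale p = [:-0, 1:] ^ k * r"
      using order_1[of 0 "tscale p"] unfolding o dvd_def k_def by blast
    moreover have "r \<noteq> 0" using nz r by auto
    ultimately have "k = k + Polynomial.degree r"
      using arg_cong[OF r, of Polynomial.degree] unfolding k_def[symmetric] by (simp add: degree_mult_eq degree_power_eq)
    then obtain c where "r = [:c:]" by (metis add_cancel_right_right degree_eq_zeroE)
    then have *: "tscale p = Polynomial.monom c k" using r by (simp add: monom_altdef)
    then have "c = p" by (metis tscale_poly_1 poly_monom power_one mult.right_neutral)
    with * show ?thesis unfolding homogeneous_iff k_def[symmetric] by simp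
  qed
  then show ?thesis using that \<open>tdeg p + tdeg q = d\<close> by blast
qed

lemma tdeg_0_const: assumes "tdeg p = 0" obtains c where "p = mconst c"
proof
  have "m = 0" if "m \<in> Poly_Mapping.keys p" for m
    using mon_deg_le_tdeg[OF that] assms by simp
  then show "p = mconst (Poly_Mapping.lookup p 0)"
    by (intro poly_mapping_eqI) (auto simp: mconst_def lookup_single when_def in_keys_iff)
qed

lemma mconst_eq_0_iff [simp]: "mconst c = 0 \<longleftrightarrow> c = 0"
proof
  assume "mconst c = 0"
  then have "Poly_Mapping.lookup (mconst c) 0 = 0" by simp
  then show "c = 0" by (simp add: mconst_def)
qed simp

lemma mpoly_unit_iff: "(p :: 'a::field mpoly) dvd 1 \<longleftrightarrow> p \<noteq> 0 \<and> tdeg p = 0"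
proof
  assume "p dvd 1"
  then obtain q where q: "1 = p * q" by (auto simp: dvd_def)
  then have "p * q \<noteq> 0" by simp
  then have "p \<noteq> 0" "q \<noteq> 0" by auto
  then show "p \<noteq> 0 \<and> tdeg p = 0" using tdeg_mult[of p q] q by (metis add_is_0 degree_1 tscale.hom_one)
next
  assume *: "p \<noteq> 0 \<and> tdeg p = 0"
  then obtain c where c: "p = mconst c" using tdeg_0_const by blast
  then have "c \<noteq> 0" using * by auto
  then have "p * mconst (inverse c) = 1" using c by (simp add: mconst_mult[symmetric])
  then show "p dvd 1" by (rule dvdI[OF sym])
qed

section \<open>Polynomials viewed as univariate in one chosen variable\<close>

definition split_var :: "nat \<Rightarrow> 'a::comm_ring_1 mpoly \<Rightarrow> 'a mpoly poly"
  where "split_var x = mp_eval (\<lambda>c. [:mconst c:]) (\<lambda>i. if i = x then [:0, 1:] else [:mvar i:])"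

interpretation split_var: comm_ring_hom "split_var x" for x
  unfolding split_var_def by (rule mconst2.comm_ring_hom_mp_eval)

lemma split_var_mvar: "split_var x (mvar i) = (if i = x then [:0, 1:] else [:mvar i:])"
  by (simp add: split_var_def)
lemma split_var_mconst: "split_var x (mconst c) = [:mconst c:]"
  by (simp add: split_var_def)

abbreviation deg_in :: "nat \<Rightarrow> 'a::comm_ring_1 mpoly \<Rightarrow> nat" where "deg_in x p \<equiv> Polynomial.degree (split_var x p)"

lemma poly_split_var [simp]: "poly (split_var x p) (mvar x) = p"
proof -
  have "poly (split_var x p) (mvar x) = mp_eval (\<lambda>c. poly [:mconst c:] (mvar x)) (\<lambda>i. poly (if i = x then [:0, 1:] else [:mvar i:]) (mvar x)) p"
    unfolding split_var_def by (rule hom_mp_eval) (unfold_locales, auto)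
  also have "\<dots> = mp_eval mconst mvar p"
  proof -
    have "(\<lambda>i. poly (if i = x then [:0, 1:] else [:mvar i:]) (mvar x)) = (mvar :: nat \<Rightarrow> 'a mpoly)" by auto
    then show ?thesis by simp
  qed
  finally show ?thesis by simp
qed

lemma split_var_eq_iff [simp]: "split_var x p = split_var x q \<longleftrightarrow> p = q"
  using poly_split_var[of x p] poly_split_var[of x q] by metis

lemma split_var_eq_0_iff [simp]: "split_var x p = 0 \<longleftrightarrow> p = 0"
  using split_var_eq_iff[of x p 0] by simp

lemma split_var_const: assumes "x \<notin> mvars p" shows "split_var x p = [:p:]"
proof -
  have "split_var x p = mp_eval (\<lambda>c. [:mconst c:]) (\<lambda>i. [:mvar i:]) p"
    unfolding split_var_def by (rule mp_eval_cong) (use assms in auto)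
  also have "\<dots> = [:mp_eval mconst mvar p:]"
    by (rule hom_mp_eval[symmetric]) (rule comm_ring_hom_const_poly)
  finally show ?thesis by simp
qed

lemma mvars_coeff_split_var:
  assumes "mvars p \<subseteq> insert x V" "x \<notin> V"
  shows "mvars (Polynomial.coeff (split_var x p) i) \<subseteq> V"
  using assms(1)
proof (induction p arbitrary: i rule: mpoly_induct)
  case (const c) then show ?case by (auto simp: split_var_mconst coeff_pCons split: nat.split)
next
  case (var j) then show ?case using assms(2) by (auto simp: split_var_mvar coeff_pCons split: nat.splits)
next
  case (add p q) then show ?case using mvars_add by (fastforce simp: split_var.hom_add)
next
  case (mult p q) then show ?case unfolding split_var.hom_mult Polynomial.coeff_mult
    by (intro mvars_sum order_trans[OF mvars_mult]) auto
qed

lemma deg_in_eq_0_iff: "deg_in x p = 0 \<longleftrightarrow> x \<notin> mvars p"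
proof
  assume *: "deg_in x p = 0"
  then obtain c where c: "split_var x p = [:c:]" by (rule degree_eq_zeroE)
  then have "p = c" using poly_split_var[of x p] by simp
  moreover have "mvars (Polynomial.coeff (split_var x p) 0) \<subseteq> mvars p - {x}"
    by (rule mvars_coeff_split_var) auto
  ultimately show "x \<notin> mvars p" using c by auto
qed (simp add: split_var_const)

lemma deg_in_mult: "p \<noteq> 0 \<Longrightarrow> q \<noteq> 0 \<Longrightarrow> deg_in x (p * q) = deg_in x p + deg_in x (q :: 'a::idom mpoly)"
  by (simp add: split_var.hom_mult degree_mult_eq)

text \<open>The degree in each single variable is additive, so a factor cannot contain a variable
  that the product lacks.\<close>

lemma mvars_factor:
  assumes "mvars (p * q) \<subseteq> V" "p * q \<noteq> 0" shows "mvars (p :: 'a::idom mpoly) \<subseteq> V"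
proof
  fix x assume x: "x \<in> mvars p"
  have "deg_in x (p * q) = deg_in x p + deg_in x q" by (rule deg_in_mult) (use assms in auto)
  then have "x \<in> mvars (p * q)" using x deg_in_eq_0_iff[of x p] deg_in_eq_0_iff[of x "p * q"] by simp
  then show "x \<in> V" using assms by blast
qed

lemma mvars_factor': "mvars (p * q) \<subseteq> V \<Longrightarrow> p * q \<noteq> 0 \<Longrightarrow> mvars (q :: 'a::idom mpoly) \<subseteq> V"
  using mvars_factor[of q p] by (simp add: mult.commute)

subsection \<open>Unique factorization\<close>

text \<open>Primality is relative to the polynomials in the variables \<open>V\<close>, so that an induction on \<open>V\<close> is possible.\<close>

definition prime_in :: "nat set \<Rightarrow> 'a::field mpoly \<Rightarrow> bool"
  where "prime_in V p \<longleftrightarrow> mvars p \<subseteq> V \<and> p \<noteq> 0 \<and> \<not> p dvd 1 \<and>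
     (\<forall>a b. mvars a \<subseteq> V \<longrightarrow> mvars b \<subseteq> V \<longrightarrow> p dvd a * b \<longrightarrow> p dvd a \<or> p dvd b)"

text \<open>Factorizations into prime elements, rather than irreducible ones, make uniqueness
  automatic.\<close>

definition factorial_in :: "nat set \<Rightarrow> 'a::field itself \<Rightarrow> bool"
  where "factorial_in V _ \<longleftrightarrow> (\<forall>a :: 'a mpoly. mvars a \<subseteq> V \<longrightarrow> a \<noteq> 0 \<longrightarrow>
     (\<exists>u ps. u dvd 1 \<and> (\<forall>p\<in>set ps. prime_in V p) \<and> a = u * prod_list ps))"

text \<open>Gauss's lemma. If i and j are the lowest indices of coefficients of a and b not
  divisible by p, then in the coefficient of index i + j of the product all summands but one are
  divisible by p.\<close>

lemma prime_in_insert: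
  assumes p: "prime_in V p" and x: "x \<notin> V"
  shows "prime_in (insert x V) p"
  unfolding prime_in_def
proof (intro conjI allI impI)
  show "mvars p \<subseteq> insert x V" "p \<noteq> 0" "\<not> p dvd 1" using p by (auto simp: prime_in_def)
  fix a b assume ab: "mvars a \<subseteq> insert x V" "mvars b \<subseteq> insert x V" "p dvd a * b"
  have sp: "split_var x p = [:p:]" using p x by (intro split_var_const) (auto simp: prime_in_def)
  have ca: "mvars (Polynomial.coeff (split_var x a) i) \<subseteq> V" for i by (rule mvars_coeff_split_var) fact+
  have cb: "mvars (Polynomial.coeff (split_var x b) i) \<subseteq> V" for i by (rule mvars_coeff_split_var) fact+
  have dv: "p dvd c" if "\<forall>i. p dvd Polynomial.coeff (split_var x c) i" for c
  proof -
    have "[:p:] dvd split_var x c" using that by (simp add: const_poly_dvd_iff)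
    then obtain r where "split_var x c = [:p:] * r" by (auto simp: dvd_def)
    then have "c = p * poly r (mvar x)" by (metis poly_split_var poly_mult poly_const_conv)
    then show ?thesis by simp
  qed
  have "split_var x p dvd split_var x (a * b)" using ab(3) by (metis dvdE dvd_triv_left split_var.hom_mult)
  then have dab: "p dvd Polynomial.coeff (split_var x a * split_var x b) i" for i
    unfolding sp split_var.hom_mult by (simp add: const_poly_dvd_iff)
  show "p dvd a \<or> p dvd b"
  proof (rule ccontr)
    assume "\<not> (p dvd a \<or> p dvd b)"
    then have ex: "\<exists>i. \<not> p dvd Polynomial.coeff (split_var x a) i" "\<exists>i. \<not> p dvd Polynomial.coeff (split_var x b) i"
      using dv by blast+
    define i where "i = (LEAST i. \<not> p dvd Polynomial.coeff (split_var x a) i)"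
    define j where "j = (LEAST i. \<not> p dvd Polynomial.coeff (split_var x b) i)"
    have i: "\<not> p dvd Polynomial.coeff (split_var x a) i" "\<And>k. k < i \<Longrightarrow> p dvd Polynomial.coeff (split_var x a) k"
      unfolding i_def using LeastI_ex[OF ex(1)] not_less_Least by blast+
    have j: "\<not> p dvd Polynomial.coeff (split_var x b) j" "\<And>k. k < j \<Longrightarrow> p dvd Polynomial.coeff (split_var x b) k"
      unfolding j_def using LeastI_ex[OF ex(2)] not_less_Least by blast+
    let ?f = "\<lambda>k. Polynomial.coeff (split_var x a) k * Polynomial.coeff (split_var x b) (i + j - k)"
    have "Polynomial.coeff (split_var x a * split_var x b) (i + j) = (\<Sum>k\<le>i+j. ?f k)"
      by (simp add: Polynomial.coeff_mult)
    also have "\<dots> = ?f i + (\<Sum>k\<in>{..i+j} - {i}. ?f k)" by (rule sum.remove) auto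
    finally have eq: "Polynomial.coeff (split_var x a * split_var x b) (i + j) = \<dots>" .
    have "p dvd (\<Sum>k\<in>{..i+j} - {i}. ?f k)"
    proof (rule dvd_sum)
      fix k assume "k \<in> {..i+j} - {i}"
      then have "k < i \<or> i + j - k < j" by auto
      then show "p dvd ?f k" using i(2) j(2) by (metis dvd_mult dvd_mult2)
    qed
    then have "p dvd ?f i" using dab[of "i + j"] unfolding eq by (simp add: dvd_add_left_iff)
    then have "p dvd Polynomial.coeff (split_var x a) i \<or> p dvd Polynomial.coeff (split_var x b) j"
      using p ca cb unfolding prime_in_def by simp
    then show False using i j by simp
  qed
qed

section \<open>Gauss's theorem: unique factorization survives the adjunction of one variable\<close>

context
  fixes V :: "nat set" and x :: nat and ty :: "'a::field itself"
  assumes fac: "factorial_in V ty" and x: "x \<notin> V"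
begin

private lemma const_factor:
  fixes c :: "'a mpoly"
  assumes "mvars c \<subseteq> V" "c \<noteq> 0"
  obtains u ps where "u dvd 1" "\<And>p. p \<in> set ps \<Longrightarrow> prime_in V p" "c = u * prod_list ps"
  using fac assms unfolding factorial_in_def by blast

text \<open>Each prime on the left divides one of the two factors on the right and can be cancelled
  there; what is cancelled is collected in \<open>c\<close> and \<open>d\<close>.\<close>

private lemma split_common:
  fixes f r s :: "'a mpoly"
  assumes "\<And>p. p \<in> set ps \<Longrightarrow> prime_in V p" "prod_list ps * f = r * s" "f \<noteq> 0"
    "mvars f \<subseteq> insert x V" "mvars r \<subseteq> insert x V" "mvars s \<subseteq> insert x V"
  shows "\<exists>c d r' s'. c \<noteq> 0 \<and> d \<noteq> 0 \<and> mvars c \<subseteq> V \<and> mvars d \<subseteq> V \<and> f = r' * s' \<and> r = c * r' \<and> s = d * s'"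
  using assms
proof (induction ps arbitrary: r s)
  case Nil
  then show ?case by (intro exI[of _ 1] exI[of _ r] exI[of _ s]) auto
next
  case (Cons p ps)
  have p: "prime_in V p" using Cons.prems by simp
  then have p': "prime_in (insert x V) p" using x by (rule prime_in_insert)
  have nz: "p \<noteq> 0" using p by (simp add: prime_in_def)
  have "prod_list ps \<noteq> 0" using Cons.prems(1) by (auto simp: prod_list_zero_iff prime_in_def)
  then have rsnz: "r * s \<noteq> 0" using Cons.prems(2,3) nz by (metis mult_eq_0_iff prod_list.Cons)
  have "p dvd r * s" using Cons.prems(2) by (metis dvd_triv_left mult.assoc prod_list.Cons)
  then have "p dvd r \<or> p dvd s" using p' Cons.prems unfolding prime_in_def by blast
  then show ?case
  proof
    assume "p dvd r"
    then obtain r1 where r1: "r = p * r1" by (auto simp: dvd_def)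
    have "mvars r1 \<subseteq> insert x V" by (rule mvars_factor'[of p]) (use r1 rsnz Cons.prems in auto)
    moreover have "prod_list ps * f = r1 * s" using Cons.prems(2) nz unfolding r1 by (simp add: mult.assoc)
    ultimately obtain c d r' s' where "c \<noteq> 0" "d \<noteq> 0" "mvars c \<subseteq> V" "mvars d \<subseteq> V" "f = r' * s'" "r1 = c * r'" "s = d * s'"
      using Cons.IH[of r1 s] Cons.prems by auto
    moreover have "mvars (p * c) \<subseteq> V" using mvars_mult[of p c] p calculation by (auto simp: prime_in_def)
    ultimately show ?thesis using nz r1 by (intro exI[of _ "p * c"] exI[of _ d] exI[of _ r'] exI[of _ s']) auto
  next
    assume "p dvd s"
    then obtain r1 where r1: "s = p * r1" by (auto simp: dvd_def)
    have "mvars r1 \<subseteq> insert x V" by (rule mvars_factor'[of p]) (use r1 rsnz Cons.prems in auto)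
    moreover have "prod_list ps * f = r * r1" using Cons.prems(2) nz unfolding r1 by (simp add: ac_simps)
    ultimately obtain c d r' s' where "c \<noteq> 0" "d \<noteq> 0" "mvars c \<subseteq> V" "mvars d \<subseteq> V" "f = r' * s'" "r = c * r'" "r1 = d * s'"
      using Cons.IH[of r r1] Cons.prems by auto
    moreover have "mvars (p * d) \<subseteq> V" using mvars_mult[of p d] p calculation by (auto simp: prime_in_def)
    ultimately show ?thesis using nz r1 by (intro exI[of _ c] exI[of _ "p * d"] exI[of _ r'] exI[of _ s']) auto
  qed
qed

text \<open>This replaces the passage to the fraction field of the coefficients: a factorization of
  f up to a denominator c free of x is turned into a factorization of f itself.\<close>

private lemma split_const:
  fixes c f r s :: "'a mpoly"
  assumes "mvars c \<subseteq> V" "c \<noteq> 0" "c * f = r * s" "f \<noteq> 0"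
    "mvars f \<subseteq> insert x V" "mvars r \<subseteq> insert x V" "mvars s \<subseteq> insert x V"
  obtains a b r' s' where "a \<noteq> 0" "b \<noteq> 0" "mvars a \<subseteq> V" "mvars b \<subseteq> V" "f = r' * s'" "r = a * r'" "s = b * s'"
proof -
  obtain u ps where ups: "u dvd 1" "\<And>p. p \<in> set ps \<Longrightarrow> prime_in V p" "c = u * prod_list ps"
    using const_factor[OF assms(1,2)] by blast
  then obtain w where w: "u * w = 1" by (metis dvdE)
  have "w \<noteq> 0" using w by auto
  have "tdeg w = 0" using w by (metis dvd_triv_right mpoly_unit_iff)
  then obtain k where k: "w = mconst k" by (rule tdeg_0_const)
  have "c * f * w = r * s * w" using assms(3) by simp
  then have "prod_list ps * f * (u * w) = (w * r) * s" unfolding ups(3) by (simp add: ac_simps)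
  then have "prod_list ps * f = (w * r) * s" using w by simp
  moreover have "mvars (w * r) \<subseteq> insert x V" using mvars_mult[of w r] k assms by auto
  ultimately obtain a b r' s' where *: "a \<noteq> 0" "b \<noteq> 0" "mvars a \<subseteq> V" "mvars b \<subseteq> V" "f = r' * s'" "w * r = a * r'" "s = b * s'"
    using split_common[of ps f "w * r" s] ups(2) assms by metis
  have "tdeg u = 0" "u \<noteq> 0" using ups(1) by (simp_all add: mpoly_unit_iff)
  then obtain l where l: "u = mconst l" using tdeg_0_const by blast
  have "mvars (u * a) \<subseteq> V" using mvars_mult[of u a] * l by auto
  moreover have "r = (u * a) * r'"
  proof -
    have "u * (w * r) = u * a * r'" using *(6) by (simp add: mult.assoc)
    then show ?thesis using w by (simp add: mult.assoc[symmetric])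
  qed
  ultimately show ?thesis using that[of "u * a" b r' s'] * \<open>u \<noteq> 0\<close> by simp
qed

text \<open>The leading coefficient of \<open>r\<close> need not be invertible, so instead of
  dividing by it one multiplies \<open>f\<close> by it in every step; \<open>c\<close> is the
  product of these multipliers.\<close>

private lemma pseudo_division:
  fixes f r :: "'a mpoly"
  assumes "r \<noteq> 0" "mvars r \<subseteq> insert x V" "mvars f \<subseteq> insert x V"
  shows "\<exists>c s. c \<noteq> 0 \<and> mvars c \<subseteq> V \<and> mvars s \<subseteq> insert x V \<and> (c * f = r * s \<or> deg_in x (c * f - r * s) < deg_in x r)"
  using assms(3)
proof (induction "deg_in x f" arbitrary: f rule: less_induct)
  case less
  define lr where "lr = Polynomial.coeff (split_var x r) (deg_in x r)"
  define lf where "lf = Polynomial.coeff (split_var x f) (deg_in x f)"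
  have lr: "mvars lr \<subseteq> V" "lr \<noteq> 0" unfolding lr_def using mvars_coeff_split_var[OF assms(2) x] assms(1) by auto
  have lf: "mvars lf \<subseteq> V" unfolding lf_def using mvars_coeff_split_var[OF less.prems x] by auto
  show ?case
  proof (cases "deg_in x f < deg_in x r \<or> f = 0")
    case True
    then show ?thesis by (intro exI[of _ 1] exI[of _ 0]) auto
  next
    case False
    define k where "k = deg_in x f - deg_in x r"
    define q where "q = lf * mvar x ^ k"
    have mq: "mvars q \<subseteq> insert x V" unfolding q_def
      by (rule order_trans[OF mvars_mult]) (use lf mvars_power[of "mvar x :: 'a mpoly" k] in auto)
    \<comment> \<open>The leading terms in x cancel.\<close>
    define f1 where "f1 = lr * f - q * r"
    have mf1: "mvars f1 \<subseteq> insert x V" unfolding f1_def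
      by (intro order_trans[OF mvars_diff] Un_least order_trans[OF mvars_mult]) (use lr mq less.prems assms in auto)
    have sq: "split_var x q = Polynomial.monom lf k"
      unfolding q_def split_var.hom_mult split_var.hom_power split_var_mvar
      using lf x by (subst split_var_const) (auto simp: monom_altdef)
    have sf1: "split_var x f1 = Polynomial.smult lr (split_var x f) - Polynomial.monom lf k * split_var x r"
      unfolding f1_def split_var.hom_minus split_var.hom_mult sq
      using lr x by (subst split_var_const) auto
    have "split_var x f1 = 0 \<or> deg_in x f1 < deg_in x f"
    proof (rule eq_zero_or_degree_less)
      show "deg_in x f1 \<le> deg_in x f" unfolding sf1
      proof (rule degree_diff_le)
        show "Polynomial.degree (Polynomial.monom lf k * split_var x r) \<le> deg_in x f"
          using degree_mult_le[of "Polynomial.monom lf k" "split_var x r"] degree_monom_le[of lf k] False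
          unfolding k_def by linarith
      qed simp
      have "Polynomial.coeff (Polynomial.monom lf k * split_var x r) (deg_in x f) = lf * lr"
        using False by (simp add: coeff_monom_mult k_def lr_def)
      then show "Polynomial.coeff (split_var x f1) (deg_in x f) = 0"
        unfolding sf1 by (simp add: lf_def)
    qed
    then have "f1 = 0 \<or> (\<exists>c s. c \<noteq> 0 \<and> mvars c \<subseteq> V \<and> mvars s \<subseteq> insert x V \<and> (c * f1 = r * s \<or> deg_in x (c * f1 - r * s) < deg_in x r))"
      using less.hyps[OF _ mf1] by auto
    then obtain c s where cs: "c \<noteq> 0" "mvars c \<subseteq> V" "mvars s \<subseteq> insert x V" "c * f1 = r * s \<or> deg_in x (c * f1 - r * s) < deg_in x r"
    proof
      assume "f1 = 0" then show ?thesis using that[of 1 0] by simp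
    qed blast
    have "c * f1 - r * s = (c * lr) * f - r * (s + c * q)" unfolding f1_def by (simp add: algebra_simps)
    then have "(c * lr) * f = r * (s + c * q) \<or> deg_in x ((c * lr) * f - r * (s + c * q)) < deg_in x r"
      using cs(4) by auto
    moreover have "mvars (c * lr) \<subseteq> V" using mvars_mult[of c lr] cs lr by auto
    moreover have "mvars (s + c * q) \<subseteq> insert x V"
      by (intro order_trans[OF mvars_add] Un_least order_trans[OF mvars_mult]) (use cs mq in auto)
    moreover have "c * lr \<noteq> 0" using cs lr by simp
    ultimately show ?thesis by blast
  qed
qed

text \<open>By \<open>split_const\<close> the factor c is absorbed by coefficients free of x, and f
  is such a coefficient times a factor of g. By irreducibility one of the two is a unit; since f
  involves x, it is the coefficient.\<close>

private lemma irreducible_cancel: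
  fixes f :: "'a mpoly"
  assumes f: "irreducible f" "mvars f \<subseteq> insert x V" "deg_in x f > 0"
    and c: "mvars c \<subseteq> V" "c \<noteq> 0" and g: "mvars g \<subseteq> insert x V" and dv: "f dvd c * g"
  shows "f dvd g"
proof (cases "g = 0")
  case False
  obtain s where s: "c * g = f * s" using dv by (auto simp: dvd_def)
  have ms: "mvars s \<subseteq> insert x V"
  proof (rule mvars_factor'[of f])
    show "mvars (f * s) \<subseteq> insert x V" unfolding s[symmetric] using c g mvars_mult[of c g] by blast
    show "f * s \<noteq> 0" unfolding s[symmetric] using False c by simp
  qed
  obtain a b r' s' where *: "a \<noteq> 0" "b \<noteq> 0" "mvars a \<subseteq> V" "mvars b \<subseteq> V" "g = r' * s'" "f = a * r'" "s = b * s'"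
    using split_const[OF c s False g f(2) ms] by blast
  have "a dvd 1 \<or> r' dvd 1" using f(1) *(6) by (auto simp: irreducible_def)
  moreover have "\<not> r' dvd 1"
  proof
    assume "r' dvd 1"
    then have "tdeg r' = 0" "r' \<noteq> 0" by (auto simp: mpoly_unit_iff)
    then obtain l where "r' = mconst l" using tdeg_0_const by blast
    then have "x \<notin> mvars f" using *(3,6) mvars_mult[of a r'] x by auto
    then show False using f(3) deg_in_eq_0_iff[of x f] by simp
  qed
  ultimately obtain w where "a * w = 1" by (metis dvdE)
  then have "r' = f * w" using *(6) by (simp add: ac_simps)
  then show ?thesis using *(5) by simp
qed simp

text \<open>An element r of least degree in x among the nonzero combinations of f and g divides each
  combination up to a factor free of x, by pseudo-division. So r plays the part of the greatest
  common divisor over the fraction field. Either r equals f up to factors free of x, and then f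
  divides g, or r itself is free of x, and then f divides r h and hence h.\<close>

private lemma irreducible_prime:
  fixes f :: "'a mpoly"
  assumes f: "irreducible f" "mvars f \<subseteq> insert x V" "deg_in x f > 0"
  shows "prime_in (insert x V) f"
  unfolding prime_in_def
proof (intro conjI allI impI)
  show "mvars f \<subseteq> insert x V" "f \<noteq> 0" "\<not> f dvd 1" using f by (auto simp: irreducible_def)
  fix g h assume gh: "mvars g \<subseteq> insert x V" "mvars h \<subseteq> insert x V" "f dvd g * h"
  define I where "I = {r. r \<noteq> 0 \<and> mvars r \<subseteq> insert x V \<and> (\<exists>u v. mvars u \<subseteq> insert x V \<and> mvars v \<subseteq> insert x V \<and> r = u * f + v * g)}"
  have "f = 1 * f + 0 * g" "mvars (1 :: 'a mpoly) \<subseteq> insert x V" "mvars (0 :: 'a mpoly) \<subseteq> insert x V" by auto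
  moreover have "f \<noteq> 0" using f(1) by (auto simp: irreducible_def)
  ultimately have "f \<in> I" unfolding I_def using f(2) by blast
  then obtain r where rI: "r \<in> I" and rmin: "\<And>s. s \<in> I \<Longrightarrow> deg_in x r \<le> deg_in x s"
    using ex_has_least_nat[of "\<lambda>r. r \<in> I" f "deg_in x"] by blast
  obtain u v where uv: "mvars u \<subseteq> insert x V" "mvars v \<subseteq> insert x V" "r = u * f + v * g"
    and r: "r \<noteq> 0" "mvars r \<subseteq> insert x V" using rI unfolding I_def by blast
  have div: "\<exists>c s. c \<noteq> 0 \<and> mvars c \<subseteq> V \<and> mvars s \<subseteq> insert x V \<and> c * k = r * s"
    if k: "mvars k \<subseteq> insert x V" and ku: "k = u' * f + v' * g" "mvars u' \<subseteq> insert x V" "mvars v' \<subseteq> insert x V" for k u' v'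
  proof -
    obtain c s where cs: "c \<noteq> 0" "mvars c \<subseteq> V" "mvars s \<subseteq> insert x V" "c * k = r * s \<or> deg_in x (c * k - r * s) < deg_in x r"
      using pseudo_division[OF r k] by blast
    have "c * k = r * s"
    proof (rule ccontr)
      assume ne: "c * k \<noteq> r * s"
      have "c * k - r * s = (c * u' - s * u) * f + (c * v' - s * v) * g"
        unfolding ku(1) uv(3) by (simp add: algebra_simps)
      moreover have "mvars (c * u' - s * u) \<subseteq> insert x V" "mvars (c * v' - s * v) \<subseteq> insert x V" "mvars (c * k - r * s) \<subseteq> insert x V"
        by (intro order_trans[OF mvars_diff] Un_least order_trans[OF mvars_mult]; use cs ku uv k r in auto)+
      ultimately have "c * k - r * s \<in> I" unfolding I_def using ne by auto
      then show False using rmin cs(4) ne by fastforce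
    qed
    then show ?thesis using cs by blast
  qed
  show "f dvd g \<or> f dvd h"
  proof (cases "f dvd g")
    case False
    have "f \<noteq> 0" "g \<noteq> 0" using f False by (auto simp: irreducible_def)
    obtain c s where cs: "c \<noteq> 0" "mvars c \<subseteq> V" "mvars s \<subseteq> insert x V" "c * f = r * s"
      using div[of f 1 0] f by auto
    obtain a b r' s' where ab: "a \<noteq> 0" "b \<noteq> 0" "mvars a \<subseteq> V" "mvars b \<subseteq> V" "f = r' * s'" "r = a * r'" "s = b * s'"
      using split_const[OF cs(2,1,4) \<open>f \<noteq> 0\<close> f(2) r(2) cs(3)] by blast
    have "r' dvd 1 \<or> s' dvd 1" using f(1) ab(5) by (auto simp: irreducible_def)
    moreover have "\<not> s' dvd 1"
    proof
      assume "s' dvd 1"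
      then obtain w where w: "s' * w = 1" by (metis dvdE)
      obtain c1 s1 where c1: "c1 \<noteq> 0" "mvars c1 \<subseteq> V" "mvars s1 \<subseteq> insert x V" "c1 * g = r * s1"
        using div[of g 0 1] gh by auto
      have "r' = f * w" using w ab(5) by (simp add: ac_simps)
      then have "c1 * g = f * (w * a * s1)" using c1(4) ab(6) by (simp add: ac_simps)
      then have "f dvd c1 * g" by simp
      then have "f dvd g" using irreducible_cancel[OF f c1(2,1) gh(1)] by blast
      then show False using False by simp
    qed
    ultimately have "r' dvd 1" by blast
    then have "tdeg r' = 0" by (simp add: mpoly_unit_iff)
    then obtain l where "r' = mconst l" by (rule tdeg_0_const)
    then have "mvars r \<subseteq> V" using ab(3,6) mvars_mult[of a r'] by auto
    moreover have "f dvd r * h" unfolding uv(3) using gh(3)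
      by (metis (no_types, lifting) dvd_add dvd_mult dvd_triv_right distrib_right mult.assoc mult.commute)
    ultimately show ?thesis using irreducible_cancel[OF f _ r(1) gh(2)] by blast
  qed simp
qed

text \<open>Units are the nonzero constants, so both factors of a reducible element have smaller
  total degree. An irreducible element without x is factored in the smaller ring.\<close>

lemma factorial_in_insert: "factorial_in (insert x V) ty"
  unfolding factorial_in_def
proof (intro allI impI)
  fix a :: "'a mpoly"
  assume "mvars a \<subseteq> insert x V" "a \<noteq> 0"
  then show "\<exists>u ps. u dvd 1 \<and> (\<forall>p\<in>set ps. prime_in (insert x V) p) \<and> a = u * prod_list ps"
  proof (induction "tdeg a" arbitrary: a rule: less_induct)
    case less
    show ?case
    proof (cases "a dvd 1")
      case True
      then show ?thesis by (intro exI[of _ a] exI[of _ "[]"]) auto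
    next
      case nu: False
      show ?thesis
      proof (cases "irreducible a")
        case True
        show ?thesis
        proof (cases "deg_in x a = 0")
          case True
          then have "mvars a \<subseteq> V" using less.prems deg_in_eq_0_iff[of x a] by auto
          then obtain u ps where "u dvd 1" "\<And>p. p \<in> set ps \<Longrightarrow> prime_in V p" "a = u * prod_list ps"
            using const_factor less.prems by blast
          then show ?thesis using prime_in_insert[OF _ x] by blast
        next
          case False
          then have "prime_in (insert x V) a" using irreducible_prime[OF True] less.prems by simp
          then show ?thesis by (intro exI[of _ 1] exI[of _ "[a]"]) auto
        qed
      next
        case False
        then obtain b c where bc: "a = b * c" "\<not> b dvd 1" "\<not> c dvd 1" using nu less.prems by (auto simp: irreducible_def)
        then have nz: "b \<noteq> 0" "c \<noteq> 0" using less.prems by auto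
        then have "tdeg b < tdeg a" "tdeg c < tdeg a" using bc tdeg_mult[OF nz] by (auto simp: mpoly_unit_iff)
        moreover have "mvars b \<subseteq> insert x V" "mvars c \<subseteq> insert x V"
          using mvars_factor[of b c] mvars_factor'[of b c] less.prems bc by auto
        ultimately obtain u ps w qs where "u dvd 1" "\<forall>p\<in>set ps. prime_in (insert x V) p" "b = u * prod_list ps"
          "w dvd 1" "\<forall>p\<in>set qs. prime_in (insert x V) p" "c = w * prod_list qs"
          using less.hyps nz by metis
        then show ?thesis using bc(1)
          by (intro exI[of _ "u * w"] exI[of _ "ps @ qs"]) (auto simp: ac_simps is_unit_mult_iff)
      qed
    qed
  qed
qed

end

lemma factorial_in_finite: "finite V \<Longrightarrow> factorial_in V TYPE('a::field)"
proof (induction rule: finite_induct)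
  case empty
  show ?case unfolding factorial_in_def
  proof (intro allI impI)
    fix a :: "'a mpoly" assume a: "mvars a \<subseteq> {}" "a \<noteq> 0"
    have "mon_deg m = 0" if "m \<in> Poly_Mapping.keys a" for m
      using a(1) that by (auto simp: mvars_def mon_deg_def)
    then have "tdeg a = 0" using tdeg_le_iff[of a 0] by auto
    then have "a dvd 1" using a by (simp add: mpoly_unit_iff)
    then show "\<exists>u ps. u dvd 1 \<and> (\<forall>p\<in>set ps. prime_in {} p) \<and> a = u * prod_list ps"
      by (intro exI[of _ a] exI[of _ "[]"]) auto
  qed
next
  case (insert x V)
  then show ?case by (intro factorial_in_insert)
qed

subsection \<open>Reduced representatives\<close>

lemma proportional_refl [simp]: "proportional F F" by (simp add: proportional_def mult.commute)
lemma proportional_sym: "proportional F G \<Longrightarrow> proportional G F" by (simp add: proportional_def mult.commute)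
lemma proportional_trans:
  assumes "proportional F G" "proportional G H" "G k \<noteq> 0" shows "proportional F H"
  unfolding proportional_def
proof (intro allI)
  fix i j
  have "G k * G k * (F i * H j) = (F i * G k) * (G k * H j)" by (simp add: ac_simps)
  also have "\<dots> = (F k * G i) * (G j * H k)" using assms(1,2) by (simp add: proportional_def)
  also have "\<dots> = (F k * G j) * (G i * H k)" by (simp add: ac_simps)
  also have "\<dots> = (F j * G k) * (G k * H i)"
    using assms(1,2) unfolding proportional_def by (metis mult.commute)
  also have "\<dots> = G k * G k * (F j * H i)" by (simp add: ac_simps)
  finally show "F i * H j = F j * H i" using assms(3) by simp
qed

lemma rat_reps_nonzero: "F \<in> rat_reps S T \<Longrightarrow> \<exists>k\<le>space_dim T. F k \<noteq> 0"
  by (cases T) (force simp: rat_reps_def not_le[symmetric])+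

lemma rat_class_self: "F \<in> rat_reps S T \<Longrightarrow> F \<in> rat_class S T F" by (simp add: rat_class_def)

lemma rat_class_eq:
  assumes "F \<in> rat_reps S T" "G \<in> rat_reps S T" "proportional F G"
  shows "rat_class S T F = rat_class S T G"
  using assms proportional_trans proportional_sym rat_reps_nonzero unfolding rat_class_def by blast

lemma RatMaps_member:
  assumes "f \<in> RatMaps S T" "F \<in> f" shows "F \<in> rat_reps S T" "f = rat_class S T F"
proof -
  obtain F0 where F0: "F0 \<in> rat_reps S T" "f = rat_class S T F0" using assms(1) by (auto simp: RatMaps_def)
  then show "F \<in> rat_reps S T" using assms(2) by (simp add: rat_class_def)
  then show "f = rat_class S T F" using rat_class_eq[of F0 S T F] F0 assms(2) by (auto simp: rat_class_def)
qed

lemma RatMaps_obtain: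
  assumes "f \<in> RatMaps S T" obtains F where "F \<in> f" "F \<in> rat_reps S T" "f = rat_class S T F"
proof -
  obtain F where "F \<in> rat_reps S T" "f = rat_class S T F" using assms by (auto simp: RatMaps_def)
  then show ?thesis using that[of F] rat_class_self by blast
qed

lemma RatMaps_proportional: "f \<in> RatMaps S T \<Longrightarrow> F \<in> f \<Longrightarrow> G \<in> f \<Longrightarrow> proportional F G"
  using RatMaps_member[of f S T F] by (auto simp: rat_class_def)

lemma RatMaps_classI: "F \<in> rat_reps S T \<Longrightarrow> rat_class S T F \<in> RatMaps S T" by (simp add: RatMaps_def)

lemma finite_space_coords [simp]: "finite (space_coords S)" by (cases S) auto

lemma rat_reps_divide:
  assumes F: "F \<in> rat_reps S T" and p: "p \<noteq> 0" "\<And>i. F i = p * F' i"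
  shows "F' \<in> rat_reps S T"
proof -
  have z: "F' i = 0 \<longleftrightarrow> F i = 0" for i using p by simp
  have "mvars (F' i) \<subseteq> space_coords S" for i
  proof (cases "F i = 0")
    case True then have "F' i = 0" using z by blast
    then show ?thesis by simp
  next
    case False
    have "mvars (F i) \<subseteq> space_coords S" using F by (simp add: rat_reps_def)
    then show ?thesis using mvars_factor'[of p "F' i"] False unfolding p(2) by simp
  qed
  moreover have "\<exists>d. \<forall>i. homogeneous d (F' i)" if S: "S = Proj n" for n
  proof -
    obtain d where d: "\<And>i. homogeneous d (F i)" using F S by (auto simp: rat_reps_def)
    have "homogeneous (d - tdeg p) (F' i)" for i
    proof (cases "F i = 0")
      case True then have "F' i = 0" using z by blast
      then show ?thesis by simp
    next
      case False
      then obtain e where "homogeneous e (F' i)" "e + tdeg p = d"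
        using homogeneous_factor[of d "F' i" p] d[of i] p(2)[of i] by (metis mult.commute)
      then show ?thesis by auto
    qed
    then show ?thesis by blast
  qed
  ultimately show ?thesis using F z unfolding rat_reps_def by (auto split: space.splits)
qed

text \<open>Unique factorization provides a representative without common factors.\<close>

lemma reduced_representative:
  assumes f: "f \<in> RatMaps S T"
  shows "\<exists>F\<in>f. \<forall>G\<in>f. \<exists>c. \<forall>i. G i = c * F i"
proof -
  let ?N = "\<lambda>F. \<Sum>i\<le>space_dim T. tdeg (F i)"
  obtain F0 where "F0 \<in> f" using RatMaps_obtain[OF f] by blast
  then obtain F where F: "F \<in> f" and min: "\<And>G. G \<in> f \<Longrightarrow> ?N F \<le> ?N G"
    using ex_has_least_nat[of "\<lambda>F. F \<in> f" F0 ?N] by blast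
  have Fr: "F \<in> rat_reps S T" "f = rat_class S T F" using RatMaps_member[OF f F] by auto
  let ?V = "space_coords S"
  have Fv: "mvars (F i) \<subseteq> ?V" for i using Fr by (simp add: rat_reps_def)
  \<comment> \<open>A common factor could be divided out of all components, which would lower the
    minimal total degree.\<close>
  have nodiv: "\<not> (\<forall>i. p dvd F i)" if p: "p \<noteq> 0" "\<not> p dvd 1" for p
  proof
    assume "\<forall>i. p dvd F i"
    then obtain F' where F': "\<And>i. F i = p * F' i" unfolding dvd_def by metis
    have F'r: "F' \<in> rat_reps S T" using rat_reps_divide[OF Fr(1) p(1) F'] .
    have "proportional F F'" unfolding proportional_def F' by (simp add: ac_simps)
    then have "F' \<in> f" using F'r Fr by (simp add: rat_class_def)
    then have le: "?N F \<le> ?N F'" by (rule min)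
    obtain k where k: "k \<le> space_dim T" "F k \<noteq> 0" using rat_reps_nonzero[OF Fr(1)] by blast
    have p1: "tdeg p > 0" using p by (simp add: mpoly_unit_iff)
    have t: "tdeg (F i) = tdeg p + tdeg (F' i)" if "F i \<noteq> 0" for i
      using that tdeg_mult[of p "F' i"] F'[of i] by auto
    have "?N F' < ?N F"
    proof (rule sum_strict_mono_ex1)
      show "\<forall>i\<in>{..space_dim T}. tdeg (F' i) \<le> tdeg (F i)"
      proof
        fix i show "tdeg (F' i) \<le> tdeg (F i)" using t[of i] F'[of i] p by (cases "F i = 0") auto
      qed
      show "\<exists>i\<in>{..space_dim T}. tdeg (F' i) < tdeg (F i)" using k t[of k] p1 by (intro bexI[of _ k]) auto
    qed simp
    then show False using le by simp
  qed
  \<comment> \<open>The primes are cancelled one after another: each of them fails to divide some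
    component of \<open>F\<close>, hence divides \<open>b\<close>.\<close>
  have step: "\<exists>c. \<forall>i. G i = c * F i"
    if "\<And>p. p \<in> set ps \<Longrightarrow> prime_in ?V p" "\<And>i. prod_list ps * G i = b * F i" "mvars b \<subseteq> ?V" for ps b and G :: "'a tuple"
    using that
  proof (induction ps arbitrary: b)
    case Nil then show ?case by (intro exI[of _ b]) simp
  next
    case (Cons p ps)
    have p: "prime_in ?V p" using Cons.prems by simp
    then obtain i where i: "\<not> p dvd F i" using nodiv unfolding prime_in_def by blast
    have "p dvd b * F i" using Cons.prems(2)[of i] by (metis dvd_triv_left mult.assoc prod_list.Cons)
    then have "p dvd b" using p i Fv Cons.prems(3) unfolding prime_in_def by blast
    then obtain b' where b': "b = p * b'" by (auto simp: dvd_def)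
    have pn: "p \<noteq> 0" using p by (simp add: prime_in_def)
    have "mvars b' \<subseteq> ?V"
    proof (cases "b = 0")
      case True then show ?thesis using b' pn by simp
    next
      case False then show ?thesis using mvars_factor'[of p b'] b' Cons.prems(3) by simp
    qed
    moreover have "prod_list ps * G i = b' * F i" for i
      using Cons.prems(2)[of i] pn unfolding b' by (simp add: mult.assoc)
    ultimately show ?case using Cons.IH[of b'] Cons.prems(1) by simp
  qed
  show ?thesis
  proof (intro bexI[of _ F] ballI)
    show "F \<in> f" by fact
    fix G assume G: "G \<in> f"
    then have Gr: "G \<in> rat_reps S T" "proportional F G" using RatMaps_member[OF f] RatMaps_proportional[OF f F] by auto
    obtain k where k: "F k \<noteq> 0" using rat_reps_nonzero[OF Fr(1)] by blast
    obtain u ps where ups: "u dvd 1" "\<And>p. p \<in> set ps \<Longrightarrow> prime_in ?V p" "F k = u * prod_list ps"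
      using factorial_in_finite[OF finite_space_coords[of S], where 'a='a, unfolded factorial_in_def, rule_format, OF Fv[of k] k] by blast
    then obtain w where w: "u * w = 1" by (metis dvdE)
    have "tdeg w = 0" using w by (metis dvd_triv_right mpoly_unit_iff)
    then obtain l where l: "w = mconst l" by (rule tdeg_0_const)
    have "prod_list ps * G i = (w * G k) * F i" for i
    proof -
      have "(u * w) * (prod_list ps * G i) = w * (F k * G i)" unfolding ups(3) by (simp add: ac_simps)
      also have "\<dots> = w * (F i * G k)" using Gr(2) by (simp add: proportional_def)
      finally show ?thesis using w by (simp add: ac_simps)
    qed
    moreover have "mvars (w * G k) \<subseteq> ?V" using mvars_mult[of w "G k"] l Gr(1) by (auto simp: rat_reps_def)
    ultimately show "\<exists>c. \<forall>i. G i = c * F i" by (intro step[of ps G "w * G k"] ups(2))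
  qed
qed

subsection \<open>Evaluation at points over the field of rational functions\<close>

definition tf :: "'a::idom \<Rightarrow> 'a fract" where "tf p = Fract p 1"

interpretation tf: comm_ring_hom tf
  by unfold_locales (auto simp: tf_def Zero_fract_def One_fract_def)

lemma tf_eq_iff [simp]: "tf p = tf q \<longleftrightarrow> p = q" by (simp add: tf_def eq_fract)
lemma tf_eq_0_iff [simp]: "tf p = 0 \<longleftrightarrow> p = 0" using tf_eq_iff[of p 0] by simp

definition kc :: "'a::field \<Rightarrow> 'a mpoly fract" where "kc c = tf (mconst c)"

interpretation kc: comm_ring_hom kc
  unfolding kc_def by (rule comm_ring_hom_comp[OF tf.comm_ring_hom_axioms comm_ring_hom_mconst])

lemma kc_eq_0_iff [simp]: "kc c = 0 \<longleftrightarrow> c = 0" by (simp add: kc_def)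

abbreviation pev :: "(nat \<Rightarrow> 'a::field mpoly fract) \<Rightarrow> 'a mpoly \<Rightarrow> 'a mpoly fract" where "pev \<equiv> mp_eval kc"

lemma pev_mp_eval: "pev v (mp_eval mconst F p) = pev (\<lambda>l. pev v (F l)) p"
  using hom_mp_eval[OF kc.comm_ring_hom_mp_eval, of v mconst F p] by simp

lemma tf_mp_eval: "tf (mp_eval mconst F p) = pev (\<lambda>l. tf (F l)) p"
  using hom_mp_eval[OF tf.comm_ring_hom_axioms, of mconst F p] by (simp add: kc_def[abs_def])

lemma tf_pev: "pev (\<lambda>i. tf (mvar i)) p = tf p"
  using tf_mp_eval[of mvar p] by simp

section \<open>Vectors up to a common factor\<close>

definition vprop :: "(nat \<Rightarrow> 'b::field) \<Rightarrow> (nat \<Rightarrow> 'b) \<Rightarrow> bool"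
  where "vprop v w \<longleftrightarrow> (\<forall>i j. v i * w j = v j * w i)"

lemma proportional_iff: "proportional F G \<longleftrightarrow> vprop (\<lambda>i. tf (F i)) (\<lambda>i. tf (G i))"
  by (simp add: proportional_def vprop_def tf.hom_mult[symmetric])

text \<open>In contrast to \<open>vprop\<close>, which relates the zero vector to every vector, this
  is an equivalence relation.\<close>

definition peq :: "(nat \<Rightarrow> 'b::field) \<Rightarrow> (nat \<Rightarrow> 'b) \<Rightarrow> bool"
  where "peq v w \<longleftrightarrow> (\<exists>c. c \<noteq> 0 \<and> (\<forall>i. v i = c * w i))"

lemma peq_refl [simp]: "peq v v" unfolding peq_def by (intro exI[of _ 1]) auto
lemma peq_sym: assumes "peq v w" shows "peq w v"
proof -
  obtain c where "c \<noteq> 0" "\<And>i. v i = c * w i" using assms by (auto simp: peq_def)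
  then show ?thesis unfolding peq_def by (intro exI[of _ "inverse c"]) auto
qed
lemma peq_trans: assumes "peq u v" "peq v w" shows "peq u w"
proof -
  obtain c where "c \<noteq> 0" "\<And>i. u i = c * v i" using assms by (auto simp: peq_def)
  moreover obtain d where "d \<noteq> 0" "\<And>i. v i = d * w i" using assms by (auto simp: peq_def)
  ultimately show ?thesis unfolding peq_def by (intro exI[of _ "c * d"]) auto
qed
lemma peqI: "c \<noteq> 0 \<Longrightarrow> (\<And>i. v i = c * w i) \<Longrightarrow> peq v w" by (auto simp: peq_def)
lemma peq_vprop: "peq v w \<Longrightarrow> vprop v w" by (auto simp: peq_def vprop_def)
lemma vprop_peq:
  assumes "vprop v w" "v i \<noteq> 0" "w j \<noteq> 0" shows "peq v w"
proof -
  have e: "v k * w j = v j * w k" for k using assms by (simp add: vprop_def)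
  then have "v j \<noteq> 0" using e[of i] assms by auto
  then show ?thesis using assms(3) e by (intro peqI[of "v j / w j"]) (auto simp: field_simps)
qed

lemma RatMaps_peq:
  assumes "f \<in> RatMaps S T" "F \<in> f" "G \<in> f"
  shows "peq (\<lambda>i. tf (F i)) (\<lambda>i. tf (G i))"
proof -
  obtain i where "F i \<noteq> 0" using rat_reps_nonzero[OF RatMaps_member(1)[OF assms(1,2)]] by blast
  moreover obtain j where "G j \<noteq> 0" using rat_reps_nonzero[OF RatMaps_member(1)[OF assms(1,3)]] by blast
  ultimately show ?thesis using RatMaps_proportional[OF assms] by (intro vprop_peq[of _ _ i j]) (auto simp: proportional_iff)
qed

lemma peq_rat_class_eq:
  assumes "F \<in> rat_reps S T" "G \<in> rat_reps S T" "peq (\<lambda>i. tf (F i)) (\<lambda>i. tf (G i))"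
  shows "rat_class S T F = rat_class S T G"
  using assms by (intro rat_class_eq) (auto simp: proportional_iff peq_vprop)

text \<open>The value at \<open>w\<close> of a map with source \<open>T\<close>; homogeneous coordinates are used also if \<open>T\<close> is affine.\<close>

fun act :: "space \<Rightarrow> ('a::field) tuple \<Rightarrow> (nat \<Rightarrow> 'a mpoly fract) \<Rightarrow> nat \<Rightarrow> 'a mpoly fract"
  where "act (Proj n) G w = (\<lambda>i. pev w (G i))"
  | "act (Aff n) G w = (\<lambda>i. pev (\<lambda>l. w l / w 0) (G i))"

lemma tuple_deg_bound:
  assumes "G \<in> rat_reps T U" "m \<in> Poly_Mapping.keys (G i)" shows "mon_deg m \<le> tuple_deg G"
proof -
  let ?P = "\<lambda>d. \<forall>i. \<forall>m\<in>Poly_Mapping.keys (G i). mon_deg m \<le> d"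
  have "?P (\<Sum>i\<le>space_dim U. tdeg (G i))"
  proof (intro allI ballI)
    fix i m assume m: "m \<in> Poly_Mapping.keys (G i)"
    then have "G i \<noteq> 0" by auto
    then have i: "i \<le> space_dim U" using assms(1) by (auto simp: rat_reps_def not_le[symmetric])
    have "mon_deg m \<le> tdeg (G i)" using m by (rule mon_deg_le_tdeg)
    also have "\<dots> \<le> (\<Sum>i\<le>space_dim U. tdeg (G i))" using i by (intro member_le_sum) auto
    finally show "mon_deg m \<le> \<dots>" .
  qed
  then have "?P (tuple_deg G)" unfolding tuple_deg_def by (rule LeastI)
  then show ?thesis using assms(2) by blast
qed

lemma tuple_deg_eqI:
  assumes "\<And>i. homogeneous d (G i)" "G k \<noteq> 0" shows "tuple_deg G = d"
  unfolding tuple_deg_def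
proof (rule Least_equality)
  show "\<forall>i. \<forall>m\<in>Poly_Mapping.keys (G i). mon_deg m \<le> d" using assms(1) by (simp add: homogeneous_def)
  obtain m where m: "m \<in> Poly_Mapping.keys (G k)" using assms(2) keys_eq_empty by blast
  then have "mon_deg m = d" using assms(1) by (simp add: homogeneous_def)
  then show "d \<le> y" if "\<forall>i. \<forall>m\<in>Poly_Mapping.keys (G i). mon_deg m \<le> y" for y using that m by blast
qed

lemma tuple_comp_alt: "tuple_comp G F i = (\<Sum>m\<in>Poly_Mapping.keys (G i).
    mconst (Poly_Mapping.lookup (G i) m) * F 0 ^ (tuple_deg G - mon_deg m) * mon_val F m)"
  by (simp add: tuple_comp_def mon_val_def)

lemma tuple_comp_Proj:
  assumes "G \<in> rat_reps (Proj n) U" shows "tuple_comp G F i = mp_eval mconst F (G i)"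
proof -
  obtain d where d: "\<And>i. homogeneous d (G i)" using assms by (auto simp: rat_reps_def)
  obtain k where k: "G k \<noteq> 0" using rat_reps_nonzero[OF assms] by blast
  have "tuple_deg G = d" using tuple_deg_eqI[of d G, OF d k] .
  then show ?thesis using d[of i] by (simp add: tuple_comp_alt mp_eval_alt homogeneous_def)
qed

lemma (in comm_ring_hom) hom_mon_val: "hom (mon_val v m) = mon_val (\<lambda>i. hom (v i)) m"
  by (simp add: mon_val_def hom_distribs)

lemma pev_tuple_comp_Aff:
  assumes "G \<in> rat_reps (Aff n) U" "pev v (F 0) \<noteq> 0"
  shows "pev v (tuple_comp G F i) = pev v (F 0) ^ tuple_deg G * pev (\<lambda>l. pev v (F l) / pev v (F 0)) (G i)"
proof -
  interpret e: comm_ring_hom "pev v" by (rule kc.comm_ring_hom_mp_eval)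
  have mv: "mon_val (\<lambda>l. pev v (F l) / pev v (F 0)) m = mon_val (\<lambda>l. pev v (F l)) m / pev v (F 0) ^ mon_deg m" for m
    by (simp add: mon_val_def mon_deg_def power_divide prod_dividef power_sum)
  have "pev v (tuple_comp G F i) = (\<Sum>m\<in>Poly_Mapping.keys (G i).
     kc (Poly_Mapping.lookup (G i) m) * pev v (F 0) ^ (tuple_deg G - mon_deg m) * mon_val (\<lambda>l. pev v (F l)) m)"
    by (simp add: tuple_comp_alt e.hom_mult e.hom_power e.hom_sum e.hom_mon_val)
  also have "\<dots> = (\<Sum>m\<in>Poly_Mapping.keys (G i).
     pev v (F 0) ^ tuple_deg G * (kc (Poly_Mapping.lookup (G i) m) * mon_val (\<lambda>l. pev v (F l) / pev v (F 0)) m))"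
  proof (rule sum.cong)
    \<comment> \<open>The bound on \<open>mon_deg m\<close> makes the truncated subtraction of
      exponents a true one.\<close>
    fix m assume "m \<in> Poly_Mapping.keys (G i)"
    then have "mon_deg m \<le> tuple_deg G" by (rule tuple_deg_bound[OF assms(1)])
    then show "kc (Poly_Mapping.lookup (G i) m) * pev v (F 0) ^ (tuple_deg G - mon_deg m) * mon_val (\<lambda>l. pev v (F l)) m =
       pev v (F 0) ^ tuple_deg G * (kc (Poly_Mapping.lookup (G i) m) * mon_val (\<lambda>l. pev v (F l) / pev v (F 0)) m)"
      using assms(2) by (simp add: mv power_diff)
  qed simp
  finally show ?thesis by (simp add: mp_eval_alt sum_distrib_left)
qed

lemma tf_tuple_comp:
  assumes "F \<in> rat_reps S T" "G \<in> rat_reps T U"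
  shows "peq (\<lambda>i. tf (tuple_comp G F i)) (act T G (\<lambda>i. tf (F i)))"
proof (cases T)
  case (Proj n)
  then show ?thesis using tuple_comp_Proj[of G n U] assms by (simp add: tf_mp_eval)
next
  case (Aff n)
  then have "F 0 \<noteq> 0" using assms(1) by (simp add: rat_reps_def)
  then show ?thesis using pev_tuple_comp_Aff[of G n U "\<lambda>i. tf (mvar i)" F] assms Aff
    by (intro peqI[of "tf (F 0) ^ tuple_deg G"]) (auto simp: tf_pev)
qed

lemma act_scale:
  assumes "G \<in> rat_reps T U" "c \<noteq> 0" shows "peq (act T G (\<lambda>i. c * w i)) (act T G w)"
proof (cases T)
  case (Proj n)
  then obtain d where d: "\<And>i. homogeneous d (G i)" using assms by (auto simp: rat_reps_def)
  then show ?thesis using Proj assms(2) kc.mp_eval_homogeneous_scale[OF d] by (intro peqI[of "c ^ d"]) auto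
next
  case (Aff n) then show ?thesis using assms by simp
qed

lemma act_peq:
  assumes "G \<in> rat_reps T U" "peq v w" shows "peq (act T G v) (act T G w)"
proof -
  obtain c where "c \<noteq> 0" "v = (\<lambda>i. c * w i)" using assms(2) by (auto simp: peq_def)
  then show ?thesis using act_scale[OF assms(1)] by simp
qed

lemma peq_nonzero: "peq v w \<Longrightarrow> v i \<noteq> 0 \<Longrightarrow> w i \<noteq> 0"
  by (auto simp: peq_def)

lemma act_vprop: "proportional G G' \<Longrightarrow> vprop (act T G w) (act T G' w)"
  unfolding proportional_def vprop_def
  by (cases T) (simp_all add: kc.mp_eval_mult[symmetric])

text \<open>The union that defines \<open>rat_comp\<close> collapses to a single class: other
  representatives change the values only by a common factor, and this factor is nonzero because both
  composites are.\<close>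

lemma rat_comp_eq:
  assumes f: "f \<in> RatMaps S T" and g: "g \<in> RatMaps T U" and FG: "F \<in> f" "G \<in> g" and r: "tuple_comp G F \<in> rat_reps S U"
  shows "rat_comp S U g f = rat_class S U (tuple_comp G F)"
proof -
  have "rat_class S U (tuple_comp G' F') = rat_class S U (tuple_comp G F)"
    if *: "F' \<in> f" "G' \<in> g" "tuple_comp G' F' \<in> rat_reps S U" for F' G'
  proof -
    have reps: "F \<in> rat_reps S T" "F' \<in> rat_reps S T" "G \<in> rat_reps T U" "G' \<in> rat_reps T U"
      using RatMaps_member(1)[OF f FG(1)] RatMaps_member(1)[OF f *(1)] RatMaps_member(1)[OF g FG(2)] RatMaps_member(1)[OF g *(2)] .
    let ?w = "\<lambda>i. tf (F i)" and ?w' = "\<lambda>i. tf (F' i)"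
    obtain i j where ij: "tuple_comp G F i \<noteq> 0" "tuple_comp G' F' j \<noteq> 0"
      using rat_reps_nonzero[OF r] rat_reps_nonzero[OF *(3)] by blast
    have 1: "peq (\<lambda>i. tf (tuple_comp G F i)) (act T G ?w)" by (rule tf_tuple_comp) fact+
    have 2: "peq (\<lambda>i. tf (tuple_comp G' F' i)) (act T G' ?w)"
      using tf_tuple_comp[OF reps(2,4)] act_peq[OF reps(4) RatMaps_peq[OF f *(1) FG(1)]] by (rule peq_trans)
    have nz: "act T G ?w i \<noteq> 0" "act T G' ?w j \<noteq> 0"
      using peq_nonzero[OF 1] peq_nonzero[OF 2] ij by auto
    have "peq (act T G ?w) (act T G' ?w)"
      by (rule vprop_peq[OF act_vprop nz]) (rule RatMaps_proportional[OF g FG(2) *(2)])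
    then have "peq (\<lambda>i. tf (tuple_comp G' F' i)) (\<lambda>i. tf (tuple_comp G F i))"
      using peq_trans[OF 2 peq_trans[OF peq_sym peq_sym[OF 1]]] by blast
    then show ?thesis using r * by (intro peq_rat_class_eq)
  qed
  then show ?thesis using FG r unfolding rat_comp_def by blast
qed

lemma tuple_comp_reps:
  assumes F: "F \<in> rat_reps S T" and G: "G \<in> rat_reps T U"
    and nz: "case U of Aff _ \<Rightarrow> tuple_comp G F 0 \<noteq> 0 | Proj _ \<Rightarrow> (\<exists>i. tuple_comp G F i \<noteq> 0)"
  shows "tuple_comp G F \<in> rat_reps S U"
proof -
  have Fv: "mvars (F i) \<subseteq> space_coords S" for i using F by (simp add: rat_reps_def)
  have "mvars (tuple_comp G F i) \<subseteq> space_coords S" for i unfolding tuple_comp_def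
    by (intro mvars_sum order_trans[OF mvars_mult] Un_least mvars_prod order_trans[OF mvars_power] Fv) auto
  moreover have "tuple_comp G F i = 0" if "i > space_dim U" for i
    using that G by (simp add: tuple_comp_def rat_reps_def)
  moreover have "\<exists>d. \<forall>i. homogeneous d (tuple_comp G F i)" if S: "S = Proj n" for n
  proof -
    obtain d where d: "\<And>i. homogeneous d (F i)" using F S by (auto simp: rat_reps_def)
    show ?thesis
    proof (cases T)
      case (Proj k)
      then obtain e where "\<And>i. homogeneous e (G i)" using G by (auto simp: rat_reps_def)
      then have "homogeneous (d * e) (tuple_comp G F i)" for i
        using tuple_comp_Proj[of G k U F i] G Proj d homogeneous_mp_eval[where p="G i" and e=e and F=F and d=d] by simp
      then show ?thesis by blast
    next
      case (Aff k)
      \<comment> \<open>The power of \<open>F 0\<close> that clears denominators also pads all terms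
        to the same degree.\<close>
      have "homogeneous (d * tuple_deg G) (tuple_comp G F i)" for i
        unfolding tuple_comp_def
      proof (rule homogeneous_sum)
        fix m assume m: "m \<in> Poly_Mapping.keys (G i)"
        then have le: "mon_deg m \<le> tuple_deg G" by (rule tuple_deg_bound[OF G])
        have "homogeneous (\<Sum>l\<in>Poly_Mapping.keys m. d * Poly_Mapping.lookup m l) (\<Prod>l\<in>Poly_Mapping.keys m. F l ^ Poly_Mapping.lookup m l)"
          by (intro homogeneous_prod homogeneous_power d)
        then have "homogeneous (d * mon_deg m) (\<Prod>l\<in>Poly_Mapping.keys m. F l ^ Poly_Mapping.lookup m l)"
          by (simp add: mon_deg_def sum_distrib_left)
        then have "homogeneous (d * (tuple_deg G - mon_deg m) + d * mon_deg m)
          (mconst (Poly_Mapping.lookup (G i) m) * F 0 ^ (tuple_deg G - mon_deg m) * (\<Prod>l\<in>Poly_Mapping.keys m. F l ^ Poly_Mapping.lookup m l))"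
          by (intro homogeneous_mult homogeneous_mult_mconst homogeneous_power d)
        then show "homogeneous (d * tuple_deg G)
          (mconst (Poly_Mapping.lookup (G i) m) * F 0 ^ (tuple_deg G - mon_deg m) * (\<Prod>l\<in>Poly_Mapping.keys m. F l ^ Poly_Mapping.lookup m l))"
          using le by (simp add: distrib_left[symmetric])
      qed
      then show ?thesis by blast
    qed
  qed
  ultimately show ?thesis using nz unfolding rat_reps_def by (auto split: space.splits)
qed

text \<open>A nonempty composition determines representatives whose composition is defined.\<close>

lemma rat_comp_obtain:
  assumes "rat_comp S U g f = rat_class S U H" "H \<in> rat_reps S U"
  obtains F G where "F \<in> f" "G \<in> g" "tuple_comp G F \<in> rat_reps S U" "peq (\<lambda>i. tf (tuple_comp G F i)) (\<lambda>i. tf (H i))"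
proof -
  have "H \<in> rat_comp S U g f" using assms rat_class_self by simp
  then obtain F G where *: "F \<in> f" "G \<in> g" "tuple_comp G F \<in> rat_reps S U" "H \<in> rat_class S U (tuple_comp G F)"
    unfolding rat_comp_def by blast
  have "peq (\<lambda>i. tf (tuple_comp G F i)) (\<lambda>i. tf (H i))"
    by (rule RatMaps_peq[OF RatMaps_classI[OF *(3)] rat_class_self[OF *(3)] *(4)])
  then show ?thesis using that * by blast
qed

subsection \<open>The group of birational self-maps of projective space\<close>

text \<open>A generic point of projective m-space in the sense of Weil, with coordinates in the
  field of rational functions. Only forms are tested, so the notion does not depend on the choice of
  homogeneous coordinates.\<close>

definition generic :: "nat \<Rightarrow> (nat \<Rightarrow> 'a::field mpoly fract) \<Rightarrow> bool"
  where "generic m v \<longleftrightarrow> (\<forall>i>m. v i = 0) \<and>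
    (\<forall>p d. homogeneous d p \<longrightarrow> mvars p \<subseteq> {0..m} \<longrightarrow> p \<noteq> 0 \<longrightarrow> pev v p \<noteq> 0)"

text \<open>The tautological generic point: the value of a map at it is the map itself, so equality
  of maps can be read off there.\<close>

definition gpt :: "nat \<Rightarrow> nat \<Rightarrow> 'a::field mpoly fract"
  where "gpt m i = (if i \<le> m then tf (mvar i) else 0)"

abbreviation papp :: "('a::field) tuple \<Rightarrow> (nat \<Rightarrow> 'a mpoly fract) \<Rightarrow> nat \<Rightarrow> 'a mpoly fract"
  where "papp F v \<equiv> (\<lambda>i. pev v (F i))"

lemma pev_gpt: "mvars p \<subseteq> {0..m} \<Longrightarrow> pev (gpt m) p = tf p"
  by (rule trans[OF mp_eval_cong tf_pev]) (auto simp: gpt_def)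

lemma generic_gpt: "generic m (gpt m)"
  by (auto simp: generic_def pev_gpt) (simp add: gpt_def)

lemma mvar_nonzero [simp]: "(mvar i :: 'a::zero_neq_one mpoly) \<noteq> 0"
  by (metis mvars_0 mvars_mvar insert_not_empty)

lemma generic_nonzero: "generic m v \<Longrightarrow> i \<le> m \<Longrightarrow> v i \<noteq> 0"
proof -
  assume "generic m v" "i \<le> m"
  moreover from this have "\<And>p d. homogeneous d p \<Longrightarrow> mvars p \<subseteq> {0..m} \<Longrightarrow> p \<noteq> 0 \<Longrightarrow> pev v p \<noteq> 0"
    unfolding generic_def by blast
  ultimately have "pev v (mvar i) \<noteq> 0" using homogeneous_mvar[of i] by fastforce
  then show ?thesis by simp
qed

lemma generic_peq: assumes "generic m v" "peq w v" shows "generic m w"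
proof -
  obtain c where c: "c \<noteq> 0" "w = (\<lambda>i. c * v i)" using assms(2) by (auto simp: peq_def)
  then show ?thesis using assms(1) kc.mp_eval_homogeneous_scale unfolding generic_def by fastforce
qed

text \<open>No nonzero form vanishes on the image of \<open>F\<close>.\<close>

definition dominant :: "nat \<Rightarrow> ('a::field) tuple \<Rightarrow> bool"
  where "dominant m F \<longleftrightarrow> F \<in> rat_reps (Proj m) (Proj m) \<and> generic m (\<lambda>i. tf (F i))"

lemma dominant_reps: "dominant m F \<Longrightarrow> F \<in> rat_reps (Proj m) (Proj m)" by (simp add: dominant_def)

lemma dominantE:
  assumes "dominant m F"
  obtains d where "\<And>i. homogeneous d (F i)" "\<And>i. mvars (F i) \<subseteq> {0..m}" "\<And>i. i > m \<Longrightarrow> F i = 0"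
  using assms by (auto simp: dominant_def rat_reps_def)

text \<open>If p is a nonzero form, then so is p(F) by dominance, and it does not vanish at the
  generic v.\<close>

lemma generic_papp: assumes F: "dominant m F" and v: "generic m v" shows "generic m (papp F v)"
proof -
  obtain d where d: "\<And>i. homogeneous d (F i)" "\<And>i. mvars (F i) \<subseteq> {0..m}" "\<And>i. i > m \<Longrightarrow> F i = 0"
    using dominantE[OF F] by metis
  show ?thesis unfolding generic_def
  proof (intro conjI allI impI)
    fix p :: "'a mpoly" and e assume p: "homogeneous e p" "mvars p \<subseteq> {0..m}" "p \<noteq> 0"
    have "tf (mp_eval mconst F p) \<noteq> 0" using F p unfolding dominant_def generic_def tf_mp_eval by blast
    moreover have "homogeneous (d * e) (mp_eval mconst F p)" using p d by (intro homogeneous_mp_eval)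
    moreover have "mvars (mp_eval mconst F p) \<subseteq> {0..m}" using d by (intro mvars_mp_eval)
    ultimately show "pev (papp F v) p \<noteq> 0" using v unfolding generic_def pev_mp_eval[symmetric] by auto
  qed (simp add: d(3) mp_eval_def)
qed

lemma papp_peq:
  assumes "dominant m F" "peq v w" shows "peq (papp F v) (papp F w)"
  using act_peq[OF dominant_reps[OF assms(1)] assms(2)] by simp

lemma papp_tuple_comp: "G \<in> rat_reps (Proj n) U \<Longrightarrow> papp (tuple_comp G F) v = papp G (papp F v)"
  by (auto simp: tuple_comp_Proj pev_mp_eval)

lemma papp_gpt: "dominant m F \<Longrightarrow> papp F (gpt m) = (\<lambda>i. tf (F i))"
  using pev_gpt by (fastforce elim!: dominantE)

lemma dominant_tuple_comp:
  assumes "dominant m F" "dominant m G" shows "dominant m (tuple_comp G F)"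
proof -
  have *: "papp (tuple_comp G F) (gpt m) = papp G (\<lambda>i. tf (F i))"
    by (simp add: papp_tuple_comp[OF dominant_reps[OF assms(2)]] papp_gpt[OF assms(1)])
  have **: "generic m (papp G (\<lambda>i. tf (F i)))" using assms by (intro generic_papp) (auto simp: dominant_def)
  have t: "(\<lambda>i. tf (tuple_comp G F i)) = papp G (\<lambda>i. tf (F i))"
    using tuple_comp_Proj[OF dominant_reps[OF assms(2)]] by (auto simp: tf_mp_eval)
  then have "tuple_comp G F 0 \<noteq> 0" using generic_nonzero[OF **, of 0] by (metis tf.hom_zero zero_le)
  then have "tuple_comp G F \<in> rat_reps (Proj m) (Proj m)"
    using assms by (intro tuple_comp_reps) (auto simp: dominant_def)
  then show ?thesis unfolding dominant_def t using ** by simp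
qed

abbreviation pclass :: "nat \<Rightarrow> ('a::field) tuple \<Rightarrow> 'a ratmap" where "pclass m \<equiv> rat_class (Proj m) (Proj m)"

lemma rat_comp_dominant:
  assumes "dominant m F" "dominant m G"
  shows "rat_comp (Proj m) (Proj m) (pclass m G) (pclass m F) = pclass m (tuple_comp G F)"
  by (rule rat_comp_eq[where T = "Proj m"]) (simp_all add: assms dominant_reps dominant_tuple_comp RatMaps_classI rat_class_self)

lemma pclass_eqI:
  assumes "dominant m F" "dominant m G" "peq (papp F (gpt m)) (papp G (gpt m))"
  shows "pclass m F = pclass m G"
  using assms by (intro peq_rat_class_eq) (auto simp: papp_gpt dominant_reps)

lemma pclass_eqD:
  assumes "dominant m F" "dominant m G" "pclass m F = pclass m G" "generic m v"
  shows "peq (papp F v) (papp G v)"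
proof -
  have "G \<in> pclass m F" using assms(3) rat_class_self[OF dominant_reps[OF assms(2)]] by simp
  then have "proportional F G" by (simp add: rat_class_def)
  then have "vprop (papp F v) (papp G v)" using act_vprop[of F G "Proj m" v] by simp
  then show ?thesis using generic_nonzero[OF generic_papp[OF assms(1,4)], of 0] generic_nonzero[OF generic_papp[OF assms(2,4)], of 0]
    by (intro vprop_peq[of _ _ 0 0]) auto
qed

lemma dominant_id: "dominant m (id_tuple (Proj m))"
proof -
  have "(\<lambda>i. tf (id_tuple (Proj m) i :: 'a mpoly)) = gpt m" by (auto simp: gpt_def)
  then have "generic m (\<lambda>i. tf (id_tuple (Proj m) i :: 'a mpoly))" by (simp only: generic_gpt)
  moreover have "\<exists>d. \<forall>i. homogeneous d (id_tuple (Proj m) i :: 'a mpoly)" by (intro exI[of _ 1]) auto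
  moreover have "\<exists>i. id_tuple (Proj m) i \<noteq> (0 :: 'a mpoly)" by (intro exI[of _ 0]) auto
  ultimately show ?thesis unfolding dominant_def
    by (auto simp: rat_reps_def simp del: id_tuple.simps) (auto split: if_splits)
qed

lemma papp_id: "(\<And>i. i > m \<Longrightarrow> v i = 0) \<Longrightarrow> papp (id_tuple (Proj m)) v = v"
  by (auto simp: kc.mp_eval_0)


lemma rat_id_Proj: "rat_id (Proj m) = pclass m (id_tuple (Proj m))" by (simp add: rat_id_def)

lemma tf_id_tuple: "(\<lambda>i. tf (id_tuple (Proj m) i)) = gpt m" by (auto simp: gpt_def)

text \<open>A form that vanishes identically on the components of \<open>F\<close> would vanish at
  F(w), which is generic.\<close>

lemma dominantI:
  assumes F: "F \<in> rat_reps (Proj m) (Proj m)" and FG: "peq (papp F w) (gpt m)" and w: "w = (\<lambda>i. tf (G i))"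
  shows "dominant m F"
  unfolding dominant_def generic_def
proof (intro conjI allI impI)
  fix p :: "'a mpoly" and d assume p: "homogeneous d p" "mvars p \<subseteq> {0..m}" "p \<noteq> 0"
  show "pev (\<lambda>i. tf (F i)) p \<noteq> 0"
  proof
    assume "pev (\<lambda>i. tf (F i)) p = 0"
    then have "mp_eval mconst F p = 0" using tf_mp_eval[of F p] by simp
    then have "pev (papp F w) p = 0" by (metis pev_mp_eval kc.mp_eval_0)
    moreover have "generic m (papp F w)" using generic_peq[OF generic_gpt FG] .
    ultimately show False using p unfolding generic_def by blast
  qed
qed (use F in \<open>auto simp: rat_reps_def\<close>)

text \<open>The inverse map is a right inverse for some representative, which is thus dominant; all
  other representatives are proportional to it.\<close>

lemma Bir_member:
  assumes f: "f \<in> carrier (Bir (Proj m))" "F \<in> f"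
  shows "dominant m F" "f = pclass m F"
proof -
  obtain g where fR: "f \<in> RatMaps (Proj m) (Proj m)" and g: "g \<in> RatMaps (Proj m) (Proj m)"
    and fg: "rat_comp (Proj m) (Proj m) f g = pclass m (id_tuple (Proj m))"
    using f by (auto simp: Bir_def birational_def rat_inverse_of_def rat_id_Proj)
  show "f = pclass m F" by (rule RatMaps_member(2)[OF fR f(2)])
  obtain G F' where FG: "G \<in> g" "F' \<in> f" "peq (\<lambda>i. tf (tuple_comp F' G i)) (\<lambda>i. tf (id_tuple (Proj m) i))"
    using rat_comp_obtain[OF fg dominant_reps[OF dominant_id]] by blast
  have reps: "F \<in> rat_reps (Proj m) (Proj m)" "F' \<in> rat_reps (Proj m) (Proj m)"
    using RatMaps_member(1)[OF fR f(2)] RatMaps_member(1)[OF fR FG(2)] .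
  have "(\<lambda>i. tf (tuple_comp F' G i)) = papp F' (\<lambda>i. tf (G i))"
    using tuple_comp_Proj[OF reps(2)] by (auto simp: tf_mp_eval)
  then have "peq (papp F' (\<lambda>i. tf (G i))) (gpt m)" using FG(3) by (simp only: tf_id_tuple)
  then have "dominant m F'" by (rule dominantI[OF reps(2) _ refl])
  then have "generic m (\<lambda>i. tf (F' i))" by (simp add: dominant_def)
  then have "generic m (\<lambda>i. tf (F i))" by (rule generic_peq[OF _ RatMaps_peq[OF fR f(2) FG(2)]])
  then show "dominant m F" using reps by (simp add: dominant_def)
qed

lemma Bir_nonempty: "f \<in> carrier (Bir (Proj m)) \<Longrightarrow> \<exists>F. F \<in> f"
  by (auto simp: Bir_def birational_def elim: RatMaps_obtain)

lemma Bir_obtain: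
  assumes "f \<in> carrier (Bir (Proj m))" obtains F where "F \<in> f" "dominant m F" "f = pclass m F"
  using assms Bir_nonempty Bir_member by blast

lemma pclass_id_peq:
  assumes "dominant m F" "pclass m F = rat_id (Proj m)" "generic m v" shows "peq (papp F v) v"
  using pclass_eqD[OF assms(1) dominant_id assms(2)[unfolded rat_id_Proj] assms(3)] papp_id[of m v] assms(3)
  by (simp add: generic_def)

lemma peq_pclass_id:
  fixes F :: "'a::field tuple"
  assumes "dominant m F" "peq (papp F (gpt m)) (gpt m)" shows "pclass m F = rat_id (Proj m)"
proof -
  have "papp (id_tuple (Proj m)) (gpt m :: nat \<Rightarrow> 'a mpoly fract) = gpt m"
    by (rule papp_id) (simp add: gpt_def)
  then show ?thesis unfolding rat_id_Proj
    by (intro pclass_eqI[OF assms(1) dominant_id]) (simp only: assms(2))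
qed

lemma BirI:
  assumes F: "F \<in> rat_reps (Proj m) (Proj m)" and G: "G \<in> rat_reps (Proj m) (Proj m)"
    and FG: "peq (papp F (\<lambda>i. tf (G i))) (gpt m)" and GF: "peq (papp G (\<lambda>i. tf (F i))) (gpt m)"
  shows "dominant m F" "pclass m F \<in> carrier (Bir (Proj m))"
    "rat_inverse_of (Proj m) (Proj m) (pclass m F) (pclass m G)"
proof -
  show dF: "dominant m F" by (rule dominantI[OF F FG refl])
  have dG: "dominant m G" by (rule dominantI[OF G GF refl])
  have "pclass m (tuple_comp G F) = rat_id (Proj m)" "pclass m (tuple_comp F G) = rat_id (Proj m)"
    by (rule peq_pclass_id; simp add: dF dG dominant_tuple_comp papp_tuple_comp[OF F] papp_tuple_comp[OF G] papp_gpt FG GF)+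
  then show "rat_inverse_of (Proj m) (Proj m) (pclass m F) (pclass m G)"
    unfolding rat_inverse_of_def using F G by (simp add: RatMaps_classI rat_comp_dominant dF dG)
  then show "pclass m F \<in> carrier (Bir (Proj m))" using F by (auto simp: Bir_def birational_def RatMaps_classI)
qed

lemma rat_inverse_ofD:
  assumes f: "f \<in> carrier (Bir (Proj m))" and g: "rat_inverse_of (Proj m) (Proj m) f g"
  shows "g \<in> carrier (Bir (Proj m))"
  using assms unfolding Bir_def birational_def rat_inverse_of_def by auto

lemma rat_inverse_of_papp:
  assumes f: "f \<in> carrier (Bir (Proj m))" and g: "rat_inverse_of (Proj m) (Proj m) f g"
    and FG: "F \<in> f" "G \<in> g" and v: "generic m v"
  shows "peq (papp F (papp G v)) v" "peq (papp G (papp F v)) v"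
proof -
  have gB: "g \<in> carrier (Bir (Proj m))" by (rule rat_inverse_ofD[OF f g])
  have F: "dominant m F" "f = pclass m F" and G: "dominant m G" "g = pclass m G"
    using Bir_member[OF f FG(1)] Bir_member[OF gB FG(2)] by auto
  have "pclass m (tuple_comp G F) = rat_id (Proj m)" "pclass m (tuple_comp F G) = rat_id (Proj m)"
    using g unfolding rat_inverse_of_def F(2) G(2) by (simp_all add: rat_comp_dominant F G)
  then show "peq (papp F (papp G v)) v" "peq (papp G (papp F v)) v"
    using pclass_id_peq[OF dominant_tuple_comp[OF F(1) G(1)] _ v] pclass_id_peq[OF dominant_tuple_comp[OF G(1) F(1)] _ v]
    by (simp_all add: papp_tuple_comp[OF dominant_reps[OF F(1)]] papp_tuple_comp[OF dominant_reps[OF G(1)]])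
qed

lemma group_Bir: "group (Bir (Proj m) :: 'a::field ratmap monoid)"
proof (rule groupI)
  fix x y :: "'a ratmap" assume x: "x \<in> carrier (Bir (Proj m))" and y: "y \<in> carrier (Bir (Proj m))"
  obtain x' where x': "rat_inverse_of (Proj m) (Proj m) x x'" using x by (auto simp: Bir_def birational_def)
  obtain y' where y': "rat_inverse_of (Proj m) (Proj m) y y'" using y by (auto simp: Bir_def birational_def)
  obtain F where F: "F \<in> x" "dominant m F" "x = pclass m F" by (rule Bir_obtain[OF x])
  obtain G where G: "G \<in> y" "dominant m G" "y = pclass m G" by (rule Bir_obtain[OF y])
  obtain F' where F': "F' \<in> x'" "dominant m F'" by (rule Bir_obtain[OF rat_inverse_ofD[OF x x']])
  obtain G' where G': "G' \<in> y'" "dominant m G'" by (rule Bir_obtain[OF rat_inverse_ofD[OF y y']])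
  have r: "F \<in> rat_reps (Proj m) (Proj m)" "G \<in> rat_reps (Proj m) (Proj m)" "F' \<in> rat_reps (Proj m) (Proj m)" "G' \<in> rat_reps (Proj m) (Proj m)"
    using F G F' G' dominant_reps by auto
  have tc: "(\<lambda>i. tf (tuple_comp H H' i)) = papp H (\<lambda>i. tf (H' i))" if "H \<in> rat_reps (Proj m) (Proj m)" for H H' :: "'a tuple"
    using tuple_comp_Proj[OF that] by (auto simp: tf_mp_eval)
  have "pclass m (tuple_comp F G) \<in> carrier (Bir (Proj m))"
  proof (rule BirI(2)[where G = "tuple_comp G' F'"])
    show "tuple_comp F G \<in> rat_reps (Proj m) (Proj m)" "tuple_comp G' F' \<in> rat_reps (Proj m) (Proj m)"
      using dominant_tuple_comp dominant_reps F G F' G' by blast+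
    have 1: "peq (papp F (papp G (papp G' (papp F' v)))) v" "peq (papp G' (papp F' (papp F (papp G v)))) v" if v: "generic m v" for v
    proof -
      have "peq (papp G (papp G' (papp F' v))) (papp F' v)"
        by (rule rat_inverse_of_papp(1)[OF y y' G(1) G'(1) generic_papp[OF F'(2) v]])
      then show "peq (papp F (papp G (papp G' (papp F' v)))) v"
        using peq_trans[OF papp_peq[OF F(2)] rat_inverse_of_papp(1)[OF x x' F(1) F'(1) v]] by blast
      have "peq (papp F' (papp F (papp G v))) (papp G v)"
        by (rule rat_inverse_of_papp(2)[OF x x' F(1) F'(1) generic_papp[OF G(2) v]])
      then show "peq (papp G' (papp F' (papp F (papp G v)))) v"
        using peq_trans[OF papp_peq[OF G'(2)] rat_inverse_of_papp(2)[OF y y' G(1) G'(1) v]] by blast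
    qed
    show "peq (papp (tuple_comp F G) (\<lambda>i. tf (tuple_comp G' F' i))) (gpt m)" "peq (papp (tuple_comp G' F') (\<lambda>i. tf (tuple_comp F G i))) (gpt m)"
      using 1[OF generic_gpt] by (simp_all add: papp_tuple_comp[OF r(1)] papp_tuple_comp[OF r(4)] tc r papp_gpt F' G)
  qed
  then show "x \<otimes>\<^bsub>Bir (Proj m)\<^esub> y \<in> carrier (Bir (Proj m))"
    using F G by (simp add: Bir_def rat_comp_dominant)
next
  have i: "peq (papp (id_tuple (Proj m)) (\<lambda>i. tf (id_tuple (Proj m) i))) (gpt m :: nat \<Rightarrow> 'a mpoly fract)"
    using papp_id[of m "gpt m :: nat \<Rightarrow> 'a mpoly fract"] unfolding tf_id_tuple by (simp add: gpt_def)
  show "\<one>\<^bsub>Bir (Proj m)\<^esub> \<in> carrier (Bir (Proj m) :: 'a ratmap monoid)"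
    using BirI(2)[OF dominant_reps[OF dominant_id] dominant_reps[OF dominant_id] i i] by (simp add: Bir_def rat_id_Proj)
next
  fix x y z :: "'a ratmap" assume "x \<in> carrier (Bir (Proj m))" "y \<in> carrier (Bir (Proj m))" "z \<in> carrier (Bir (Proj m))"
  then obtain F G H where *: "dominant m F" "x = pclass m F" "dominant m G" "y = pclass m G" "dominant m H" "z = pclass m H"
    by (meson Bir_obtain)
  have "pclass m (tuple_comp (tuple_comp F G) H) = pclass m (tuple_comp F (tuple_comp G H))"
    by (rule pclass_eqI) (simp_all add: * dominant_tuple_comp papp_tuple_comp[OF dominant_reps[OF *(1)]]
      papp_tuple_comp[OF dominant_reps[OF *(3)]] papp_tuple_comp[OF dominant_reps[OF dominant_tuple_comp[OF *(3,1)]]])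
  then show "x \<otimes>\<^bsub>Bir (Proj m)\<^esub> y \<otimes>\<^bsub>Bir (Proj m)\<^esub> z = x \<otimes>\<^bsub>Bir (Proj m)\<^esub> (y \<otimes>\<^bsub>Bir (Proj m)\<^esub> z)"
    by (simp add: Bir_def * rat_comp_dominant dominant_tuple_comp)
next
  fix x :: "'a ratmap" assume "x \<in> carrier (Bir (Proj m))"
  then obtain F where *: "dominant m F" "x = pclass m F" by (meson Bir_obtain)
  have v: "generic m (\<lambda>i. tf (F i))" using * by (simp add: dominant_def)
  have "pclass m (tuple_comp (id_tuple (Proj m)) F) = pclass m F"
    by (rule pclass_eqI) (use papp_id[of m "\<lambda>i. tf (F i)"] v in
      \<open>simp_all add: * dominant_tuple_comp dominant_id papp_tuple_comp[OF dominant_reps[OF dominant_id]] papp_gpt generic_def del: id_tuple.simps\<close>)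
  then show "\<one>\<^bsub>Bir (Proj m)\<^esub> \<otimes>\<^bsub>Bir (Proj m)\<^esub> x = x"
    by (simp add: Bir_def rat_id_Proj * rat_comp_dominant dominant_id del: id_tuple.simps)
next
  fix x :: "'a ratmap" assume x: "x \<in> carrier (Bir (Proj m))"
  then obtain g where g: "rat_inverse_of (Proj m) (Proj m) x g" by (auto simp: Bir_def birational_def)
  show "\<exists>y\<in>carrier (Bir (Proj m)). y \<otimes>\<^bsub>Bir (Proj m)\<^esub> x = \<one>\<^bsub>Bir (Proj m)\<^esub>"
    using rat_inverse_ofD[OF x g] g by (intro bexI[of _ g]) (auto simp: Bir_def rat_inverse_of_def)
qed

lemma rat_inverse_of_eq_inv:
  assumes f: "f \<in> carrier (Bir (Proj m))" and g: "rat_inverse_of (Proj m) (Proj m) f g"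
  shows "g = inv\<^bsub>Bir (Proj m)\<^esub> f"
proof -
  interpret B: group "Bir (Proj m)" by (rule group_Bir)
  show ?thesis
    by (rule B.inv_equality[symmetric]) (use f g rat_inverse_ofD[OF f g] in \<open>auto simp: Bir_def rat_inverse_of_def\<close>)
qed

lemma rat_inv_eq_inv:
  assumes f: "f \<in> carrier (Bir (Proj m))"
  shows "rat_inv (Proj m) (Proj m) f = inv\<^bsub>Bir (Proj m)\<^esub> f"
proof -
  obtain g where g: "rat_inverse_of (Proj m) (Proj m) f g" using f by (auto simp: Bir_def birational_def)
  show ?thesis unfolding rat_inv_def
    using g rat_inverse_of_eq_inv[OF f] by (intro the_equality) metis+
qed

lemma mult_Bir: "dominant m F \<Longrightarrow> dominant m G \<Longrightarrow> pclass m G \<otimes>\<^bsub>Bir (Proj m)\<^esub> pclass m F = pclass m (tuple_comp G F)"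
  by (simp add: Bir_def rat_comp_dominant)

subsection \<open>Linear automorphisms\<close>

lemma comm_ring_hom_to_ac: "comm_ring_hom (to_ac :: 'a::field \<Rightarrow> _)"
  by unfold_locales auto
interpretation ac: comm_ring_hom to_ac by (rule comm_ring_hom_to_ac)
interpretation acp: comm_ring_hom "\<lambda>c. [:to_ac c:]"
  by (rule comm_ring_hom_comp[OF comm_ring_hom_const_poly comm_ring_hom_to_ac])

text \<open>In a finite field, 1 plus the product of all t - a has no root.\<close>

lemma infinite_UNIV_alg_closed: "infinite (UNIV :: 'a::alg_closed_field set)"
proof
  assume fin: "finite (UNIV :: 'a set)"
  define p :: "'a poly" where "p = (\<Prod>a\<in>UNIV. [:- a, 1:])"
  have "Polynomial.degree p = card (UNIV :: 'a set)" unfolding p_def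
    by (subst degree_prod_eq_sum_degree) auto
  moreover have "card (UNIV :: 'a set) > 0" using fin by (simp add: card_gt_0_iff)
  ultimately have "Polynomial.degree (p + 1) > 0" by (subst degree_add_eq_left) auto
  then obtain x where "poly (p + 1) x = 0" using alg_closed_imp_poly_has_root by blast
  moreover have "poly p x = 0" unfolding p_def using fin by (auto simp: poly_prod)
  ultimately show False by simp
qed

lemma poly_eq_0_if_almost_all_roots:
  fixes p :: "'a::alg_closed_field poly"
  assumes "\<And>t. t \<noteq> a \<Longrightarrow> poly p t = 0" shows "p = 0"
proof (rule ccontr)
  assume "p \<noteq> 0"
  then have "finite {t. poly p t = 0}" by (rule poly_roots_finite)
  then have "finite (insert a {t. poly p t = 0})" by simp
  moreover have "insert a {t. poly p t = 0} = UNIV" using assms by auto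
  ultimately show False using infinite_UNIV_alg_closed[where 'a='a] by simp
qed

lemma poly_acp_eval:
  "poly (mp_eval (\<lambda>c. [:to_ac c:]) w p) t = mp_eval to_ac (\<lambda>i. poly (w i) t) (p :: 'a::field mpoly)"
proof -
  have "comm_ring_hom (\<lambda>q :: 'a alg_closure poly. poly q t)" by unfold_locales auto
  from hom_mp_eval[OF this, of "\<lambda>c. [:to_ac c:]" w p] show ?thesis by simp
qed

text \<open>Let s(t) = h(1, t, 0, ...) and q(t) = h(t, 1, 0, ...). If s has no root, it is a
  constant c, and homogeneity gives q = c t^r, which vanishes at 0.\<close>

lemma homogeneous_has_zero:
  fixes h :: "'a::field mpoly"
  assumes h: "homogeneous r h" "r \<ge> 1" and m: "m \<ge> 1"
  obtains p where "p \<in> space_points (Proj m)" "mp_eval to_ac p h = 0"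
proof -
  define e :: "nat \<Rightarrow> 'a alg_closure \<Rightarrow> 'a alg_closure \<Rightarrow> 'a alg_closure"
    where "e i x y = (if i = 0 then x else if i = 1 then y else 0)" for i x y
  have pt: "(\<lambda>i. e i x y) \<in> space_points (Proj m)" if "x \<noteq> 0 \<or> y \<noteq> 0" for x y
    using that m by (auto simp: e_def)
  define s where "s = mp_eval (\<lambda>c. [:to_ac c:]) (\<lambda>i. if i = 0 then 1 else if i = 1 then [:0,1:] else 0) h"
  define q where "q = mp_eval (\<lambda>c. [:to_ac c:]) (\<lambda>i. if i = 0 then [:0,1:] else if i = 1 then 1 else 0) h"
  have s: "poly s t = mp_eval to_ac (\<lambda>i. e i 1 t) h" for t
    unfolding s_def poly_acp_eval by (rule arg_cong[where f="\<lambda>v. mp_eval to_ac v h"]) (auto simp: e_def)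
  have q: "poly q t = mp_eval to_ac (\<lambda>i. e i t 1) h" for t
    unfolding q_def poly_acp_eval by (rule arg_cong[where f="\<lambda>v. mp_eval to_ac v h"]) (auto simp: e_def)
  show ?thesis
  proof (cases "\<exists>t. poly s t = 0")
    case True
    then obtain t where "poly s t = 0" by blast
    then show ?thesis using that[of "\<lambda>i. e i 1 t"] pt[of 1 t] s by simp
  next
    case False
    then have "Polynomial.degree s = 0" using alg_closed_imp_poly_has_root by blast
    then obtain c where c: "s = [:c:]" by (rule degree_eq_zeroE)
    have "poly (q - Polynomial.monom c r) t = 0" if "t \<noteq> 0" for t
    proof -
      have "(\<lambda>i. e i t 1) = (\<lambda>i. t * e i 1 (inverse t))" using that by (auto simp: e_def)
      then have "poly q t = t ^ r * poly s (inverse t)"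
        using ac.mp_eval_homogeneous_scale[OF h(1), of t "\<lambda>i. e i 1 (inverse t)"] by (simp add: s q)
      then show ?thesis by (simp add: c poly_monom)
    qed
    then have "q - Polynomial.monom c r = 0" by (rule poly_eq_0_if_almost_all_roots)
    then have "poly q 0 = 0" using h(2) by (simp add: poly_monom)
    then show ?thesis using that[of "\<lambda>i. e i 0 1"] pt[of 0 1] q by simp
  qed
qed

section \<open>Linear forms and invertible matrices\<close>

lemma mon_deg_1: assumes "mon_deg m = Suc 0" obtains j where "m = Poly_Mapping.single j 1"
proof -
  have "(\<Sum>l\<in>Poly_Mapping.keys m. Poly_Mapping.lookup m l) = 1" using assms by (simp add: mon_deg_def)
  then obtain j where j: "j \<in> Poly_Mapping.keys m" "Poly_Mapping.lookup m j = 1" "\<And>l. l \<in> Poly_Mapping.keys m \<Longrightarrow> j \<noteq> l \<Longrightarrow> Poly_Mapping.lookup m l = 0"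
    using sum_eq_1_iff[of "Poly_Mapping.keys m" "Poly_Mapping.lookup m"] by auto
  have "m = Poly_Mapping.single j 1"
    by (rule poly_mapping_eqI) (use j in \<open>auto simp: lookup_single when_def in_keys_iff\<close>)
  then show ?thesis by (rule that)
qed

lemma single_Suc_0_eq_iff [simp]: "Poly_Mapping.single j (Suc 0) = Poly_Mapping.single k (Suc 0) \<longleftrightarrow> j = k"
  by (metis lookup_single_eq lookup_single_not_eq nat.distinct(1))

lemma single_Suc_0_neq_0 [simp]: "Poly_Mapping.single j (Suc 0) \<noteq> 0" "0 \<noteq> Poly_Mapping.single j (Suc 0)"
  by (metis lookup_single_eq lookup_zero nat.distinct(1))+

lemma lookup_mconst: "Poly_Mapping.lookup (mconst c) m = (if m = 0 then c else 0)"
  by (simp add: mconst_def lookup_single when_def)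

lemma lookup_mconst_mvar:
  "Poly_Mapping.lookup (mconst (c :: 'a::comm_ring_1) * mvar j) m = (if m = Poly_Mapping.single j (Suc 0) then c else 0)"
  by (simp add: mconst_def mvar_def mult_single lookup_single when_def)

lemma affine_linear_form:
  fixes p :: "'a::comm_ring_1 mpoly"
  assumes "tdeg p \<le> 1" "mvars p \<subseteq> V" "finite V"
  shows "p = mconst (Poly_Mapping.lookup p 0) + (\<Sum>j\<in>V. mconst (Poly_Mapping.lookup p (Poly_Mapping.single j (Suc 0))) * mvar j)"
proof (rule poly_mapping_eqI)
  fix m
  consider "m = 0" | j where "m = Poly_Mapping.single j (Suc 0)" | "mon_deg m > 1"
    using mon_deg_1[of m] mon_deg_eq_0_iff[of m] by (metis One_nat_def Suc_lessI neq0_conv)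
  then show "Poly_Mapping.lookup p m = Poly_Mapping.lookup (mconst (Poly_Mapping.lookup p 0) + (\<Sum>j\<in>V. mconst (Poly_Mapping.lookup p (Poly_Mapping.single j (Suc 0))) * mvar j)) m"
  proof cases
    case 1
    then show ?thesis by (simp add: lookup_add lookup_sum lookup_mconst lookup_mconst_mvar)
  next
    case (2 j)
    have "Poly_Mapping.lookup p m = 0" if "j \<notin> V"
    proof (rule ccontr)
      assume "Poly_Mapping.lookup p m \<noteq> 0"
      then have "Poly_Mapping.keys m \<subseteq> mvars p" by (auto simp: mvars_def in_keys_iff)
      then show False using that assms(2) by (auto simp: 2)
    qed
    then show ?thesis using assms(3) by (auto simp: 2 lookup_add lookup_sum lookup_mconst lookup_mconst_mvar)
  next
    case 3
    then have "m \<notin> Poly_Mapping.keys p" using assms(1) mon_deg_le_tdeg by fastforce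
    moreover have "m \<noteq> 0" "\<And>j. m \<noteq> Poly_Mapping.single j (Suc 0)" using 3 mon_deg_single by (auto simp: mon_deg_def)
    ultimately show ?thesis by (simp add: lookup_add lookup_sum lookup_mconst lookup_mconst_mvar in_keys_iff)
  qed
qed

lemma linear_form:
  fixes p :: "'a::comm_ring_1 mpoly"
  assumes "homogeneous (Suc 0) p" "mvars p \<subseteq> V" "finite V"
  shows "p = (\<Sum>j\<in>V. mconst (Poly_Mapping.lookup p (Poly_Mapping.single j (Suc 0))) * mvar j)"
proof -
  have "tdeg p \<le> 1" using assms(1) by (simp add: homogeneous_def tdeg_le_iff)
  moreover have "Poly_Mapping.lookup p 0 = 0" 
  proof (rule ccontr)
    assume "Poly_Mapping.lookup p 0 \<noteq> 0"
    then have "mon_deg 0 = Suc 0" using assms(1) by (auto simp: homogeneous_def in_keys_iff)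
    then show False by (simp add: mon_deg_def)
  qed
  ultimately show ?thesis using affine_linear_form[OF _ assms(2,3)] by simp
qed

definition lin :: "nat \<Rightarrow> (nat \<Rightarrow> nat \<Rightarrow> 'a::field) \<Rightarrow> 'a tuple"
  where "lin m A = (\<lambda>i. if i \<le> m then (\<Sum>j\<le>m. mconst (A i j) * mvar j) else 0)"

text \<open>The action on vectors over an extension field: \<open>h\<close> is \<open>kc\<close> for
  generic points and \<open>to_ac\<close> for geometric ones.\<close>

definition lact :: "('a::field \<Rightarrow> 'b::field) \<Rightarrow> nat \<Rightarrow> (nat \<Rightarrow> nat \<Rightarrow> 'a) \<Rightarrow> (nat \<Rightarrow> 'b) \<Rightarrow> nat \<Rightarrow> 'b"
  where "lact h m A v = (\<lambda>i. if i \<le> m then (\<Sum>j\<le>m. h (A i j) * v j) else 0)"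

definition matinv :: "nat \<Rightarrow> (nat \<Rightarrow> nat \<Rightarrow> 'a::field) \<Rightarrow> (nat \<Rightarrow> nat \<Rightarrow> 'a) \<Rightarrow> bool"
  where "matinv m A B \<longleftrightarrow> (\<forall>i\<le>m. \<forall>j\<le>m. (\<Sum>k\<le>m. A i k * B k j) = (if i = j then 1 else 0) \<and>
     (\<Sum>k\<le>m. B i k * A k j) = (if i = j then 1 else 0))"

lemma matinv_sym: "matinv m A B \<Longrightarrow> matinv m B A" by (simp add: matinv_def)

lemma mp_eval_lin:
  fixes h :: "'a::field \<Rightarrow> 'b::field"
  assumes "comm_ring_hom h" shows "(\<lambda>i. mp_eval h v (lin m A i)) = lact h m A v"
proof -
  interpret h: comm_ring_hom h by fact
  interpret e: comm_ring_hom "mp_eval h v" by (rule h.comm_ring_hom_mp_eval)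
  show ?thesis by (auto simp: lin_def lact_def e.hom_sum e.hom_mult)
qed

lemma lact_lact:
  assumes h: "comm_ring_hom h" and AB: "matinv m A B" and v: "\<And>i. i > m \<Longrightarrow> v i = 0"
  shows "lact h m A (lact h m B v) = v"
proof
  fix i
  interpret h: comm_ring_hom h by fact
  show "lact h m A (lact h m B v) i = v i"
  proof (cases "i \<le> m")
    case True
    have "lact h m A (lact h m B v) i = (\<Sum>k\<le>m. \<Sum>j\<le>m. h (A i k * B k j) * v j)"
      using True by (simp add: lact_def sum_distrib_left h.hom_mult mult.assoc)
    also have "\<dots> = (\<Sum>j\<le>m. h (\<Sum>k\<le>m. A i k * B k j) * v j)"
      by (subst sum.swap) (simp add: h.hom_sum sum_distrib_right)
    also have "\<dots> = (\<Sum>j\<le>m. if j = i then v j else 0)"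
      using AB True by (intro sum.cong) (auto simp: matinv_def)
    finally show ?thesis using True by simp
  qed (simp add: lact_def v)
qed

lemma lin_reps: assumes AB: "matinv m A B" shows "lin m A \<in> rat_reps (Proj m) (Proj m)"
proof -
  have "\<exists>j\<le>m. A 0 j \<noteq> 0"
  proof (rule ccontr)
    assume "\<not> ?thesis" then have "(\<Sum>k\<le>m. A 0 k * B k 0) = 0" by (intro sum.neutral) auto
    then show False using AB by (simp add: matinv_def)
  qed
  then obtain j where j: "j \<le> m" "A 0 j \<noteq> 0" by blast
  have "Poly_Mapping.lookup (lin m A 0) (Poly_Mapping.single j (Suc 0)) = A 0 j"
    using j by (simp add: lin_def lookup_sum lookup_mconst_mvar)
  then have "lin m A 0 \<noteq> 0" using j by auto
  moreover have "homogeneous 1 (lin m A i)" for i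
    by (auto simp: lin_def intro!: homogeneous_sum homogeneous_mult_mconst)
  moreover have "mvars (lin m A i) \<subseteq> {0..m}" for i
    by (auto simp: lin_def intro!: mvars_sum order_trans[OF mvars_mult])
  moreover have "lin m A i = 0" if "i > m" for i using that by (simp add: lin_def)
  ultimately show ?thesis unfolding rat_reps_def by auto
qed

lemma papp_lin: "papp (lin m A) v = lact kc m A v"
  by (rule mp_eval_lin[OF kc.comm_ring_hom_axioms])

lemma Bir_lin:
  assumes AB: "matinv m A B"
  shows "dominant m (lin m A)" "pclass m (lin m A) \<in> carrier (Bir (Proj m))"
    "rat_inverse_of (Proj m) (Proj m) (pclass m (lin m A)) (pclass m (lin m B))"
proof -
  have r: "lin m A \<in> rat_reps (Proj m) (Proj m)" "lin m B \<in> rat_reps (Proj m) (Proj m)"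
    using lin_reps AB matinv_sym by blast+
  have tl: "(\<lambda>i. tf (lin m C i)) = lact kc m C (gpt m)" for C :: "nat \<Rightarrow> nat \<Rightarrow> 'a"
    by (auto simp: lin_def lact_def gpt_def kc_def tf.hom_sum tf.hom_mult)
  have z: "i > m \<Longrightarrow> gpt m i = (0 :: 'a mpoly fract)" for i by (simp add: gpt_def)
  have 1: "peq (papp (lin m A) (\<lambda>i. tf (lin m B i))) (gpt m)"
    unfolding tl papp_lin by (simp add: lact_lact[OF kc.comm_ring_hom_axioms AB z])
  have 2: "peq (papp (lin m B) (\<lambda>i. tf (lin m A i))) (gpt m)"
    unfolding tl papp_lin by (simp add: lact_lact[OF kc.comm_ring_hom_axioms matinv_sym[OF AB] z])
  show "dominant m (lin m A)" "pclass m (lin m A) \<in> carrier (Bir (Proj m))"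
    "rat_inverse_of (Proj m) (Proj m) (pclass m (lin m A)) (pclass m (lin m B))"
    using BirI[OF r 1 2] by blast+
qed

text \<open>An invertible matrix annihilates no nonzero vector over the algebraic closure, so a
  single representative is defined everywhere.\<close>

lemma lin_morphism: assumes AB: "matinv m A B" shows "morphism (Proj m) (Proj m) (pclass m (lin m A))"
  unfolding morphism_def
proof (intro conjI ballI)
  show "pclass m (lin m A) \<in> RatMaps (Proj m) (Proj m)" using lin_reps[OF AB] by (rule RatMaps_classI)
  fix p :: "nat \<Rightarrow> 'a alg_closure" assume p: "p \<in> space_points (Proj m)"
  have ta: "tuple_at (lin m A) p = lact to_ac m A p"
    unfolding tuple_at_def by (rule mp_eval_lin[OF comm_ring_hom_to_ac])
  have "\<exists>i. tuple_at (lin m A) p i \<noteq> 0"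
  proof (rule ccontr)
    assume "\<not> ?thesis"
    then have "lact to_ac m A p = (\<lambda>i. 0)" unfolding ta by auto
    then have "p = lact to_ac m B (\<lambda>i. 0)"
      using lact_lact[OF comm_ring_hom_to_ac matinv_sym[OF AB], of p] p by simp
    then have "p i = 0" for i by (auto simp: lact_def intro!: sum.neutral)
    then show False using p by simp
  qed
  then show "regular_at (Proj m) (pclass m (lin m A)) p"
    using rat_class_self[OF lin_reps[OF AB]] by (auto simp: regular_at_def)
qed

lemma lin_Aut: assumes AB: "matinv m A B" shows "pclass m (lin m A) \<in> Aut_Proj m"
proof -
  have "rat_inv (Proj m) (Proj m) (pclass m (lin m A)) = pclass m (lin m B)"
    using Bir_lin[OF AB] rat_inv_eq_inv rat_inverse_of_eq_inv by metis
  then show ?thesis unfolding Aut_Proj_def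
    using Bir_lin(2)[OF AB] lin_morphism[OF AB] lin_morphism[OF matinv_sym[OF AB]] by simp
qed

text \<open>The variables \<open>x_0\<close> and \<open>x_1\<close> are coprime, which forces every representative of the identity to be a multiple of \<open>(x_0, \<dots>, x_m)\<close>.\<close>

lemma multiple_of_id:
  fixes Q :: "'a::field tuple"
  assumes "m \<ge> 1" and Q: "\<And>i j. i \<le> m \<Longrightarrow> j \<le> m \<Longrightarrow> Q i * mvar j = Q j * mvar i"
  shows "\<exists>h. \<forall>i\<le>m. Q i = h * mvar i"
proof -
  have "split_var 1 (Q 1 * mvar 0) = split_var 1 (Q 0 * mvar 1)" using Q[of 1 0] assms(1) by simp
  then have "split_var 1 (Q 1) * [:mvar 0:] = split_var 1 (Q 0) * [:0, 1:]"
    by (simp add: split_var.hom_mult split_var_mvar)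
  \<comment> \<open>The right-hand side is divisible by x_1, and the factor x_0 on the left does not
    involve x_1.\<close>
  then have "Polynomial.coeff (split_var 1 (Q 1) * [:mvar 0:]) 0 = Polynomial.coeff (split_var 1 (Q 0) * [:0, 1:]) 0" by simp
  then have "Polynomial.coeff (split_var 1 (Q 1)) 0 = 0" by simp
  then obtain r where r: "split_var 1 (Q 1) = pCons 0 r" by (cases "split_var 1 (Q 1)") auto
  have Q1: "Q 1 = poly r (mvar 1) * mvar 1" using poly_split_var[of 1 "Q 1"] unfolding r by (simp add: mult.commute)
  have "Q i = poly r (mvar 1) * mvar i" if "i \<le> m" for i
  proof -
    have "mvar 1 * Q i = mvar 1 * (poly r (mvar 1) * mvar i)"
      using Q[of i 1] that assms(1) unfolding Q1 by (simp add: ac_simps)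
    then show ?thesis by simp
  qed
  then show ?thesis by blast
qed

lemma Aut_Proj_linear:
  fixes f :: "'a::field ratmap"
  assumes f: "f \<in> Aut_Proj m" and m: "m \<ge> 1"
  obtains A B where "matinv m A B" "f = pclass m (lin m A)"
proof -
  let ?P = "Proj m"
  have fB: "f \<in> carrier (Bir ?P)" and fm: "morphism ?P ?P f" and gm: "morphism ?P ?P (rat_inv ?P ?P f)"
    using f by (auto simp: Aut_Proj_def)
  obtain g where g: "rat_inverse_of ?P ?P f g" using fB by (auto simp: Bir_def birational_def)
  have gB: "g \<in> carrier (Bir ?P)" by (rule rat_inverse_ofD[OF fB g])
  have gm: "morphism ?P ?P g" using gm rat_inv_eq_inv[OF fB] rat_inverse_of_eq_inv[OF fB g] by simp
  have fR: "f \<in> RatMaps ?P ?P" and gR: "g \<in> RatMaps ?P ?P" using fm gm by (auto simp: morphism_def)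
  obtain F where F: "F \<in> f" "\<forall>H\<in>f. \<exists>c. \<forall>i. H i = c * F i" using reduced_representative[OF fR] by blast
  obtain G where G: "G \<in> g" "\<forall>H\<in>g. \<exists>c. \<forall>i. H i = c * G i" using reduced_representative[OF gR] by blast
  \<comment> \<open>Any representative that witnesses regularity at p is a multiple of the reduced
    one, which therefore does not vanish at p either.\<close>
  have nocommon: "\<exists>i\<le>m. mp_eval to_ac p (H i) \<noteq> 0"
    if h: "morphism ?P ?P h" "H \<in> h" "\<forall>H'\<in>h. \<exists>c. \<forall>i. H' i = c * H i" and p: "p \<in> space_points ?P" for h H p
  proof -
    obtain H' i where H': "H' \<in> h" "mp_eval to_ac p (H' i) \<noteq> 0"
      using h(1) p by (auto simp: morphism_def regular_at_def tuple_at_def)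
    obtain c where "H' i = c * H i" using h(3) H'(1) by blast
    then have "mp_eval to_ac p (H i) \<noteq> 0" using H'(2) by (auto simp: ac.mp_eval_mult)
    moreover have "i \<le> m"
    proof (rule ccontr)
      assume "\<not> i \<le> m"
      then have "H i = 0" using RatMaps_member(1)[OF _ h(2)] h(1) by (auto simp: morphism_def rat_reps_def)
      then show False using calculation by (simp add: ac.mp_eval_0)
    qed
    ultimately show ?thesis by blast
  qed
  have dF: "dominant m F" "f = pclass m F" and dG: "dominant m G" "g = pclass m G"
    using Bir_member[OF fB F(1)] Bir_member[OF gB G(1)] by auto
  \<comment> \<open>Stated for a pair of maps so that it applies to both orders of composition; both
    constants are needed to invert the matrix.\<close>
  have key: "\<exists>k. k \<noteq> 0 \<and> (\<forall>i\<le>m. mp_eval mconst F1 (F2 i) = mconst k * mvar i)"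
    if d1: "dominant m F1" and d2: "dominant m F2" and eq: "peq (papp F2 (papp F1 (gpt m))) (gpt m)"
     and n1: "\<And>p. p \<in> space_points ?P \<Longrightarrow> \<exists>i\<le>m. mp_eval to_ac p (F1 i) \<noteq> 0"
     and n2: "\<And>p. p \<in> space_points ?P \<Longrightarrow> \<exists>i\<le>m. mp_eval to_ac p (F2 i) \<noteq> 0" for F1 F2 :: "'a tuple"
  proof -
    define Q where "Q i = mp_eval mconst F1 (F2 i)" for i
    have tQ: "papp F2 (papp F1 (gpt m)) = (\<lambda>i. tf (Q i))"
      unfolding Q_def papp_gpt[OF d1] tf_mp_eval by simp
    have "vprop (\<lambda>i. tf (Q i)) (gpt m)" using eq unfolding tQ by (rule peq_vprop)
    then have Qp: "Q i * mvar j = Q j * mvar i" if "i \<le> m" "j \<le> m" for i j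
    proof -
      have "tf (Q i) * gpt m j = tf (Q j) * gpt m i" using \<open>vprop _ _\<close> unfolding vprop_def by blast
      then have "tf (Q i * mvar j) = tf (Q j * mvar i)" using that by (simp add: gpt_def tf.hom_mult)
      then show ?thesis by simp
    qed
    obtain h where h: "\<And>i. i \<le> m \<Longrightarrow> Q i = h * mvar i" using multiple_of_id[OF m Qp] by blast
    have "tf (Q 0) \<noteq> 0" using peq_nonzero[OF peq_sym[OF eq], of 0] tQ[THEN fun_cong, of 0] by (simp add: gpt_def)
    then have Q0: "Q 0 \<noteq> 0" by simp
    obtain d where d: "\<And>i. homogeneous d (F1 i)" using dominantE[OF d1] by metis
    obtain e where e: "\<And>i. homogeneous e (F2 i)" using dominantE[OF d2] by metis
    have Qh: "homogeneous (d * e) (Q 0)" unfolding Q_def using d e by (intro homogeneous_mp_eval)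
    have "homogeneous (d * e) (h * mvar 0)" "h * mvar 0 \<noteq> 0" using Qh Q0 h[of 0] by simp_all
    then obtain r where r: "homogeneous r h" by (rule homogeneous_factor)
    have "\<not> r \<ge> 1"
    proof
      assume "r \<ge> 1"
      obtain p where p: "p \<in> space_points ?P" "mp_eval to_ac p h = 0" by (rule homogeneous_has_zero[OF r \<open>r \<ge> 1\<close> m])
      define w where "w = (\<lambda>i. mp_eval to_ac p (F1 i))"
      have w: "w \<in> space_points ?P"
      proof -
        have "F1 i = 0" if "i > m" for i using dominant_reps[OF d1] that by (auto simp: rat_reps_def)
        then show ?thesis using n1[OF p(1)] by (auto simp: w_def ac.mp_eval_0)
      qed
      obtain i where i: "i \<le> m" "mp_eval to_ac w (F2 i) \<noteq> 0" using n2[OF w] by blast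
      have "mp_eval to_ac w (F2 i) = mp_eval to_ac p (Q i)" unfolding Q_def w_def
        using hom_mp_eval[OF ac.comm_ring_hom_mp_eval, of p mconst F1 "F2 i"] by simp
      then show False using i p h[OF i(1)] by (simp add: ac.mp_eval_mult)
    qed
    then have "tdeg h = 0" using r Q0 h[of 0] homogeneous_tdeg[OF r] by (cases "h = 0") auto
    then obtain k where k: "h = mconst k" by (rule tdeg_0_const)
    then have "k \<noteq> 0" using Q0 h[of 0] by auto
    then show ?thesis using h k unfolding Q_def by blast
  qed
  have nF: "\<exists>i\<le>m. mp_eval to_ac p (F i) \<noteq> 0" and nG: "\<exists>i\<le>m. mp_eval to_ac p (G i) \<noteq> 0"
    if "p \<in> space_points ?P" for p
    using nocommon[OF fm F that] nocommon[OF gm G that] .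
  obtain k where k: "k \<noteq> 0" "\<And>i. i \<le> m \<Longrightarrow> mp_eval mconst F (G i) = mconst k * mvar i"
    using key[OF dF(1) dG(1) rat_inverse_of_papp(2)[OF fB g F(1) G(1) generic_gpt] nF nG] by blast
  obtain l where l: "l \<noteq> 0" "\<And>i. i \<le> m \<Longrightarrow> mp_eval mconst G (F i) = mconst l * mvar i"
    using key[OF dG(1) dF(1) rat_inverse_of_papp(1)[OF fB g F(1) G(1) generic_gpt] nG nF] by blast
  obtain d where d: "\<And>i. homogeneous d (F i)" "\<And>i. mvars (F i) \<subseteq> {0..m}" "\<And>i. i > m \<Longrightarrow> F i = 0" using dominantE[OF dF(1)] by metis
  obtain e where e: "\<And>i. homogeneous e (G i)" "\<And>i. mvars (G i) \<subseteq> {0..m}" "\<And>i. i > m \<Longrightarrow> G i = 0" using dominantE[OF dG(1)] by metis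
  have "homogeneous (d * e) (mp_eval mconst F (G 0))" using d e by (intro homogeneous_mp_eval)
  moreover have "homogeneous (Suc 0) (mp_eval mconst F (G 0))" using k(2)[of 0] by (simp add: homogeneous_mult_mconst)
  \<comment> \<open>A constant multiple of the identity has degree 1.\<close>
  ultimately have "d * e = 1" using homogeneous_unique[of "d * e" "mp_eval mconst F (G 0)" 1] k by simp
  then have de: "d = Suc 0" "e = Suc 0" by auto
  define A where "A i j = Poly_Mapping.lookup (F i) (Poly_Mapping.single j (Suc 0))" for i j
  define B where "B i j = Poly_Mapping.lookup (G i) (Poly_Mapping.single j (Suc 0))" for i j
  have FA: "F = lin m A"
    using linear_form[of "F _" "{0..m}"] d de by (auto simp: lin_def A_def atLeast0AtMost fun_eq_iff)
  have GB: "G = lin m B"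
    using linear_form[of "G _" "{0..m}"] e de by (auto simp: lin_def B_def atLeast0AtMost fun_eq_iff)
  have lk: "Poly_Mapping.lookup (mp_eval mconst (lin m C) (lin m D i)) (Poly_Mapping.single j (Suc 0)) = (\<Sum>k\<le>m. D i k * C k j)"
    if "i \<le> m" "j \<le> m" for C D :: "nat \<Rightarrow> nat \<Rightarrow> 'a" and i j
  proof -
    interpret e: comm_ring_hom "mp_eval mconst (lin m C)" by (rule mconst.comm_ring_hom_mp_eval)
    have "mp_eval mconst (lin m C) (lin m D i) = (\<Sum>k\<le>m. mconst (D i k) * lin m C k)"
      using that by (subst lin_def[of m D]) (simp add: e.hom_sum e.hom_mult)
    also have "\<dots> = (\<Sum>k\<le>m. mconst (D i k) * (\<Sum>j\<le>m. mconst (C k j) * mvar j))"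
      by (simp add: lin_def)
    also have "\<dots> = (\<Sum>k\<le>m. \<Sum>j\<le>m. mconst (D i k * C k j) * mvar j)"
      by (simp add: sum_distrib_left mconst_mult mult.assoc)
    finally show ?thesis using that by (simp add: lookup_sum lookup_mconst_mvar)
  qed
  have BA: "(\<Sum>s\<le>m. B i s * A s j) = (if i = j then k else 0)" if "i \<le> m" "j \<le> m" for i j
  proof -
    have "Poly_Mapping.lookup (mp_eval mconst F (G i)) (Poly_Mapping.single j (Suc 0)) = (\<Sum>s\<le>m. B i s * A s j)"
      using lk[OF that, of A B] by (simp only: FA[symmetric] GB[symmetric])
    then show ?thesis unfolding k(2)[OF that(1)] lookup_mconst_mvar by auto
  qed
  have AB: "(\<Sum>s\<le>m. A i s * B s j) = (if i = j then l else 0)" if "i \<le> m" "j \<le> m" for i j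
  proof -
    have "Poly_Mapping.lookup (mp_eval mconst G (F i)) (Poly_Mapping.single j (Suc 0)) = (\<Sum>s\<le>m. A i s * B s j)"
      using lk[OF that, of B A] by (simp only: FA[symmetric] GB[symmetric])
    then show ?thesis unfolding l(2)[OF that(1)] lookup_mconst_mvar by auto
  qed
  \<comment> \<open>Row 0 of A B A is computed in two ways and compared at a nonzero entry of that
    row of A.\<close>
  have kl: "k = l"
  proof -
    have "F 0 \<noteq> 0" using generic_nonzero[of m "\<lambda>i. tf (F i)" 0] dF(1) by (simp add: dominant_def)
    have "\<exists>j\<le>m. A 0 j \<noteq> 0"
    proof (rule ccontr)
      assume "\<not> ?thesis"
      then have "lin m A 0 = 0" by (simp add: lin_def)
      then show False using \<open>F 0 \<noteq> 0\<close> FA by simp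
    qed
    then obtain j where j: "j \<le> m" "A 0 j \<noteq> 0" by blast
    have "(\<Sum>s\<le>m. A 0 s * (\<Sum>t\<le>m. B s t * A t j)) = (\<Sum>t\<le>m. (\<Sum>s\<le>m. A 0 s * B s t) * A t j)"
      unfolding sum_distrib_left sum_distrib_right mult.assoc by (rule sum.swap)
    moreover have "(\<Sum>s\<le>m. A 0 s * (\<Sum>t\<le>m. B s t * A t j)) = (\<Sum>s\<le>m. if s = j then A 0 s * k else 0)"
      using j by (intro sum.cong) (auto simp: BA)
    moreover have "(\<Sum>t\<le>m. (\<Sum>s\<le>m. A 0 s * B s t) * A t j) = (\<Sum>t\<le>m. if t = 0 then l * A t j else 0)"
      by (intro sum.cong) (auto simp: AB)
    ultimately show ?thesis using j by simp
  qed
  have "matinv m A (\<lambda>i j. B i j / k)"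
    unfolding matinv_def using AB BA k(1) by (simp add: kl sum_divide_distrib[symmetric])
  then show ?thesis using that dF(2) FA by blast
qed

subsection \<open>Linear open embeddings\<close>

lemma single_root_poly:
  fixes p :: "'a::alg_closed_field poly"
  assumes "p \<noteq> 0" "\<And>t. poly p t = 0 \<Longrightarrow> t = c"
  shows "p = Polynomial.smult (Polynomial.lead_coeff p) ([:- c, 1:] ^ Polynomial.degree p)"
proof -
  obtain A where A: "size A = Polynomial.degree p" "p = Polynomial.smult (Polynomial.lead_coeff p) (\<Prod>x\<in>#A. [:-x, 1:])"
    using alg_closed_imp_factorization[OF assms(1)] by blast
  have "x = c" if "x \<in># A" for x
  proof (rule assms(2))
    have "poly (\<Prod>x\<in>#A. [:-x, 1:]) x = 0" using that by (auto simp: poly_prod_mset)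
    then show "poly p x = 0" by (subst A(2)) simp
  qed
  then have "(\<Prod>x\<in>#A. [:-x, 1:]) = (\<Prod>x\<in>#A. [:- c, 1:])" by (intro arg_cong[where f = prod_mset] image_mset_cong) auto
  then show ?thesis using A by simp
qed

text \<open>Induction on the variables: a point is chosen where the leading coefficient in x does
  not vanish, and then a value of x outside the finitely many roots of the resulting univariate
  polynomial.\<close>

lemma exists_nonzero_point:
  fixes h :: "'a::field \<Rightarrow> 'b::alg_closed_field" and p :: "'a mpoly"
  assumes h: "comm_ring_hom h" and "p \<noteq> 0"
  shows "\<exists>v. mp_eval h v p \<noteq> 0"
proof -
  interpret h: comm_ring_hom h by fact
  have inj: "h c \<noteq> 0" if "c \<noteq> 0" for c
  proof
    assume "h c = 0"
    then have "h (c * inverse c) = 0" by (simp add: h.hom_mult)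
    then show False using that by simp
  qed
  have *: "\<exists>v. mp_eval h v p \<noteq> 0" if "finite V" "mvars p \<subseteq> V" "p \<noteq> 0" for V and p :: "'a mpoly"
    using that
  proof (induction V arbitrary: p rule: finite_induct)
    case empty
    then have "mon_deg m = 0" if "m \<in> Poly_Mapping.keys p" for m
      using that by (auto simp: mvars_def mon_deg_def)
    then have "tdeg p = 0" using tdeg_le_iff[of p 0] by auto
    then obtain c where "p = mconst c" by (rule tdeg_0_const)
    then show ?case using empty inj by auto
  next
    case (insert x V)
    let ?n = "deg_in x p" and ?c = "Polynomial.coeff (split_var x p)"
    have cV: "mvars (?c k) \<subseteq> V" for k using insert by (intro mvars_coeff_split_var)
    have "?c ?n \<noteq> 0" using insert by simp
    then obtain v where v: "mp_eval h v (?c ?n) \<noteq> 0" using insert.IH cV by blast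
    define q where "q = (\<Sum>k\<le>?n. Polynomial.monom (mp_eval h v (?c k)) k)"
    have "Polynomial.coeff q ?n = mp_eval h v (?c ?n)" by (simp add: q_def coeff_sum coeff_monom)
    then have "q \<noteq> 0" using v by auto
    then have "finite {t. poly q t = 0}" by (rule poly_roots_finite)
    then have "{t. poly q t = 0} \<noteq> UNIV" using infinite_UNIV_alg_closed[where 'a='b] by auto
    then obtain t where t: "poly q t \<noteq> 0" by blast
    interpret e: comm_ring_hom "mp_eval h (v(x := t))" by (rule h.comm_ring_hom_mp_eval)
    have "mp_eval h (v(x := t)) p = mp_eval h (v(x := t)) (poly (split_var x p) (mvar x))" by simp
    also have "\<dots> = (\<Sum>k\<le>?n. mp_eval h (v(x := t)) (?c k) * t ^ k)"
      unfolding poly_altdef by (simp add: e.hom_sum e.hom_mult e.hom_power)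
    also have "\<dots> = (\<Sum>k\<le>?n. mp_eval h v (?c k) * t ^ k)"
    proof (intro sum.cong refl arg_cong2[of _ _ _ _ "(*)"] mp_eval_cong)
      fix k i assume "i \<in> mvars (?c k)"
      then show "(v(x := t)) i = v i" using cV[of k] insert.hyps by auto
    qed
    also have "\<dots> = poly q t" by (simp add: q_def poly_sum poly_monom)
    finally show ?case using t by metis
  qed
  show ?thesis by (rule *[OF finite_mvars subset_refl assms(2)])
qed

lemma mon_val_line:
  fixes p q :: "nat \<Rightarrow> 'b::comm_ring_1"
  shows "Polynomial.degree (mon_val (\<lambda>j. [:p j, q j:]) m) \<le> mon_deg m \<and>
    Polynomial.coeff (mon_val (\<lambda>j. [:p j, q j:]) m) (mon_deg m) = mon_val q m"
proof -
  have pw: "Polynomial.degree ([:a, b:] ^ k) \<le> k \<and> Polynomial.coeff ([:a, b:] ^ k) k = b ^ k" for a b :: 'b and k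
  proof (induction k)
    case (Suc k)
    have "Polynomial.degree ([:a, b:] * [:a, b:] ^ k) \<le> Suc k"
      using degree_mult_le[of "[:a, b:]" "[:a, b:] ^ k"] degree_pCons_le[of a "[:b:]"] Suc by simp
    moreover have "Polynomial.coeff ([:a, b:] * [:a, b:] ^ k) (Suc k) = b * b ^ k"
      using Suc coeff_eq_0[of "[:a, b:] ^ k" "Suc k"] by simp
    ultimately show ?case by simp
  qed simp
  have "Polynomial.degree (\<Prod>l\<in>S. [:p l, q l:] ^ Poly_Mapping.lookup m l) \<le> (\<Sum>l\<in>S. Poly_Mapping.lookup m l) \<and>
     Polynomial.coeff (\<Prod>l\<in>S. [:p l, q l:] ^ Poly_Mapping.lookup m l) (\<Sum>l\<in>S. Poly_Mapping.lookup m l) = (\<Prod>l\<in>S. q l ^ Poly_Mapping.lookup m l)"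
    if "finite S" for S
    using that
  proof induction
    case (insert x S)
    let ?A = "[:p x, q x:] ^ Poly_Mapping.lookup m x" and ?B = "\<Prod>l\<in>S. [:p l, q l:] ^ Poly_Mapping.lookup m l"
    let ?a = "Poly_Mapping.lookup m x" and ?b = "\<Sum>l\<in>S. Poly_Mapping.lookup m l"
    have A: "Polynomial.degree ?A \<le> ?a" "Polynomial.coeff ?A ?a = q x ^ ?a" using pw by auto
    have B: "Polynomial.degree ?B \<le> ?b" "Polynomial.coeff ?B ?b = (\<Prod>l\<in>S. q l ^ Poly_Mapping.lookup m l)" using insert by auto
    have "Polynomial.coeff (?A * ?B) (?a + ?b) = Polynomial.coeff ?A ?a * Polynomial.coeff ?B ?b"
    proof -
      have "Polynomial.coeff (?A * ?B) (?a + ?b) = (\<Sum>i\<le>?a + ?b. Polynomial.coeff ?A i * Polynomial.coeff ?B (?a + ?b - i))"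
        by (rule Polynomial.coeff_mult)
      also have "\<dots> = (\<Sum>i\<le>?a + ?b. if i = ?a then Polynomial.coeff ?A ?a * Polynomial.coeff ?B ?b else 0)"
      proof (rule sum.cong)
        fix i assume "i \<in> {..?a + ?b}"
        have "Polynomial.coeff ?A i * Polynomial.coeff ?B (?a + ?b - i) = 0" if "i \<noteq> ?a"
        proof (cases "i < ?a")
          case True then have "Polynomial.degree ?B < ?a + ?b - i" using B by linarith
          then show ?thesis by (simp add: coeff_eq_0)
        next
          case False then have "Polynomial.degree ?A < i" using A that by linarith
          then show ?thesis by (simp add: coeff_eq_0)
        qed
        then show "Polynomial.coeff ?A i * Polynomial.coeff ?B (?a + ?b - i) = (if i = ?a then Polynomial.coeff ?A ?a * Polynomial.coeff ?B ?b else 0)"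
          by auto
      qed simp
      finally show ?thesis by simp
    qed
    moreover have "Polynomial.degree (?A * ?B) \<le> ?a + ?b" using degree_mult_le[of ?A ?B] A B by linarith
    ultimately show ?case using insert.hyps A B by simp
  qed simp
  from this[of "Poly_Mapping.keys m"] show ?thesis by (simp add: mon_val_def mon_deg_def)
qed

text \<open>On the line p + t q the coefficient of t^d is the value at the direction q of the
  component of degree d. A direction off the zeros of that component thus keeps the degree from
  dropping.\<close>

lemma line_restriction:
  fixes P :: "'a::field mpoly" and p q :: "nat \<Rightarrow> 'a alg_closure"
  assumes "tdeg P \<le> d"
  defines "f \<equiv> mp_eval (\<lambda>c. [:to_ac c:]) (\<lambda>j. [:p j, q j:]) P"
  shows "Polynomial.degree f \<le> d" "Polynomial.coeff f d = mp_eval to_ac q (Polynomial.coeff (tscale P) d)"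
proof -
  let ?M = "mon_val (\<lambda>j. [:p j, q j:])"
  have deg: "mon_deg m \<le> d" if "m \<in> Poly_Mapping.keys P" for m
    using mon_deg_le_tdeg[OF that] assms(1) by linarith
  have f: "f = (\<Sum>m\<in>Poly_Mapping.keys P. Polynomial.smult (to_ac (Poly_Mapping.lookup P m)) (?M m))"
    unfolding f_def mp_eval_alt by simp
  show "Polynomial.degree f \<le> d" unfolding f
    using mon_val_line[of p q] deg by (intro degree_sum_le degree_smult_le[THEN order_trans]) (auto intro: order_trans)
  have cm: "Polynomial.coeff (?M m) d = (if mon_deg m = d then mon_val q m else 0)" if "m \<in> Poly_Mapping.keys P" for m
  proof (cases "mon_deg m = d")
    case False
    then have "Polynomial.degree (?M m) < d" using mon_val_line[of p q m] deg[OF that] by linarith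
    then show ?thesis using False by (simp add: coeff_eq_0)
  qed (use mon_val_line[of p q m] in auto)
  have "Polynomial.coeff f d = (\<Sum>m\<in>Poly_Mapping.keys P. to_ac (Poly_Mapping.lookup (Polynomial.coeff (tscale P) d) m) * mon_val q m)"
    unfolding f by (auto simp: coeff_sum cm lookup_coeff_tscale intro!: sum.cong)
  also have "\<dots> = mp_eval to_ac q (Polynomial.coeff (tscale P) d)"
    by (rule ac.mp_eval_superset[symmetric]) (auto simp: in_keys_iff lookup_coeff_tscale split: if_splits)
  finally show "Polynomial.coeff f d = \<dots>" .
qed

text \<open>
  A curve all of whose general hyperplane sections are supported in a single point has degree at
  most \<open>1\<close> or is inseparable: a general section has the equation \<open>c (t - \<gamma>)\<^sup>d\<close>. If \<open>d \<ge> 2\<close> is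
  nonzero in the field, a general member of the pencil spanned by \<open>(t - \<gamma>)\<^sup>d\<close> and \<open>(t - \<gamma>')\<^sup>d\<close>
  has no multiple root.
\<close>

lemma curve_degree_le_1:
  fixes f :: "nat \<Rightarrow> 'b::alg_closed_field poly" and Q :: "'b mpoly"
  assumes nocommon: "\<And>t. \<exists>i\<le>n. poly (f i) t \<noteq> 0"
    and deg: "\<And>i. i \<le> n \<Longrightarrow> Polynomial.degree (f i) \<le> d" and i0: "i0 \<le> n" "Polynomial.coeff (f i0) d \<noteq> 0"
    and Q: "Q \<noteq> 0" "mvars Q \<subseteq> {0..n}"
    and gen: "\<And>a. mp_eval (\<lambda>c. c) a Q \<noteq> 0 \<Longrightarrow> (\<forall>i>n. a i = 0) \<Longrightarrow> (\<exists>i. a i \<noteq> 0) \<Longrightarrow>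
       \<exists>b0 b1. \<forall>t. poly (\<Sum>i\<le>n. Polynomial.smult (a i) (f i)) t = 0 \<longleftrightarrow> b0 + b1 * t = 0"
    and sep: "\<exists>i\<le>n. pderiv (f i) \<noteq> 0"
  shows "d \<le> 1"
proof (rule ccontr)
  assume "\<not> d \<le> 1"
  then have d2: "d \<ge> 2" by simp
  define h where "h = (\<lambda>c :: 'b. c)"
  have idh: "comm_ring_hom h" unfolding h_def by unfold_locales auto
  interpret I: comm_ring_hom h by (rule idh)
  have h: "h c = c" for c by (simp add: h_def)
  \<comment> \<open>As a function of \<open>a\<close>, this linear form is the coefficient of t^d in
    the section \<open>F a\<close>; sections of degree exactly d are those where it does not
    vanish.\<close>
  define lf where "lf = (\<Sum>i\<le>n. mconst (Polynomial.coeff (f i) d) * mvar i)"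
  define R where "R = Q * lf"
  have "Poly_Mapping.lookup lf (Poly_Mapping.single i0 (Suc 0)) = Polynomial.coeff (f i0) d"
    using i0 by (simp add: lf_def lookup_sum lookup_mconst_mvar)
  then have "lf \<noteq> 0" using i0 by auto
  then have R0: "R \<noteq> 0" using Q by (simp add: R_def)
  define F where "F a = (\<Sum>i\<le>n. Polynomial.smult (a i) (f i))" for a
  define good where "good a \<longleftrightarrow> mp_eval h a R \<noteq> 0 \<and> (\<forall>i>n. a i = 0)" for a
  have mR: "mvars R \<subseteq> {0..n}" unfolding R_def lf_def using Q
    by (intro order_trans[OF mvars_mult] Un_least mvars_sum) auto
  obtain a0 where a0: "mp_eval h a0 R \<noteq> 0" using exists_nonzero_point[OF idh R0] by blast
  have ga: "good (\<lambda>i. if i \<le> n then a0 i else 0)"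
  proof -
    have "mp_eval h (\<lambda>i. if i \<le> n then a0 i else 0) R = mp_eval h a0 R"
      by (rule mp_eval_cong) (use mR in auto)
    then show ?thesis using a0 by (simp add: good_def)
  qed
  define a where "a = (\<lambda>i. if i \<le> n then a0 i else 0)"
  have a: "good a" using ga by (simp only: a_def)
  have lfe: "mp_eval h a lf = Polynomial.coeff (F a) d" for a
  proof -
    interpret e: comm_ring_hom "mp_eval h a" by (rule I.comm_ring_hom_mp_eval)
    show ?thesis by (simp add: lf_def F_def e.hom_sum e.hom_mult coeff_sum mult.commute h)
  qed
  have power: "\<exists>c r. c \<noteq> 0 \<and> F a = Polynomial.smult c ([:- r, 1:] ^ d)" if "good a" for a
  proof -
    have cd: "Polynomial.coeff (F a) d \<noteq> 0" and Qa: "mp_eval h a Q \<noteq> 0" and az: "\<forall>i>n. a i = 0"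
      using that by (auto simp: good_def R_def I.mp_eval_mult lfe)
    have az': "\<exists>i. a i \<noteq> 0"
    proof (rule ccontr)
      assume "\<not> ?thesis" then have "F a = 0" by (simp add: F_def)
      then show False using cd by simp
    qed
    obtain b0 b1 where b: "\<And>t. poly (F a) t = 0 \<longleftrightarrow> b0 + b1 * t = 0" using gen[OF Qa[unfolded h_def] az az'] unfolding F_def by blast
    have "Polynomial.degree (F a) \<le> d" unfolding F_def
      by (intro degree_sum_le degree_smult_le[THEN order_trans] deg) auto
    then have dF: "Polynomial.degree (F a) = d" using le_degree[OF cd] by simp
    have F0: "F a \<noteq> 0" using cd by auto
    obtain r where r: "poly (F a) r = 0" using alg_closed_imp_poly_has_root[of "F a"] dF d2 by auto
    have "b1 \<noteq> 0"
    proof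
      assume "b1 = 0"
      then have "poly (F a) t = 0" for t using b[of r] b[of t] r by simp
      then show False using F0 poly_eq_0_if_almost_all_roots[of 0 "F a"] by blast
    qed
    then have "t = r" if "poly (F a) t = 0" for t
    proof -
      have "b0 + b1 * t = b0 + b1 * r" using that r b by simp
      then show ?thesis using \<open>b1 \<noteq> 0\<close> by simp
    qed
    then have "F a = Polynomial.smult (Polynomial.lead_coeff (F a)) ([:- r, 1:] ^ d)"
      using single_root_poly[OF F0] unfolding dF by blast
    then show ?thesis using F0 by (intro exI[of _ "Polynomial.lead_coeff (F a)"] exI[of _ r]) auto
  qed
  have Fupd: "F (a(i := a i + s)) = F a + Polynomial.smult s (f i)" if "i \<le> n" for a i s
  proof -
    have "F (a(i := a i + s)) = (\<Sum>k\<le>n. Polynomial.smult (a k) (f k) + (if k = i then Polynomial.smult s (f i) else 0))"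
      unfolding F_def by (intro sum.cong) (auto simp: smult_add_left)
    then show ?thesis using that by (simp add: sum.distrib F_def)
  qed
  \<comment> \<open>On a coordinate line through a good parameter only finitely many parameters are
    bad, so a perturbation can avoid any finite set.\<close>
  have fin: "finite {s. \<not> good (a(i := a i + s))}" if "good a" "i \<le> n" for a i
  proof -
    define r where "r = mp_eval (\<lambda>c. [:c:]) (\<lambda>j. [:a j, if j = i then 1 else 0:]) R"
    have pe: "comm_ring_hom (\<lambda>q :: 'b poly. poly q s)" for s by unfold_locales auto
    have rs: "poly r s = mp_eval h (a(i := a i + s)) R" for s
    proof -
      have "poly r s = mp_eval h (\<lambda>j. poly [:a j, if j = i then 1 else 0:] s) R"
        unfolding r_def h_def using hom_mp_eval[OF pe[of s], of "\<lambda>c. [:c:]" "\<lambda>j. [:a j, if j = i then 1 else 0:]" R] by simp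
      also have "(\<lambda>j. poly [:a j, if j = i then 1 else 0:] s) = a(i := a i + s)" by auto
      finally show ?thesis .
    qed
    have "a(i := a i) = a" by simp
    then have "poly r 0 \<noteq> 0" using rs[of 0] that(1) by (simp add: good_def)
    then have "r \<noteq> 0" by auto
    then have "finite {s. poly r s = 0}" by (rule poly_roots_finite)
    moreover have "{s. \<not> good (a(i := a i + s))} \<subseteq> {s. poly r s = 0}" using that by (auto simp: good_def rs)
    ultimately show ?thesis by (rule rev_finite_subset)
  qed
  have ex: "\<exists>s. s \<notin> S \<and> good (a(i := a i + s))" if "good a" "i \<le> n" "finite S" for a i S
  proof -
    have fu: "finite (S \<union> {s. \<not> good (a(i := a i + s))})" using fin that by simp
    have "S \<union> {s. \<not> good (a(i := a i + s))} \<noteq> UNIV"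
    proof
      assume eq: "S \<union> {s. \<not> good (a(i := a i + s))} = UNIV"
      show False using fu infinite_UNIV_alg_closed[where 'a='b] unfolding eq by blast
    qed
    then show ?thesis by blast
  qed
  have pd: "pderiv ([:- r, 1:] ^ d) = Polynomial.smult (of_nat d) ([:- r, 1:] ^ (d - 1))" for r :: 'b
  proof -
    obtain k where k: "d = Suc k" using d2 by (cases d) auto
    have "pderiv [:- r, 1:] = 1" by (simp add: pderiv_pCons one_pCons)
    then show ?thesis unfolding k pderiv_power_Suc by simp
  qed
  have z0: "(0 :: 'b) ^ d = 0" "(0 :: 'b) ^ (d - Suc 0) = 0" using d2 by (simp_all add: power_0_left)
  show False
  proof (cases "of_nat d = (0 :: 'b)")
    case True
    \<comment> \<open>If d vanishes in the field, all good sections have derivative zero. Perturbing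
      one coefficient transfers this to each \<open>f i\<close>, contradicting separability.\<close>
    have z: "pderiv (F a) = 0" if "good a" for a using power[OF that] by (auto simp: pderiv_smult pd True)
    have "pderiv (f i) = 0" if i: "i \<le> n" for i
    proof -
      obtain s where s: "s \<notin> {0}" "good (a(i := a i + s))" using ex[OF a i, of "{0}"] by blast
      have "pderiv (F (a(i := a i + s))) = 0" by (rule z[OF s(2)])
      then show ?thesis using s(1) z[OF a] by (simp add: Fupd[OF i] pderiv_add pderiv_smult)
    qed
    then show False using sep by blast
  next
    case False
    obtain c r where c: "c \<noteq> 0" "F a = Polynomial.smult c ([:- r, 1:] ^ d)" using power[OF a] by blast
    obtain i where i: "i \<le> n" "poly (f i) r \<noteq> 0" using nocommon by blast
    obtain s where s: "s \<notin> {0}" "good (a(i := a i + s))" using ex[OF a i(1), of "{0}"] by blast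
    obtain c1 r1 where c1: "c1 \<noteq> 0" "F (a(i := a i + s)) = Polynomial.smult c1 ([:- r1, 1:] ^ d)" using power[OF s(2)] by blast
    obtain u where u: "u \<notin> {0, s}" "good (a(i := a i + u))" using ex[OF a i(1), of "{0, s}"] by blast
    obtain c2 r2 where c2: "c2 \<noteq> 0" "F (a(i := a i + u)) = Polynomial.smult c2 ([:- r2, 1:] ^ d)" using power[OF u(2)] by blast
    \<comment> \<open>The member of the pencil F a + u f_i at parameter u is the combination of the
      members at 0 and at s with weights 1 - u/s and u/s; both weights are nonzero by the choice of
      u.\<close>
    define x where "x = (1 - u / s) * c"
    define y where "y = (u / s) * c1"
    have xy: "x \<noteq> 0" "y \<noteq> 0" using c c1 s u by (auto simp: x_def y_def divide_eq_1_iff)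
    have comb: "Polynomial.smult c2 ([:- r2, 1:] ^ d) = Polynomial.smult x ([:- r, 1:] ^ d) + Polynomial.smult y ([:- r1, 1:] ^ d)"
    proof -
      have "F a + Polynomial.smult u (f i) = Polynomial.smult (1 - u / s) (F a) + Polynomial.smult (u / s) (F a + Polynomial.smult s (f i))"
        using s(1) by (simp add: smult_add_right smult_diff_left)
      then have "Polynomial.smult c2 ([:- r2, 1:] ^ d) = Polynomial.smult (1 - u / s) (F a) + Polynomial.smult (u / s) (F (a(i := a i + s)))"
        using c2(2) by (simp only: Fupd[OF i(1)])
      then show ?thesis by (simp only: c1(2) c(2) smult_smult x_def y_def)
    qed
    \<comment> \<open>A common zero of both members would be a zero of \<open>f i\<close>, but
      \<open>i\<close> was chosen with f_i(r) nonzero.\<close>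
    have "r1 \<noteq> r"
    proof
      assume "r1 = r"
      then have "poly (F (a(i := a i + s))) r = 0" using d2 by (simp add: c1(2) poly_power)
      moreover have "poly (F a) r = 0" using d2 by (simp add: c(2) poly_power)
      ultimately show False using i s(1) by (simp add: Fupd[OF i(1)])
    qed
    define A where "A = r2 - r"
    define B where "B = r2 - r1"
    \<comment> \<open>The left-hand side of \<open>comb\<close> has a multiple root at
      \<open>r2\<close>, so the value and the derivative of the right-hand side vanish
      there.\<close>
    have e0: "x * A ^ d + y * B ^ d = 0"
      using arg_cong[OF comb, of "\<lambda>p. poly p r2"] z0 by (simp add: A_def B_def poly_power)
    have "of_nat d * (x * A ^ (d - 1) + y * B ^ (d - 1)) = 0"
      using arg_cong[OF comb, of "\<lambda>p. poly (pderiv p) r2"] z0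
      by (simp add: pderiv_add pderiv_smult pd A_def B_def poly_power algebra_simps)
    then have e1: "x * A ^ (d - 1) = - (y * B ^ (d - 1))" using False by (simp add: eq_neg_iff_add_eq_0)
    have dd: "z ^ d = z ^ (d - 1) * z" for z :: 'b using d2 by (cases d) (auto simp: mult.commute)
    have "y * B ^ (d - 1) * (B - A) = y * (B ^ (d - 1) * B) + - (y * B ^ (d - 1)) * A" by (simp add: algebra_simps)
    also have "\<dots> = x * A ^ d + y * B ^ d" unfolding e1[symmetric] dd[of A] dd[of B] by (simp add: mult.assoc)
    finally have "y * B ^ (d - 1) * (B - A) = 0" using e0 by simp
    moreover have "B - A \<noteq> 0" using \<open>r1 \<noteq> r\<close> by (simp add: A_def B_def)
    ultimately have "B = 0" using xy by simp
    then have "A = 0" using e0 z0 xy by simp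
    then show False using \<open>r1 \<noteq> r\<close> \<open>B = 0\<close> by (simp add: A_def B_def)
  qed
qed

lemma matinv_exists:
  fixes M :: "nat \<Rightarrow> nat \<Rightarrow> 'a::field"
  assumes "\<And>c. (\<And>j. j \<le> n \<Longrightarrow> (\<Sum>i\<le>n. c i * M i j) = 0) \<Longrightarrow> (\<forall>i\<le>n. c i = 0)"
  shows "\<exists>N. matinv n M N"
proof -
  define A where "A = mat (Suc n) (Suc n) (\<lambda>(i, j). M i j)"
  have A: "A \<in> carrier_mat (Suc n) (Suc n)" by (simp add: A_def)
  have "det A \<noteq> 0"
  proof
    assume "det A = 0"
    then have "det (transpose_mat A) = 0" by (simp add: det_transpose[OF A])
    then obtain v where v: "v \<in> carrier_vec (Suc n)" "v \<noteq> 0\<^sub>v (Suc n)" "transpose_mat A *\<^sub>v v = 0\<^sub>v (Suc n)"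
      using det_0_iff_vec_prod_zero_field[of "transpose_mat A" "Suc n"] A by auto
    have "(\<Sum>i\<le>n. v $ i * M i j) = 0" if "j \<le> n" for j
    proof -
      have "(transpose_mat A *\<^sub>v v) $ j = 0" using v(3) that by simp
      then show ?thesis using that v(1) A
        by (simp add: A_def scalar_prod_def mult.commute atLeast0LessThan lessThan_Suc_atMost)
    qed
    then have "\<forall>i\<le>n. v $ i = 0" using assms[of "\<lambda>i. v $ i"] by blast
    then have "v = 0\<^sub>v (Suc n)" using v(1) by (intro eq_vecI) auto
    then show False using v(2) by simp
  qed
  then obtain B where B: "B \<in> carrier_mat (Suc n) (Suc n)" "A * B = 1\<^sub>m (Suc n)" "B * A = 1\<^sub>m (Suc n)"
    using det_non_zero_imp_unit[OF A, of "()"] by (auto simp: Units_def ring_mat_def)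
  have "(\<Sum>k\<le>n. M i k * B $$ (k, j)) = (if i = j then 1 else 0)" if "i \<le> n" "j \<le> n" for i j
    using arg_cong[OF B(2), of "\<lambda>C. C $$ (i, j)"] that B(1)
    by (simp add: A_def scalar_prod_def atLeast0LessThan lessThan_Suc_atMost)
  moreover have "(\<Sum>k\<le>n. B $$ (i, k) * M k j) = (if i = j then 1 else 0)" if "i \<le> n" "j \<le> n" for i j
    using arg_cong[OF B(3), of "\<lambda>C. C $$ (i, j)"] that B(1)
    by (simp add: A_def scalar_prod_def atLeast0LessThan lessThan_Suc_atMost)
  ultimately have "matinv n M (\<lambda>i j. B $$ (i, j))" by (simp add: matinv_def)
  then show ?thesis by blast
qed

lemma mvars_coeff_tscale: "mvars (Polynomial.coeff (tscale P) k) \<subseteq> mvars P"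
  by (auto simp: mvars_def in_keys_iff lookup_coeff_tscale split: if_splits)

lemma exists_nonzero_point_in:
  fixes h :: "'a::field \<Rightarrow> 'b::alg_closed_field" and p :: "'a mpoly"
  assumes h: "comm_ring_hom h" and "p \<noteq> 0" "mvars p \<subseteq> V"
  shows "\<exists>v. mp_eval h v p \<noteq> 0 \<and> (\<forall>i. i \<notin> V \<longrightarrow> v i = 0)"
proof -
  obtain v where v: "mp_eval h v p \<noteq> 0" using exists_nonzero_point[OF h assms(2)] by blast
  have "mp_eval h (\<lambda>i. if i \<in> V then v i else 0) p = mp_eval h v p"
    by (rule mp_eval_cong) (use assms(3) in auto)
  then show ?thesis using v by (intro exI[of _ "\<lambda>i. if i \<in> V then v i else 0"]) auto
qed

text \<open>Univariate polynomials with derivative zero form a subring that contains the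
  constants.\<close>

lemma mp_eval_pderiv_zero:
  fixes P :: "'a::field mpoly" and f :: "nat \<Rightarrow> 'a alg_closure poly"
  assumes "\<And>i. i \<in> mvars P \<Longrightarrow> pderiv (f i) = 0"
  shows "pderiv (mp_eval (\<lambda>c. [:to_ac c:]) f P) = 0"
  using subset_refl
proof (induction P rule: mpoly_induct)
  case (var i) then show ?case using assms by simp
next
  case (add p q) then show ?case by (simp add: acp.mp_eval_add pderiv_add)
next
  case (mult p q) then show ?case by (simp add: acp.mp_eval_mult pderiv_mult)
qed (simp add: pderiv_pCons)

text \<open>The linear map with matrix \<open>M\<close> on the chart x_0 = 1: column 0 contains the
  constant terms.\<close>

definition afflin :: "nat \<Rightarrow> (nat \<Rightarrow> nat \<Rightarrow> 'a::field) \<Rightarrow> 'a tuple"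
  where "afflin n M = (\<lambda>i. if i \<le> n then mconst (M i 0) + (\<Sum>j\<in>{1..n}. mconst (M i j) * mvar j) else 0)"

lemma pev_afflin:
  assumes "w 0 \<noteq> 0"
  shows "pev (\<lambda>l. w l / w 0) (afflin n M i) = (1 / w 0) * lact kc n M w i"
proof (cases "i \<le> n")
  case True
  interpret e: comm_ring_hom "pev (\<lambda>l. w l / w 0)" by (rule kc.comm_ring_hom_mp_eval)
  have "(\<Sum>j\<le>n. kc (M i j) * w j) = kc (M i 0) * w 0 + (\<Sum>j\<in>{1..n}. kc (M i j) * w j)"
  proof -
    have "{..n} = insert 0 {1..n}" by auto
    then show ?thesis by simp
  qed
  then show ?thesis using True assms
    by (simp add: afflin_def lact_def e.hom_add e.hom_sum e.hom_mult distrib_left sum_distrib_left field_simps)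
qed (simp add: afflin_def lact_def kc.mp_eval_0)

text \<open>On a line where its degree d does not drop, the reduced representative F gives a curve
  without common zeros. A pulled-back hyperplane meets the line in the solutions of a linear
  equation, so \<open>curve_degree_le_1\<close> yields d <= 1. Then F is given by a matrix, whose
  rows are independent because the image of F is not contained in a hyperplane.\<close>

lemma linear_open_embedding_affine_linear:
  fixes \<tau> :: "'a::field ratmap"
  assumes \<tau>: "linear_open_embedding n \<tau>" and n: "n \<ge> 1"
  shows "\<exists>M N. matinv n M N \<and> afflin n M \<in> \<tau>"
proof -
  let ?A = "Aff n" and ?P = "Proj n"
  obtain Q :: "'a alg_closure mpoly" where
    mor: "morphism ?A ?P \<tau>" and bir: "birational ?A ?P \<tau>" and
    Q: "Q \<noteq> 0" "mvars Q \<subseteq> {0..n}"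
    and Qg: "\<And>a. a \<in> space_points ?P \<Longrightarrow> mp_eval (\<lambda>c. c) a Q \<noteq> 0 \<Longrightarrow> affine_hyperplane n (hyperplane_pullback n \<tau> a)"
    using \<tau> unfolding linear_open_embedding_def open_embedding_def by blast
  obtain \<psi> where \<psi>: "\<psi> \<in> RatMaps ?P ?A" "rat_comp ?A ?A \<psi> \<tau> = rat_id ?A" "rat_comp ?P ?P \<tau> \<psi> = rat_id ?P"
    using bir unfolding birational_def rat_inverse_of_def by blast
  have R: "\<tau> \<in> RatMaps ?A ?P" using mor by (simp add: morphism_def)
  obtain F where F: "F \<in> \<tau>" "\<forall>H\<in>\<tau>. \<exists>c. \<forall>i. H i = c * F i" using reduced_representative[OF R] by blast
  have Fr: "F \<in> rat_reps ?A ?P" by (rule RatMaps_member(1)[OF R F(1)])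
  have Fv: "mvars (F i) \<subseteq> {1..n}" for i using Fr by (simp add: rat_reps_def)
  have Fz: "F i = 0" if "i > n" for i using Fr that by (simp add: rat_reps_def)
  have nocommon: "\<exists>i\<le>n. mp_eval to_ac p (F i) \<noteq> 0" if p: "p \<in> space_points ?A" for p
  proof -
    obtain H i where H: "H \<in> \<tau>" "mp_eval to_ac p (H i) \<noteq> 0"
      using mor p by (auto simp: morphism_def regular_at_def tuple_at_def)
    obtain c where "H i = c * F i" using F(2) H(1) by blast
    then have *: "mp_eval to_ac p (F i) \<noteq> 0" using H(2) by (auto simp: ac.mp_eval_mult)
    moreover have "i \<le> n"
    proof (rule ccontr)
      assume "\<not> i \<le> n" then show False using Fz[of i] * by (simp add: ac.mp_eval_0)
    qed
    ultimately show ?thesis by blast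
  qed
  have pull: "p \<in> hyperplane_pullback n \<tau> a \<longleftrightarrow> (\<Sum>i\<le>n. a i * mp_eval to_ac p (F i)) = 0" if p: "p \<in> space_points ?A" for p a
  proof
    assume "p \<in> hyperplane_pullback n \<tau> a"
    then obtain H where H: "H \<in> \<tau>" "\<exists>i. mp_eval to_ac p (H i) \<noteq> 0" "(\<Sum>i=0..n. a i * mp_eval to_ac p (H i)) = 0"
      unfolding hyperplane_pullback_def by (auto simp: tuple_at_def)
    obtain c where c: "\<And>i. H i = c * F i" using F(2) H(1) by blast
    have "mp_eval to_ac p c \<noteq> 0" using H(2) by (auto simp: c ac.mp_eval_mult)
    moreover have "mp_eval to_ac p c * (\<Sum>i\<le>n. a i * mp_eval to_ac p (F i)) = 0"
      using H(3) by (simp add: c ac.mp_eval_mult sum_distrib_left ac_simps atLeast0AtMost)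
    ultimately show "(\<Sum>i\<le>n. a i * mp_eval to_ac p (F i)) = 0" by simp
  next
    assume "(\<Sum>i\<le>n. a i * mp_eval to_ac p (F i)) = 0"
    then show "p \<in> hyperplane_pullback n \<tau> a"
      unfolding hyperplane_pullback_def tuple_at_def using p F(1) nocommon[OF p]
      by (auto simp: tuple_at_def atLeast0AtMost intro!: bexI[of _ F])
  qed
  obtain F1 G where F1: "F1 \<in> \<tau>" and G: "G \<in> \<psi>" and GF: "tuple_comp G F1 \<in> rat_reps ?A ?A" "peq (\<lambda>i. tf (tuple_comp G F1 i)) (\<lambda>i. tf (id_tuple ?A i))"
  proof -
    have "id_tuple ?A \<in> rat_reps ?A (?A :: space)" by (auto simp: rat_reps_def)
    then show ?thesis using that rat_comp_obtain[of ?A ?A \<psi> \<tau> "id_tuple ?A"] \<psi>(2) unfolding rat_id_def by metis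
  qed
  have Gr: "G \<in> rat_reps ?P ?A" by (rule RatMaps_member(1)[OF \<psi>(1) G])
  obtain e where e: "\<And>i. homogeneous e (G i)" using Gr by (auto simp: rat_reps_def)
  have Gv: "mvars (G i) \<subseteq> {0..n}" for i using Gr by (simp add: rat_reps_def)
  define W where "W i = mp_eval mconst F (G i)" for i
  obtain c1 where c1: "\<And>i. F1 i = c1 * F i" using F(2) F1 by blast
  have tc: "tuple_comp G F1 i = c1 ^ e * W i" for i
    unfolding tuple_comp_Proj[OF Gr] W_def using mconst.mp_eval_homogeneous_scale[OF e[of i], of c1 F] by (simp add: c1[abs_def])
  have W0: "W 0 \<noteq> 0" using GF(1) tc[of 0] by (auto simp: rat_reps_def)
  have c1e: "c1 ^ e \<noteq> 0" using GF(1) tc[of 0] by (auto simp: rat_reps_def)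
  have W1: "W 1 = mvar 1 * W 0"
  proof -
    have "vprop (\<lambda>i. tf (tuple_comp G F1 i)) (\<lambda>i. tf (id_tuple ?A i))" by (rule peq_vprop[OF GF(2)])
    then have "tf (tuple_comp G F1 1) * tf (id_tuple ?A 0) = tf (tuple_comp G F1 0) * tf (id_tuple ?A 1)"
      unfolding vprop_def by blast
    then have "tf (tuple_comp G F1 1) = tf (tuple_comp G F1 0 * mvar 1)" using n by (simp add: tf.hom_mult)
    then have "c1 ^ e * W 1 = c1 ^ e * (mvar 1 * W 0)" by (simp add: tc ac_simps)
    then show ?thesis using mult_left_cancel[OF c1e] by blast
  qed
  have Wv: "mvars (W 0) \<subseteq> {1..n}" unfolding W_def using Fv by (intro mvars_mp_eval)
  define d where "d = Max ((\<lambda>i. tdeg (F i)) ` {..n})"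
  have Fd: "tdeg (F i) \<le> d" if "i \<le> n" for i unfolding d_def using that by (intro Max_ge) auto
  have "d \<in> (\<lambda>i. tdeg (F i)) ` {..n}" unfolding d_def by (rule Max_in) auto
  then obtain i0 where i0: "i0 \<le> n" "tdeg (F i0) = d" by auto
  have d1: "d \<le> 1"
  proof (cases "d = 0")
    case False
    have "tscale (F i0) \<noteq> 0" using False i0 by auto
    then have top: "Polynomial.coeff (tscale (F i0)) d \<noteq> 0" using i0(2) by (metis leading_coeff_0_iff)
    \<comment> \<open>The direction q must keep the degree of \<open>F i0\<close>. Its first
      coordinate must also be nonzero, which is used for separability.\<close>
    have "Polynomial.coeff (tscale (F i0)) d * mvar 1 \<noteq> 0" using top by simp
    moreover have "mvars (Polynomial.coeff (tscale (F i0)) d * mvar 1) \<subseteq> {1..n}"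
      using n Fv[of i0] mvars_coeff_tscale[of "F i0" d] by (intro order_trans[OF mvars_mult]) auto
    ultimately obtain q where q: "mp_eval to_ac q (Polynomial.coeff (tscale (F i0)) d * mvar 1) \<noteq> 0" "\<And>i. i \<notin> {1..n} \<Longrightarrow> q i = 0"
      using exists_nonzero_point_in[OF comm_ring_hom_to_ac] by blast
    \<comment> \<open>The base point lies where the composite of F with the inverse has nonzero
      denominator \<open>W 0\<close>.\<close>
    obtain p where p: "mp_eval to_ac p (W 0) \<noteq> 0" "\<And>i. i \<notin> {1..n} \<Longrightarrow> p i = 0"
      using exists_nonzero_point_in[OF comm_ring_hom_to_ac W0 Wv] by blast
    define l where "l j = [:p j, q j:]" for j
    have lt: "poly (mp_eval (\<lambda>c. [:to_ac c:]) l P) t = mp_eval to_ac (\<lambda>j. p j + t * q j) P" for t P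
      by (simp add: poly_acp_eval l_def)
    have lpt: "(\<lambda>j. p j + t * q j) \<in> space_points ?A" for t using p(2) q(2) by auto
    define f where "f i = mp_eval (\<lambda>c. [:to_ac c:]) l (F i)" for i
    define w where "w i = mp_eval (\<lambda>c. [:to_ac c:]) l (W i)" for i
    have wf: "w i = mp_eval (\<lambda>c. [:to_ac c:]) f (G i)" for i
      unfolding w_def W_def f_def using hom_mp_eval[OF acp.comm_ring_hom_mp_eval, of l mconst F "G i"] by simp
    show ?thesis
    proof (rule curve_degree_le_1[where f = f and n = n and Q = Q and ?i0.0 = i0])
      show "\<exists>i\<le>n. poly (f i) t \<noteq> 0" for t using nocommon[OF lpt, of t] by (simp add: f_def lt)
      show "Polynomial.degree (f i) \<le> d" if "i \<le> n" for i
        unfolding f_def l_def[abs_def] by (rule line_restriction(1)[OF Fd[OF that]])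
      show "Polynomial.coeff (f i0) d \<noteq> 0" using q(1)
        unfolding f_def l_def[abs_def] line_restriction(2)[OF Fd[OF i0(1)]] by (auto simp: ac.mp_eval_mult)
      show "i0 \<le> n" "Q \<noteq> 0" "mvars Q \<subseteq> {0..n}" by fact+
      fix a :: "nat \<Rightarrow> 'a alg_closure"
      assume a: "mp_eval (\<lambda>c. c) a Q \<noteq> 0" "\<forall>i>n. a i = 0" "\<exists>i. a i \<noteq> 0"
      then have "affine_hyperplane n (hyperplane_pullback n \<tau> a)" by (intro Qg) auto
      then obtain b where b: "hyperplane_pullback n \<tau> a = {p \<in> space_points ?A. b 0 + (\<Sum>i=1..n. b i * p i) = 0}"
        unfolding affine_hyperplane_def by blast
      have "poly (\<Sum>i\<le>n. Polynomial.smult (a i) (f i)) t = 0 \<longleftrightarrow> (b 0 + (\<Sum>i=1..n. b i * p i)) + (\<Sum>i=1..n. b i * q i) * t = 0" for t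
      proof -
        have "poly (\<Sum>i\<le>n. Polynomial.smult (a i) (f i)) t = (\<Sum>i\<le>n. a i * mp_eval to_ac (\<lambda>j. p j + t * q j) (F i))"
          by (simp add: poly_sum f_def lt)
        also have "\<dots> = 0 \<longleftrightarrow> (\<lambda>j. p j + t * q j) \<in> hyperplane_pullback n \<tau> a" using pull[OF lpt] by simp
        also have "\<dots> \<longleftrightarrow> b 0 + (\<Sum>i=1..n. b i * (p i + t * q i)) = 0" unfolding b using lpt by blast
        also have "b 0 + (\<Sum>i=1..n. b i * (p i + t * q i)) = (b 0 + (\<Sum>i=1..n. b i * p i)) + (\<Sum>i=1..n. b i * q i) * t"
          by (simp add: distrib_left sum.distrib sum_distrib_right sum_distrib_left ac_simps)
        finally show ?thesis .
      qed
      then show "\<exists>b0 b1. \<forall>t. poly (\<Sum>i\<le>n. Polynomial.smult (a i) (f i)) t = 0 \<longleftrightarrow> b0 + b1 * t = 0" by blast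
    next
      \<comment> \<open>The inverse recovers x_1 as W_1 / W_0. If all f_i had derivative zero, then
        so would w_0 and w_1 = l_1 w_0, where l_1 has derivative q_1; hence q_1 w_0 = 0.\<close>
      show "\<exists>i\<le>n. pderiv (f i) \<noteq> 0"
      proof (rule ccontr)
        assume "\<not> ?thesis"
        then have z: "pderiv (f i) = 0" if "i \<le> n" for i using that by blast
        have pw: "pderiv (w i) = 0" for i unfolding wf
          by (rule mp_eval_pderiv_zero) (use Gv[of i] in \<open>auto intro!: z\<close>)
        have "w 1 = l 1 * w 0" unfolding w_def W1 by (simp add: acp.mp_eval_mult)
        then have "pderiv (l 1 * w 0) = 0" using pw[of 1] by simp
        moreover have "pderiv (l 1) = [:q 1:]" by (simp add: l_def pderiv_pCons)
        ultimately have "Polynomial.smult (q 1) (w 0) = 0" using pw[of 0] by (auto simp: pderiv_mult)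
        moreover have "q 1 \<noteq> 0" using q(1) by (auto simp: ac.mp_eval_mult)
        moreover have "poly (w 0) 0 \<noteq> 0" using p(1) by (simp add: w_def lt)
        ultimately show False by auto
      qed
    qed
  qed simp
  define M where "M i j = Poly_Mapping.lookup (F i) (if j = 0 then 0 else Poly_Mapping.single j (Suc 0))" for i j
  have FM: "F = afflin n M"
  proof
    fix i show "F i = afflin n M i"
    proof (cases "i \<le> n")
      case True
      then have "tdeg (F i) \<le> 1" using Fd d1 by (meson order_trans)
      then show ?thesis using affine_linear_form[OF _ Fv[of i]] True by (simp add: afflin_def M_def)
    qed (simp add: afflin_def Fz)
  qed
  \<comment> \<open>A linear relation between the rows of M is a linear relation between the
    components of F. Composed with the inverse, it becomes one between the coordinates of the
    generic point.\<close>
  have "\<forall>i\<le>n. c i = 0" if c: "\<And>j. j \<le> n \<Longrightarrow> (\<Sum>i\<le>n. c i * M i j) = 0" for c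
  proof -
    obtain G2 F2 where G2: "G2 \<in> \<psi>" and F2: "F2 \<in> \<tau>" and FG: "tuple_comp F2 G2 \<in> rat_reps ?P ?P" "peq (\<lambda>i. tf (tuple_comp F2 G2 i)) (\<lambda>i. tf (id_tuple ?P i))"
      using rat_comp_obtain[OF \<psi>(3)[unfolded rat_id_Proj] dominant_reps[OF dominant_id]] by blast
    obtain c2 where c2: "\<And>i. F2 i = c2 * F i" using F(2) F2 by blast
    have F2r: "F2 \<in> rat_reps ?A ?P" by (rule RatMaps_member(1)[OF R F2])
    have G2r: "G2 \<in> rat_reps ?P ?A" by (rule RatMaps_member(1)[OF \<psi>(1) G2])
    define x where "x i = tf (G2 i)" for i
    have x0: "x 0 \<noteq> 0" using G2r by (simp add: x_def rat_reps_def)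
    have "peq (act ?A F2 x) (gpt n)"
      using peq_trans[OF peq_sym[OF tf_tuple_comp[OF G2r F2r]] FG(2)] unfolding tf_id_tuple x_def[abs_def] .
    then obtain k where k: "k \<noteq> 0" "\<And>i. pev (\<lambda>l. x l / x 0) (F2 i) = k * gpt n i" by (auto simp: peq_def)
    define u where "u = pev (\<lambda>l. x l / x 0) c2"
    have uk: "u * (1 / x 0) * lact kc n M x i = k * gpt n i" for i
      using k(2)[of i] pev_afflin[where w = x, OF x0, of n M i] by (simp add: c2 FM[symmetric] kc.mp_eval_mult u_def mult.assoc)
    have "k * (\<Sum>i\<le>n. kc (c i) * gpt n i) = (\<Sum>i\<le>n. kc (c i) * (k * gpt n i))" by (simp add: sum_distrib_left ac_simps)
    also have "\<dots> = (\<Sum>i\<le>n. kc (c i) * (u * (1 / x 0) * lact kc n M x i))" by (simp only: uk)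
    also have "\<dots> = u * (1 / x 0) * (\<Sum>i\<le>n. kc (c i) * lact kc n M x i)" by (simp add: sum_distrib_left ac_simps)
    also have "(\<Sum>i\<le>n. kc (c i) * lact kc n M x i) = (\<Sum>i\<le>n. \<Sum>j\<le>n. kc (c i * M i j) * x j)"
      by (simp add: lact_def sum_distrib_left kc.hom_mult mult.assoc)
    also have "\<dots> = (\<Sum>j\<le>n. kc (\<Sum>i\<le>n. c i * M i j) * x j)"
      by (subst sum.swap) (simp add: kc.hom_sum sum_distrib_right)
    also have "\<dots> = 0" using c by simp
    finally have "(\<Sum>i\<le>n. kc (c i) * gpt n i) = 0" using k(1) by simp
    then have "tf (\<Sum>i\<le>n. mconst (c i) * mvar i) = 0" by (simp add: tf.hom_sum tf.hom_mult kc_def gpt_def)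
    then have z: "(\<Sum>i\<le>n. mconst (c i) * mvar i) = 0" by simp
    show ?thesis
    proof (intro allI impI)
      fix i assume "i \<le> n"
      then show "c i = 0" using arg_cong[OF z, of "\<lambda>P. Poly_Mapping.lookup P (Poly_Mapping.single i (Suc 0))"]
        by (simp add: lookup_sum lookup_mconst_mvar)
    qed
  qed
  then obtain N where "matinv n M N" using matinv_exists[of n M] by blast
  then show ?thesis using F(1) FM by blast
qed

section \<open>Suspension: the embedding in homogeneous coordinates\<close>

definition trunc :: "nat \<Rightarrow> (nat \<Rightarrow> 'b::zero) \<Rightarrow> nat \<Rightarrow> 'b"
  where "trunc n v = (\<lambda>i. if i \<le> n then v i else 0)"

lemma generic_trunc: assumes "generic (Suc n) v" shows "generic n (trunc n v)"
  unfolding generic_def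
proof (intro conjI allI impI)
  fix p :: "'a mpoly" and d assume p: "homogeneous d p" "mvars p \<subseteq> {0..n}" "p \<noteq> 0"
  have "pev (trunc n v) p = pev v p" by (rule mp_eval_cong) (use p(2) in \<open>auto simp: trunc_def\<close>)
  moreover have "mvars p \<subseteq> {0..Suc n}" using p(2) by auto
  moreover have "\<And>q e. homogeneous e q \<Longrightarrow> mvars q \<subseteq> {0..Suc n} \<Longrightarrow> q \<noteq> 0 \<Longrightarrow> pev v q \<noteq> 0"
    using assms unfolding generic_def by blast
  ultimately show "pev (trunc n v) p \<noteq> 0" using p by metis
qed (simp add: trunc_def)

lemma lact_trunc: "lact h n M (trunc n v) = lact h n M v"
  by (auto simp: lact_def trunc_def)

lemma lact_scale: "lact h n M (\<lambda>i. c * v i) = (\<lambda>i. c * lact h n M v i)"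
  by (auto simp: lact_def sum_distrib_left ac_simps)

lemma lact_peq: "peq v w \<Longrightarrow> peq (lact h n M v) (lact h n M w)"
  unfolding peq_def using lact_scale[of h n M] by (metis (no_types, lifting) ext)

lemma generic_lact:
  assumes "matinv n M N" "generic n v" shows "generic n (lact kc n M v)"
  using generic_papp[OF Bir_lin(1)[OF assms(1)] assms(2)] unfolding papp_lin .

lemma lin_Aff_reps: assumes "matinv n M N" shows "lin n M \<in> rat_reps (Proj n) (Aff n)"
proof -
  have "tf (lin n M 0) \<noteq> 0" using Bir_lin(1)[OF assms] generic_nonzero[of n "\<lambda>i. tf (lin n M i)" 0] by (simp add: dominant_def)
  then show ?thesis using lin_reps[OF assms] by (auto simp: rat_reps_def)
qed

lemma tf_lin: "(\<lambda>i. tf (lin n M i)) = lact kc n M (gpt n)"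
  by (auto simp: lin_def lact_def gpt_def kc_def tf.hom_sum tf.hom_mult)

text \<open>As \<open>rat_inv\<close> is a definite description, uniqueness is needed in addition to
  the two compositions: a right inverse y satisfies M y = id up to a factor, and applying N
  determines y.\<close>

lemma rat_inv_afflin:
  assumes MN: "matinv n M N" and R: "\<tau> \<in> RatMaps (Aff n) (Proj n)" and L: "afflin n M \<in> \<tau>"
  shows "rat_inv (Aff n) (Proj n) \<tau> = rat_class (Proj n) (Aff n) (lin n N)"
proof -
  let ?A = "Aff n" and ?P = "Proj n" and ?L = "afflin n M" and ?K = "lin n N"
  have NM: "matinv n N M" by (rule matinv_sym[OF MN])
  have Lr: "?L \<in> rat_reps ?A ?P" by (rule RatMaps_member(1)[OF R L])
  have Kr: "?K \<in> rat_reps ?P ?A" by (rule lin_Aff_reps[OF NM])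
  have K: "rat_class ?P ?A ?K \<in> RatMaps ?P ?A" "?K \<in> rat_class ?P ?A ?K"
    using Kr by (auto intro: RatMaps_classI rat_class_self)
  define x where "x = (\<lambda>i. tf (id_tuple ?A i :: 'a mpoly))"
  have xz: "x i = 0" if "i > n" for i using that by (simp add: x_def)
  have tL: "(\<lambda>i. tf (?L i)) = lact kc n M x"
  proof
    fix i
    have "pev (\<lambda>l. x l / x 0) (?L i) = pev (\<lambda>i. tf (mvar i)) (?L i)"
    proof (rule mp_eval_cong)
      fix j assume "j \<in> mvars (?L i)"
      moreover have "mvars (?L i) \<subseteq> {1..n}" using Lr by (simp add: rat_reps_def)
      ultimately have "j \<in> {1..n}" by blast
      then show "x j / x 0 = tf (mvar j)" by (simp add: x_def)
    qed
    then show "tf (?L i) = lact kc n M x i"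
      using pev_afflin[of x n M i] by (simp add: tf_pev x_def)
  qed
  have idr: "id_tuple ?A \<in> rat_reps ?A (?A :: space)" by (auto simp: rat_reps_def)
  have c1: "(\<lambda>i. tf (tuple_comp ?K ?L i)) = x"
    using tuple_comp_Proj[OF Kr] lact_lact[OF kc.comm_ring_hom_axioms NM xz]
    by (simp add: tf_mp_eval papp_lin tL)
  have c1r: "tuple_comp ?K ?L \<in> rat_reps ?A ?A"
  proof (rule tuple_comp_reps[OF Lr Kr])
    have "tf (tuple_comp ?K ?L 0) = x 0" using fun_cong[OF c1, of 0] .
    then show "case ?A of Aff _ \<Rightarrow> tuple_comp ?K ?L 0 \<noteq> 0 | Proj _ \<Rightarrow> \<exists>i. tuple_comp ?K ?L i \<noteq> 0" by (auto simp: x_def)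
  qed
  have 1: "rat_comp ?A ?A (rat_class ?P ?A ?K) \<tau> = rat_id ?A"
    unfolding rat_comp_eq[OF R K(1) L K(2) c1r] rat_id_def
    by (rule peq_rat_class_eq[OF c1r idr]) (simp only: c1 x_def[symmetric] peq_refl)
  define w where "w = lact kc n N (gpt n)"
  have w0: "w 0 \<noteq> 0" unfolding w_def by (rule generic_nonzero[OF generic_lact[OF NM generic_gpt]]) simp
  have MK: "lact kc n M w = gpt n"
    unfolding w_def by (rule lact_lact[OF kc.comm_ring_hom_axioms MN]) (simp add: gpt_def)
  have actL: "peq (act ?A ?L v) (lact kc n M v)" if "v 0 \<noteq> 0" for v
    using that pev_afflin[where w = v, OF that] by (intro peqI[of "1 / v 0"]) auto
  have c2: "peq (\<lambda>i. tf (tuple_comp ?L ?K i)) (gpt n)"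
    using peq_trans[OF tf_tuple_comp[OF Kr Lr]] actL[of w, OF w0] unfolding tf_lin w_def[symmetric] MK by blast
  have c2r: "tuple_comp ?L ?K \<in> rat_reps ?P ?P"
  proof (rule tuple_comp_reps[OF Kr Lr])
    have "tf (tuple_comp ?L ?K 0) \<noteq> 0" using peq_nonzero[OF peq_sym[OF c2], of 0] by (simp add: gpt_def)
    then show "case ?P of Aff _ \<Rightarrow> tuple_comp ?L ?K 0 \<noteq> 0 | Proj _ \<Rightarrow> \<exists>i. tuple_comp ?L ?K i \<noteq> 0" by auto
  qed
  have 2: "rat_comp ?P ?P \<tau> (rat_class ?P ?A ?K) = rat_id ?P"
    unfolding rat_comp_eq[OF K(1) R K(2) L c2r] rat_id_Proj
    by (rule peq_rat_class_eq[OF c2r dominant_reps[OF dominant_id]]) (simp only: c2 tf_id_tuple)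
  have inv: "rat_inverse_of ?A ?P \<tau> (rat_class ?P ?A ?K)" using K 1 2 by (simp add: rat_inverse_of_def)
  have "g = rat_class ?P ?A ?K" if g: "rat_inverse_of ?A ?P \<tau> g" for g
  proof -
    have gR: "g \<in> RatMaps ?P ?A" and gc: "rat_comp ?P ?P \<tau> g = rat_id ?P" using g by (auto simp: rat_inverse_of_def)
    obtain G F where G: "G \<in> g" and F: "F \<in> \<tau>" and FG: "tuple_comp F G \<in> rat_reps ?P ?P" "peq (\<lambda>i. tf (tuple_comp F G i)) (\<lambda>i. tf (id_tuple ?P i))"
      using rat_comp_obtain[OF gc[unfolded rat_id_Proj] dominant_reps[OF dominant_id]] by blast
    have Fr: "F \<in> rat_reps ?A ?P" by (rule RatMaps_member(1)[OF R F])
    have Gr: "G \<in> rat_reps ?P ?A" by (rule RatMaps_member(1)[OF gR G])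
    define y where "y = (\<lambda>i. tf (G i))"
    have y0: "y 0 \<noteq> 0" using Gr by (simp add: y_def rat_reps_def)
    have yz: "y i = 0" if "i > n" for i using Gr that by (simp add: y_def rat_reps_def)
    have p1: "peq (act ?A F y) (gpt n)"
      using peq_trans[OF peq_sym[OF tf_tuple_comp[OF Gr Fr]] FG(2)] unfolding tf_id_tuple y_def .
    have "vprop (act ?A ?L y) (act ?A F y)" by (rule act_vprop[OF RatMaps_proportional[OF R L F]])
    moreover have "act ?A F y 0 \<noteq> 0" by (rule peq_nonzero[OF peq_sym[OF p1]]) (simp add: gpt_def)
    moreover have "\<exists>i. act ?A ?L y i \<noteq> 0"
    proof (rule ccontr)
      assume "\<not> ?thesis"
      then have z: "lact kc n M y = (\<lambda>i. 0)" using peq_nonzero[OF peq_sym[OF actL[of y, OF y0]]] by blast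
      have "y = lact kc n N (lact kc n M y)" using lact_lact[OF kc.comm_ring_hom_axioms NM yz] by simp
      then have "y 0 = lact kc n N (\<lambda>i. 0) 0" by (simp only: z)
      then show False using y0 by (simp add: lact_def)
    qed
    ultimately have "peq (act ?A ?L y) (act ?A F y)" using vprop_peq by blast
    then have "peq (lact kc n M y) (gpt n)" using peq_trans[OF peq_sym[OF actL[of y, OF y0]]] peq_trans[OF _ p1] by blast
    then have "peq (lact kc n N (lact kc n M y)) (lact kc n N (gpt n))" by (rule lact_peq)
    then have "peq y (lact kc n N (gpt n))" by (simp only: lact_lact[OF kc.comm_ring_hom_axioms NM yz])
    then have "rat_class ?P ?A G = rat_class ?P ?A ?K"
      by (intro peq_rat_class_eq Gr Kr) (simp only: tf_lin y_def)
    then show ?thesis using RatMaps_member(2)[OF gR G] by simp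
  qed
  then show ?thesis unfolding rat_inv_def using inv by (intro the_equality)
qed

text \<open>The new component is a multiple of \<open>H 0\<close>, so it scales together with the
  representative, and the union over all representatives is a single class.\<close>

lemma iota_aff_class:
  assumes H: "H \<in> rat_reps (Aff n) (Aff n)"
  shows "iota_aff n (rat_class (Aff n) (Aff n) H) = rat_class (Aff (n + 1)) (Aff (n + 1)) (H(n + 1 := H 0 * mvar (n + 1)))"
    "H(n + 1 := H 0 * mvar (n + 1)) \<in> rat_reps (Aff (n + 1)) (Aff (n + 1))"
proof -
  have r: "F(n + 1 := F 0 * mvar (n + 1)) \<in> rat_reps (Aff (n + 1)) (Aff (n + 1))" if F: "F \<in> rat_reps (Aff n) (Aff n)" for F :: "'a tuple"
  proof -
    have "mvars (F i) \<subseteq> {1..n + 1}" for i using F by (force simp: rat_reps_def)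
    moreover have "mvars (F 0 * mvar (n + 1)) \<subseteq> {1..n + 1}" using calculation[of 0] by (intro order_trans[OF mvars_mult]) auto
    ultimately show ?thesis using F by (auto simp: rat_reps_def)
  qed
  show "H(n + 1 := H 0 * mvar (n + 1)) \<in> rat_reps (Aff (n + 1)) (Aff (n + 1))" by (rule r[OF H])
  have "rat_class (Aff (n + 1)) (Aff (n + 1)) (F(n + 1 := F 0 * mvar (n + 1))) = rat_class (Aff (n + 1)) (Aff (n + 1)) (H(n + 1 := H 0 * mvar (n + 1)))"
    if F: "F \<in> rat_class (Aff n) (Aff n) H" for F
  proof (rule peq_rat_class_eq)
    show "F(n + 1 := F 0 * mvar (n + 1)) \<in> rat_reps (Aff (n + 1)) (Aff (n + 1))" using F by (intro r) (simp add: rat_class_def)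
    show "H(n + 1 := H 0 * mvar (n + 1)) \<in> rat_reps (Aff (n + 1)) (Aff (n + 1))" by (rule r[OF H])
    have "peq (\<lambda>i. tf (F i)) (\<lambda>i. tf (H i))"
      by (rule RatMaps_peq[OF RatMaps_classI[OF H] F rat_class_self[OF H]])
    then obtain c where "c \<noteq> 0" "\<And>i. tf (F i) = c * tf (H i)" by (auto simp: peq_def)
    then show "peq (\<lambda>i. tf ((F(n + 1 := F 0 * mvar (n + 1))) i)) (\<lambda>i. tf ((H(n + 1 := H 0 * mvar (n + 1))) i))"
      by (intro peqI[of c]) (auto simp: tf.hom_mult)
  qed
  then show "iota_aff n (rat_class (Aff n) (Aff n) H) = rat_class (Aff (n + 1)) (Aff (n + 1)) (H(n + 1 := H 0 * mvar (n + 1)))"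
    unfolding iota_aff_def using rat_class_self[OF H] by blast
qed

text \<open>In affine coordinates y_i = v_i / v_0 the point is sent to \<Phi>_i / \<Phi>_0 for i <=
  n, and y_(n+1) is kept; all coordinates are then multiplied by v_0 \<Phi>_0.\<close>

definition suspend :: "nat \<Rightarrow> ((nat \<Rightarrow> 'b::field) \<Rightarrow> nat \<Rightarrow> 'b) \<Rightarrow> (nat \<Rightarrow> 'b) \<Rightarrow> nat \<Rightarrow> 'b"
  where "suspend n \<Phi> v = (\<lambda>i. if i \<le> n then v 0 * \<Phi> v i else if i = Suc n then v (Suc n) * \<Phi> v 0 else 0)"

text \<open>Once both chart maps are matrices, \<open>\<iota>\<close> is a suspension between linear
  coordinate changes. Each stage of the composition is evaluated at one generic point, which both
  computes it and shows that no intermediate tuple degenerates.\<close>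

lemma linear_embedding_formula:
  fixes \<iota> :: "'a::field ratmap \<Rightarrow> 'a ratmap"
  assumes \<iota>: "linear_embedding n \<iota>" and n: "n \<ge> 1"
  shows "\<exists>M N M' N'. matinv n M N \<and> matinv (Suc n) M' N' \<and>
    (\<forall>\<phi>\<in>carrier (Bir (Proj n)). \<forall>F\<in>\<phi>. \<exists>T\<in>\<iota> \<phi>. peq (\<lambda>i. tf (T i))
       (lact kc (Suc n) M' (suspend n (\<lambda>v. lact kc n N (papp F (lact kc n M v))) (lact kc (Suc n) N' (gpt (Suc n))))))"
proof -
  let ?A = "Aff n" and ?P = "Proj n" and ?A' = "Aff (Suc n)" and ?P' = "Proj (Suc n)"
  obtain \<tau> \<tau>' where \<tau>: "linear_open_embedding n \<tau>" "linear_open_embedding (Suc n) \<tau>'"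
    and form: "\<And>\<phi>. \<phi> \<in> carrier (Bir ?P) \<Longrightarrow> \<iota> \<phi> = rat_comp ?P' ?P'
       (rat_comp ?A' ?P' \<tau>' (iota_aff n (rat_comp ?A ?A (rat_inv ?A ?P \<tau>) (rat_comp ?A ?P \<phi> \<tau>)))) (rat_inv ?A' ?P' \<tau>')"
    using \<iota> unfolding linear_embedding_def Let_def by auto
  obtain M N where MN: "matinv n M N" "afflin n M \<in> \<tau>" using linear_open_embedding_affine_linear[OF \<tau>(1) n] by blast
  obtain M' N' where MN': "matinv (Suc n) M' N'" "afflin (Suc n) M' \<in> \<tau>'" using linear_open_embedding_affine_linear[OF \<tau>(2)] by auto
  have R: "\<tau> \<in> RatMaps ?A ?P" "\<tau>' \<in> RatMaps ?A' ?P'"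
    using \<tau> by (auto simp: linear_open_embedding_def open_embedding_def morphism_def)
  note inv = rat_inv_afflin[OF MN(1) R(1) MN(2)] rat_inv_afflin[OF MN'(1) R(2) MN'(2)]
  have NM: "matinv n N M" "matinv (Suc n) N' M'" using MN MN' matinv_sym by auto
  let ?L = "afflin n M" and ?L' = "afflin (Suc n) M'" and ?K = "lin n N" and ?K' = "lin (Suc n) N'"
  have Lr: "?L \<in> rat_reps ?A ?P" "?L' \<in> rat_reps ?A' ?P'"
    using RatMaps_member(1)[OF R(1) MN(2)] RatMaps_member(1)[OF R(2) MN'(2)] .
  have Kr: "?K \<in> rat_reps ?P ?A" "?K' \<in> rat_reps ?P' ?A'" using lin_Aff_reps NM by blast+
  define z where "z = lact kc (Suc n) N' (gpt (Suc n))"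
  have gz: "generic (Suc n) z" unfolding z_def by (rule generic_lact[OF NM(2) generic_gpt])
  have z0: "z 0 \<noteq> 0" by (rule generic_nonzero[OF gz]) simp
  \<comment> \<open>The affine coordinates of z, at which the maps with affine source are
    evaluated.\<close>
  define y where "y = (\<lambda>l. z l / z 0)"
  have "\<exists>T\<in>\<iota> \<phi>. peq (\<lambda>i. tf (T i)) (lact kc (Suc n) M' (suspend n (\<lambda>v. lact kc n N (papp F (lact kc n M v))) z))"
    if \<phi>: "\<phi> \<in> carrier (Bir ?P)" and F: "F \<in> \<phi>" for \<phi> F
  proof -
    have dF: "dominant n F" and \<phi>F: "\<phi> = pclass n F" using Bir_member[OF \<phi> F] by auto
    have Fr: "F \<in> rat_reps ?P ?P" by (rule dominant_reps[OF dF])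
    have \<phi>R: "\<phi> \<in> RatMaps ?P ?P" unfolding \<phi>F by (rule RatMaps_classI[OF Fr])
    obtain d where d: "\<And>i. homogeneous d (F i)" using dominantE[OF dF] by metis
    define u where "u = lact kc n N (papp F (lact kc n M z))"
    have "generic n (lact kc n N (papp F (lact kc n M (trunc n z))))"
      by (intro generic_lact[OF NM(1)] generic_papp[OF dF] generic_lact[OF MN(1)] generic_trunc gz)
    then have gu: "generic n u" unfolding u_def lact_trunc .
    then have u0: "u 0 \<noteq> 0" using generic_nonzero by blast
    define H1 where "H1 = tuple_comp F ?L"
    define H where "H = tuple_comp ?K H1"
    define H' where "H' = H(n + 1 := H 0 * mvar (n + 1))"
    define T1 where "T1 = tuple_comp ?L' H'"
    define T where "T = tuple_comp T1 ?K'"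
    have yL: "papp ?L y = (\<lambda>i. (1 / z 0) * lact kc n M z i)"
      unfolding y_def using pev_afflin[where w = z, OF z0] by auto
    have yH1: "papp H1 y = (\<lambda>i. (1 / z 0) ^ d * pev (lact kc n M z) (F i))"
      unfolding H1_def papp_tuple_comp[OF Fr] yL by (rule ext) (rule kc.mp_eval_homogeneous_scale[OF d])
    have yH: "papp H y = (\<lambda>i. (1 / z 0) ^ d * u i)"
      unfolding H_def papp_tuple_comp[OF Kr(1)] papp_lin yH1 lact_scale u_def ..
    have "pev y (H 0) \<noteq> 0" using fun_cong[OF yH, of 0] u0 z0 by simp
    then have H0: "H 0 \<noteq> 0" by (auto simp: kc.mp_eval_0)
    have H1r: "H1 \<in> rat_reps ?A ?P" unfolding H1_def
    proof (rule tuple_comp_reps[OF Lr(1) Fr])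
      have "\<exists>i. H1 i \<noteq> 0"
      proof (rule ccontr)
        assume "\<not> ?thesis" then have "H 0 = 0" unfolding H_def tuple_comp_Proj[OF Kr(1)] by (simp add: lin_def mconst.mp_eval_sum_distrib mconst.mp_eval_mult)
        then show False using H0 by simp
      qed
      then show "case ?P of Aff _ \<Rightarrow> tuple_comp F ?L 0 \<noteq> 0 | Proj _ \<Rightarrow> \<exists>i. tuple_comp F ?L i \<noteq> 0" by (simp add: H1_def)
    qed
    have c1: "rat_comp ?A ?P \<phi> \<tau> = rat_class ?A ?P H1"
      unfolding H1_def by (rule rat_comp_eq[OF R(1) \<phi>R MN(2) F H1r[unfolded H1_def]])
    have Hr: "H \<in> rat_reps ?A ?A" unfolding H_def
      by (rule tuple_comp_reps[OF H1r Kr(1)]) (use H0 in \<open>simp add: H_def\<close>)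
    have c2: "rat_comp ?A ?A (rat_inv ?A ?P \<tau>) (rat_comp ?A ?P \<phi> \<tau>) = rat_class ?A ?A H"
      unfolding c1 inv H_def
      by (rule rat_comp_eq[OF RatMaps_classI[OF H1r] RatMaps_classI[OF Kr(1)] rat_class_self[OF H1r] rat_class_self[OF Kr(1)] Hr[unfolded H_def]])
    have c3: "iota_aff n (rat_class ?A ?A H) = rat_class ?A' ?A' H'" and H'r: "H' \<in> rat_reps ?A' ?A'"
      using iota_aff_class[OF Hr] by (simp_all add: H'_def)
    define U where "U = suspend n (\<lambda>v. lact kc n N (papp F (lact kc n M v))) z"
    have yH': "papp H' y = (\<lambda>i. ((1 / z 0) ^ d / z 0) * U i)"
    proof
      fix i
      have "i > Suc n \<Longrightarrow> H i = 0" using Hr by (simp add: rat_reps_def)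
      then show "pev y (H' i) = ((1 / z 0) ^ d / z 0) * U i"
        using fun_cong[OF yH, of i] fun_cong[OF yH, of 0] z0
        by (auto simp: H'_def U_def suspend_def u_def[symmetric] kc.mp_eval_mult kc.mp_eval_0 y_def)
    qed
    have U0: "U 0 \<noteq> 0" using z0 u0 by (simp add: U_def suspend_def u_def[symmetric])
    have yH'0: "pev y (H' 0) \<noteq> 0" using fun_cong[OF yH', of 0] U0 z0 by simp
    have Hp: "peq (papp H' y) U" by (rule peqI[of "(1 / z 0) ^ d / z 0"]) (simp add: z0, rule fun_cong[OF yH'])
    have "peq (papp T1 y) (lact kc (Suc n) M' (papp H' y))"
      unfolding T1_def using pev_tuple_comp_Aff[OF Lr(2), of y H'] pev_afflin[where w = "papp H' y", OF yH'0] yH'0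
      by (intro peqI[of "pev y (H' 0) ^ tuple_deg ?L' * (1 / pev y (H' 0))"]) (auto simp: mult.assoc)
    then have T1p: "peq (papp T1 y) (lact kc (Suc n) M' U)" using peq_trans lact_peq[OF Hp] by blast
    have MU: "\<exists>i. lact kc (Suc n) M' U i \<noteq> 0"
    proof (rule ccontr)
      assume "\<not> ?thesis"
      then have zz: "lact kc (Suc n) M' U = (\<lambda>i. 0)" by blast
      have "U = lact kc (Suc n) N' (lact kc (Suc n) M' U)"
        by (rule lact_lact[OF kc.comm_ring_hom_axioms NM(2), symmetric]) (simp add: U_def suspend_def)
      then have "U 0 = 0" unfolding zz by (simp add: lact_def)
      then show False using U0 by simp
    qed
    then obtain i where i: "lact kc (Suc n) M' U i \<noteq> 0" by blast
    have "pev y (T1 i) \<noteq> 0" using peq_nonzero[OF peq_sym[OF T1p] i] .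
    then have T1i: "T1 i \<noteq> 0" by (auto simp: kc.mp_eval_0)
    have T1r: "T1 \<in> rat_reps ?A' ?P'" unfolding T1_def
      by (rule tuple_comp_reps[OF H'r Lr(2)]) (use T1i in \<open>auto simp: T1_def\<close>)
    have c4: "rat_comp ?A' ?P' \<tau>' (rat_class ?A' ?A' H') = rat_class ?A' ?P' T1"
      unfolding T1_def by (rule rat_comp_eq[OF RatMaps_classI[OF H'r] R(2) rat_class_self[OF H'r] MN'(2) T1r[unfolded T1_def]])
    have Tp: "peq (\<lambda>i. tf (T i)) (lact kc (Suc n) M' U)"
      using peq_trans[OF tf_tuple_comp[OF Kr(2) T1r]] T1p unfolding T_def tf_lin z_def[symmetric] by (simp add: y_def)
    have Ti: "T i \<noteq> 0" using peq_nonzero[OF peq_sym[OF Tp] i] by simp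
    have Tr: "T \<in> rat_reps ?P' ?P'" unfolding T_def
      by (rule tuple_comp_reps[OF Kr(2) T1r]) (use Ti in \<open>auto simp: T_def\<close>)
    have "\<iota> \<phi> = rat_class ?P' ?P' T"
      unfolding form[OF \<phi>] c2 unfolding c3 c4 inv T_def
      by (rule rat_comp_eq[OF RatMaps_classI[OF Kr(2)] RatMaps_classI[OF T1r] rat_class_self[OF Kr(2)] rat_class_self[OF T1r] Tr[unfolded T_def]])
    then have "T \<in> \<iota> \<phi>" using rat_class_self[OF Tr] by simp
    then show ?thesis using Tp unfolding U_def by blast
  qed
  then show ?thesis using MN(1) MN'(1) unfolding z_def by blast
qed

subsection \<open>The generating set\<close>

definition std_tuple :: "nat \<Rightarrow> 'a::field tuple"
  where "std_tuple m = (\<lambda>i. if i \<le> m then (\<Prod>j\<in>{0..m} - {i}. mvar j) else 0)"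

lemma std_involution_std_tuple: "std_involution m = pclass m (std_tuple m)"
  by (simp add: std_involution_def std_tuple_def)

lemma papp_std_tuple:
  assumes "\<And>i. i \<le> m \<Longrightarrow> v i \<noteq> 0"
  shows "papp (std_tuple m) v = (\<lambda>i. if i \<le> m then (\<Prod>j\<le>m. v j) / v i else 0)"
proof
  fix i
  interpret e: comm_ring_hom "pev v" by (rule kc.comm_ring_hom_mp_eval)
  have "(\<Prod>j\<le>m. v j) = v i * (\<Prod>j\<in>{0..m} - {i}. v j)" if "i \<le> m"
    using prod.remove[of "{0..m}" i v] that by (simp add: atLeast0AtMost)
  then show "pev v (std_tuple m i) = (if i \<le> m then (\<Prod>j\<le>m. v j) / v i else 0)"
    using assms[of i] by (auto simp: std_tuple_def e.hom_prod)
qed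

lemma tf_std_tuple: "(\<lambda>i. tf (std_tuple m i)) = papp (std_tuple m) (gpt m)"
proof -
  have "mvars (std_tuple m i) \<subseteq> {0..m}" for i :: nat by (auto simp: std_tuple_def intro!: mvars_prod)
  then show ?thesis by (intro ext pev_gpt[symmetric])
qed

lemma std_tuple_reps: "std_tuple m \<in> rat_reps (Proj m) (Proj m)"
proof -
  have "homogeneous m (std_tuple m i :: 'a mpoly)" for i
  proof (cases "i \<le> m")
    case True
    have "homogeneous (\<Sum>j\<in>{0..m} - {i}. 1) (\<Prod>j\<in>{0..m} - {i}. mvar j :: 'a mpoly)"
      by (rule homogeneous_prod) simp
    then show ?thesis using True by (simp add: std_tuple_def)
  qed (simp add: std_tuple_def)
  moreover have "mvars (std_tuple m i :: 'a mpoly) \<subseteq> {0..m}" for i by (auto simp: std_tuple_def intro!: mvars_prod)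
  moreover have "std_tuple m 0 \<noteq> (0 :: 'a mpoly)" by (simp add: std_tuple_def)
  moreover have "std_tuple m i = 0" if "i > m" for i using that by (simp add: std_tuple_def)
  ultimately show ?thesis unfolding rat_reps_def by auto
qed

lemma std_tuple_twice:
  assumes "m \<ge> 1" "\<And>i. i \<le> m \<Longrightarrow> v i \<noteq> 0" "\<And>i. i > m \<Longrightarrow> v i = 0"
  shows "peq (papp (std_tuple m) (papp (std_tuple m) v)) v"
proof -
  let ?P = "\<Prod>j\<le>m. v j"
  have P: "?P \<noteq> 0" using assms(2) by (simp add: prod_zero_iff)
  have 1: "papp (std_tuple m) v = (\<lambda>i. if i \<le> m then ?P / v i else 0)" by (rule papp_std_tuple[OF assms(2)])
  have "papp (std_tuple m) (papp (std_tuple m) v) =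
     (\<lambda>i. if i \<le> m then (\<Prod>j\<le>m. papp (std_tuple m) v j) / papp (std_tuple m) v i else 0)"
    by (rule papp_std_tuple) (use 1[THEN fun_cong] P assms(2) in simp)
  also have "\<dots> = (\<lambda>i. if i \<le> m then (\<Prod>j\<le>m. ?P / v j) / (?P / v i) else 0)"
    using 1[THEN fun_cong] by (intro ext) simp
  also have "\<dots> = (\<lambda>i. ((\<Prod>j\<le>m. ?P / v j) / ?P) * v i)" using assms(3) by (auto simp: not_le)
  finally show ?thesis using P assms(2) by (intro peqI[of "(\<Prod>j\<le>m. ?P / v j) / ?P"]) (auto simp: fun_eq_iff prod_zero_iff)
qed

lemma std_Bir:
  assumes "m \<ge> 1"
  shows "dominant m (std_tuple m :: 'a::field tuple)" "pclass m (std_tuple m :: 'a tuple) \<in> carrier (Bir (Proj m))"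
proof -
  have "peq (papp (std_tuple m) (\<lambda>i. tf (std_tuple m i))) (gpt m :: nat \<Rightarrow> 'a mpoly fract)"
    unfolding tf_std_tuple using generic_nonzero[OF generic_gpt] by (intro std_tuple_twice assms) (auto simp: gpt_def)
  from BirI[OF std_tuple_reps std_tuple_reps this this]
  show "dominant m (std_tuple m :: 'a tuple)" "pclass m (std_tuple m :: 'a tuple) \<in> carrier (Bir (Proj m))" by auto
qed

lemma G_generators: "m \<ge> 1 \<Longrightarrow> insert (std_involution m) (Aut_Proj m) \<subseteq> carrier (Bir (Proj m))"
  using std_Bir(2)[of m] by (auto simp: std_involution_std_tuple Aut_Proj_def)

lemma subgroup_G_group: "m \<ge> 1 \<Longrightarrow> subgroup (G_group m) (Bir (Proj m))"
  unfolding G_group_def by (rule group.generate_is_subgroup[OF group_Bir G_generators])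

lemma lin_G_group: "matinv m A B \<Longrightarrow> pclass m (lin m A) \<in> G_group m"
  unfolding G_group_def by (intro generate.incl insertI2 lin_Aut)

lemma std_G_group: "pclass m (std_tuple m) \<in> G_group m"
  unfolding G_group_def std_involution_std_tuple[symmetric] by (intro generate.incl insertI1)

subsection \<open>Partial derivatives and the Jacobian\<close>

text \<open>The expansion of p at x_j + t in powers of t. Its linear coefficient is the partial
  derivative, and multiplicativity of the substitution gives the product rule.\<close>

definition taylor :: "nat \<Rightarrow> 'a::comm_ring_1 mpoly \<Rightarrow> 'a mpoly poly"
  where "taylor j = mp_eval (\<lambda>c. [:mconst c:]) (\<lambda>i. [:mvar i, if i = j then 1 else 0:])"

interpretation taylor: comm_ring_hom "taylor j" for j
  unfolding taylor_def by (rule mconst2.comm_ring_hom_mp_eval)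

definition pd :: "nat \<Rightarrow> 'a::comm_ring_1 mpoly \<Rightarrow> 'a mpoly"
  where "pd j p = Polynomial.coeff (taylor j p) 1"

lemma coeff_taylor_0: "Polynomial.coeff (taylor j p) 0 = p"
proof -
  have h: "comm_ring_hom (\<lambda>q :: 'a mpoly poly. poly q 0)" by unfold_locales auto
  have "Polynomial.coeff (taylor j p) 0 = poly (taylor j p) 0" by (simp add: poly_0_coeff_0)
  also have "\<dots> = p" unfolding taylor_def using hom_mp_eval[OF h, of "\<lambda>c. [:mconst c:]"] by simp
  finally show ?thesis .
qed

lemma pd_add: "pd j (p + q) = pd j p + pd j q" by (simp add: pd_def taylor.hom_add)
lemma pd_mult: "pd j (p * q) = p * pd j q + pd j p * q"
  by (simp add: pd_def taylor.hom_mult Polynomial.coeff_mult coeff_taylor_0)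
lemma pd_mconst [simp]: "pd j (mconst c) = 0" by (simp add: pd_def taylor_def)
lemma pd_mvar: "pd j (mvar i) = (if i = j then 1 else 0)" by (simp add: pd_def taylor_def)
lemma pd_0 [simp]: "pd j 0 = 0" using pd_mconst[of j 0] by simp
lemma pd_sum: "pd j (sum f A) = (\<Sum>a\<in>A. pd j (f a))"
  by (induction A rule: infinite_finite_induct) (auto simp: pd_add)

lemma pd_const: assumes "j \<notin> mvars p" shows "pd j p = 0"
  using subset_refl[of "mvars p"]
proof (induction p rule: mpoly_induct)
  case (var i) then show ?case using assms by (auto simp: pd_mvar)
qed (auto simp: pd_add pd_mult)

lemma pd_chain:
  assumes "mvars p \<subseteq> V" "finite V"
  shows "pd j (mp_eval mconst F p) = (\<Sum>l\<in>V. mp_eval mconst F (pd l p) * pd j (F l))"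
  using assms(1)
proof (induction p rule: mpoly_induct)
  case (const c) then show ?case by (simp add: mconst.mp_eval_0)
next
  case (var i)
  have "(\<Sum>l\<in>V. mp_eval mconst F (pd l (mvar i)) * pd j (F l)) = (\<Sum>l\<in>V. if l = i then pd j (F i) else 0)"
    by (intro sum.cong) (auto simp: pd_mvar mconst.mp_eval_0 comm_ring_hom.mp_eval_mconst[OF comm_ring_hom_mconst, of F 1, simplified])
  then show ?case using var assms(2) by simp
next
  case (add p q) then show ?case by (simp add: mconst.mp_eval_add pd_add distrib_right sum.distrib)
next
  case (mult p q) then show ?case
    by (simp add: mconst.mp_eval_add mconst.mp_eval_mult pd_mult distrib_right distrib_left sum.distrib sum_distrib_left sum_distrib_right ac_simps)
qed

text \<open>The identity p(tx) = t^e p is differentiated at t = 1.\<close>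

lemma euler:
  fixes p :: "'a::idom mpoly"
  assumes "homogeneous e p" "mvars p \<subseteq> V" "finite V"
  shows "(\<Sum>l\<in>V. mvar l * pd l p) = of_nat e * p"
proof -
  have "poly (pderiv (tscale p)) 1 = (\<Sum>l\<in>V. mvar l * pd l p)"
    using assms(2)
  proof (induction p rule: mpoly_induct)
    case (const c) then show ?case by (simp add: tscale_def pderiv_pCons)
  next
    case (var i)
    have "(\<Sum>l\<in>V. mvar l * pd l (mvar i)) = (\<Sum>l\<in>V. if l = i then mvar i else (0 :: 'a mpoly))"
      by (intro sum.cong) (auto simp: pd_mvar)
    then show ?case using var assms(3) by (simp add: tscale_def pderiv_monom poly_monom)
  next
    case (add p q) then show ?case by (simp add: tscale.hom_add pderiv_add pd_add distrib_left sum.distrib)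
  next
    case (mult p q) then show ?case
      by (simp add: tscale.hom_mult pderiv_mult pd_mult distrib_left sum.distrib sum_distrib_left sum_distrib_right ac_simps)
  qed
  then show ?thesis using assms(1) by (simp add: homogeneous_iff pderiv_monom poly_monom)
qed

text \<open>
  Up to the factor \<open>x_0\<close>, and to the degree, this is the Jacobian determinant of the homogeneous
  polynomials \<open>F_0, \<dots>, F_m\<close>. In contrast to the latter it never vanishes for a birational map, also if
  the characteristic divides the degree.
\<close>

definition jmat :: "nat \<Rightarrow> 'a::field tuple \<Rightarrow> 'a mpoly mat"
  where "jmat m F = mat (Suc m) (Suc m) (\<lambda>(i, j). if j = 0 then F i else pd j (F i))"

definition jac :: "nat \<Rightarrow> 'a::field tuple \<Rightarrow> 'a mpoly" where "jac m F = det (jmat m F)"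

lemma jmat_carrier [simp]: "jmat m F \<in> carrier_mat (Suc m) (Suc m)" by (simp add: jmat_def)

lemma mat_mult_index:
  assumes "A \<in> carrier_mat (Suc m) (Suc m)" "B \<in> carrier_mat (Suc m) (Suc m)" "i \<le> m" "j \<le> m"
  shows "(A * B) $$ (i, j) = (\<Sum>k\<le>m. A $$ (i, k) * B $$ (k, j))"
  using assms by (simp add: scalar_prod_def atLeast0LessThan lessThan_Suc_atMost)

lemma prod_diag: "A \<in> carrier_mat (Suc m) (Suc m) \<Longrightarrow> prod_list (diag_mat A) = A $$ (0, 0) * (\<Prod>i\<in>{1..m}. A $$ (i, i))"
proof -
  assume A: "A \<in> carrier_mat (Suc m) (Suc m)"
  have "prod_list (diag_mat A) = (\<Prod>i\<in>{0..<Suc m}. A $$ (i, i))" using A by (simp add: prod_list_diag_prod)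
  also have "{0..<Suc m} = insert 0 {1..m}" by auto
  finally show ?thesis by simp
qed

lemma det_upper: 
  assumes "A \<in> carrier_mat (Suc m) (Suc m)" "\<And>i j. j < i \<Longrightarrow> i \<le> m \<Longrightarrow> A $$ (i, j) = (0 :: 'b::comm_ring_1)"
  shows "det A = A $$ (0, 0) * (\<Prod>i\<in>{1..m}. A $$ (i, i))"
  using det_upper_triangular[OF _ assms(1)] assms prod_diag[OF assms(1)] by (auto simp: upper_triangular_def)

lemma det_lower: 
  assumes "A \<in> carrier_mat (Suc m) (Suc m)" "\<And>i j. i < j \<Longrightarrow> j \<le> m \<Longrightarrow> A $$ (i, j) = (0 :: 'b::idom)"
  shows "det A = A $$ (0, 0) * (\<Prod>i\<in>{1..m}. A $$ (i, i))"
  using det_lower_triangular[OF _ assms(1)] assms prod_diag[OF assms(1)] by auto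

text \<open>Expansion along the first column gives the corner entry times the same minor for both
  matrices; the rest of row 0 does not matter.\<close>

lemma det_first_column:
  assumes A: "A \<in> carrier_mat (Suc m) (Suc m)" and B: "B \<in> carrier_mat (Suc m) (Suc m)"
    and A0: "\<And>i. 1 \<le> i \<Longrightarrow> i \<le> m \<Longrightarrow> A $$ (i, 0) = 0" and B0: "\<And>i. 1 \<le> i \<Longrightarrow> i \<le> m \<Longrightarrow> B $$ (i, 0) = 0"
    and eq: "\<And>i j. 1 \<le> i \<Longrightarrow> i \<le> m \<Longrightarrow> 1 \<le> j \<Longrightarrow> j \<le> m \<Longrightarrow> A $$ (i, j) = B $$ (i, j)"
  shows "B $$ (0, 0) * det A = A $$ (0, 0) * det (B :: 'b::comm_ring_1 mat)"
proof -
  have e: "det C = C $$ (0, 0) * cofactor C 0 0" if C: "C \<in> carrier_mat (Suc m) (Suc m)" "\<And>i. 1 \<le> i \<Longrightarrow> i \<le> m \<Longrightarrow> C $$ (i, 0) = 0" for C :: "'b mat"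
  proof -
    have "det C = (\<Sum>i<Suc m. C $$ (i, 0) * cofactor C i 0)" by (rule laplace_expansion_column[OF C(1)]) simp
    also have "\<dots> = (\<Sum>i<Suc m. if i = 0 then C $$ (0, 0) * cofactor C 0 0 else 0)"
      by (intro sum.cong) (auto simp: C(2))
    finally show ?thesis by simp
  qed
  have "mat_delete A 0 0 = mat_delete B 0 0"
    by (rule eq_matI) (use A B eq in \<open>auto simp: mat_delete_def\<close>)
  then have "cofactor A 0 0 = cofactor B 0 0" by (simp add: cofactor_def)
  then show ?thesis using e[OF A A0] e[OF B B0] by simp
qed

text \<open>By the product rule the derivative columns of h F are h times those of F plus multiples
  of the column F. The exponent m + 1 is what later makes parity decisive.\<close>

lemma jac_scale: "jac m (\<lambda>i. h * F i) = h ^ Suc m * jac m F"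
proof -
  define U where "U = mat (Suc m) (Suc m) (\<lambda>(i, j). if i = j then h else if i = 0 then pd j h else 0)"
  have U: "U \<in> carrier_mat (Suc m) (Suc m)" by (simp add: U_def)
  have "jmat m (\<lambda>i. h * F i) = jmat m F * U"
  proof (rule eq_matI)
    fix i j assume "i < dim_row (jmat m F * U)" "j < dim_col (jmat m F * U)"
    then have ij: "i \<le> m" "j \<le> m" by (simp_all add: jmat_def U_def)
    have "(jmat m F * U) $$ (i, j) = (\<Sum>k\<le>m. (if k = j then jmat m F $$ (i, j) * h else 0) + (if k = 0 \<and> j \<noteq> 0 then F i * pd j h else 0))"
      unfolding mat_mult_index[OF jmat_carrier U ij] using ij by (intro sum.cong) (auto simp: U_def jmat_def)
    also have "\<dots> = jmat m F $$ (i, j) * h + (if j \<noteq> 0 then F i * pd j h else 0)"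
      using ij by (simp add: sum.distrib)
    also have "\<dots> = jmat m (\<lambda>i. h * F i) $$ (i, j)" using ij by (auto simp: jmat_def pd_mult ac_simps)
    finally show "jmat m (\<lambda>i. h * F i) $$ (i, j) = (jmat m F * U) $$ (i, j)" ..
  qed (auto simp: jmat_def U_def)
  moreover have "det U = h ^ Suc m" using det_upper[OF U] by (simp add: U_def)
  ultimately show ?thesis unfolding jac_def by (simp add: det_mult[OF jmat_carrier U] mult.commute)
qed

lemma hom_det:
  assumes "comm_ring_hom h" "A \<in> carrier_mat n n"
  shows "h (det A) = det (mat n n (\<lambda>(i, j). h (A $$ (i, j))))"
proof -
  interpret h: comm_ring_hom h by fact
  have "mat n n (\<lambda>(i, j). h (A $$ (i, j))) = map_mat h A" by (rule eq_matI) (use assms(2) in auto)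
  then show ?thesis by (simp add: h.hom_det)
qed

text \<open>The matrix of G contains G in place of its derivative with respect to x_0, so the usual
  chain rule is rewritten: Euler's relation, substituted at F, eliminates that derivative without
  dividing by the degree e. This yields a factorization through \<open>Z\<close>, whose lower right
  block consists of the expressions F_0 dF_l - F_l dF_0. The same block arises from the matrix of F
  by the row operations \<open>B\<close>. Powers of F_0 cancel except one.\<close>

lemma jac_comp:
  assumes F0: "F 0 \<noteq> 0" and G: "\<And>i. homogeneous e (G i)" "\<And>i. mvars (G i) \<subseteq> {..m}"
  shows "F 0 * jac m (\<lambda>i. mp_eval mconst F (G i)) = mp_eval mconst F (jac m G) * jac m F"
proof -
  let ?n = "Suc m" and ?s = "mp_eval mconst F"
  interpret s: comm_ring_hom ?s by (rule mconst.comm_ring_hom_mp_eval)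
  let ?C = "\<lambda>i. ?s (G i)"
  \<comment> \<open>Multiplies the derivative columns by F_0, which makes room for Euler's
    relation.\<close>
  define S where "S = mat ?n ?n (\<lambda>(i, j). if i = j then (if i = 0 then 1 else F 0) else 0)"
  define Y where "Y = mat ?n ?n (\<lambda>(i, j). if j = 0 then ?s (G i) else ?s (pd j (G i)))"
  \<comment> \<open>The entries e dF_0 in row 0 carry the degree; they do not affect the
    determinant, since column 0 vanishes below the corner.\<close>
  define Z where "Z = mat ?n ?n (\<lambda>(l, j). if l = 0 then (if j = 0 then 1 else of_nat e * pd j (F 0)) else if j = 0 then 0 else F 0 * pd j (F l) - F l * pd j (F 0))"
  \<comment> \<open>Replaces row i >= 1 by F_0 times row i minus F_i times row 0, which clears the
    first column.\<close>
  define B where "B = mat ?n ?n (\<lambda>(i, j). if i = j then (if i = 0 then 1 else F 0) else if j = 0 then - F i else 0)"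
  have c: "S \<in> carrier_mat ?n ?n" "Y \<in> carrier_mat ?n ?n" "Z \<in> carrier_mat ?n ?n" "B \<in> carrier_mat ?n ?n"
    by (simp_all add: S_def Y_def Z_def B_def)
  have dS: "det S = F 0 ^ m" using det_upper[OF c(1)] by (simp add: S_def)
  have dB: "det B = F 0 ^ m" using det_lower[OF c(4)] by (simp add: B_def)
  have dY: "det Y = ?s (jac m G)"
  proof -
    have "?s (jac m G) = det (mat ?n ?n (\<lambda>(i, j). ?s (jmat m G $$ (i, j))))"
      unfolding jac_def by (rule hom_det[OF s.comm_ring_hom_axioms jmat_carrier])
    also have "mat ?n ?n (\<lambda>(i, j). ?s (jmat m G $$ (i, j))) = Y" by (rule eq_matI) (auto simp: jmat_def Y_def)
    finally show ?thesis ..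
  qed
  have "jmat m ?C * S = Y * Z"
  proof (rule eq_matI)
    fix i j assume "i < dim_row (Y * Z)" "j < dim_col (Y * Z)"
    then have ij: "i \<le> m" "j \<le> m" by (simp_all add: Y_def Z_def)
    have "(jmat m ?C * S) $$ (i, j) = (\<Sum>k\<le>m. if k = j then jmat m ?C $$ (i, j) * (if j = 0 then 1 else F 0) else 0)"
      unfolding mat_mult_index[OF jmat_carrier c(1) ij] using ij by (intro sum.cong) (auto simp: S_def)
    also have "\<dots> = (if j = 0 then ?C i else F 0 * pd j (?C i))" using ij by (auto simp: jmat_def)
    finally have 1: "(jmat m ?C * S) $$ (i, j) = \<dots>" .
    have at: "{..m} = insert 0 {1..m}" by auto
    have 2: "(Y * Z) $$ (i, j) = Y $$ (i, 0) * Z $$ (0, j) + (\<Sum>k\<in>{1..m}. Y $$ (i, k) * Z $$ (k, j))"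
      unfolding mat_mult_index[OF c(2,3) ij] at by simp
    show "(jmat m ?C * S) $$ (i, j) = (Y * Z) $$ (i, j)"
    proof (cases "j = 0")
      case True then show ?thesis unfolding 1 2 using ij by (simp add: Y_def Z_def)
    next
      case False
      have sn: "?s (of_nat k) = of_nat k" for k by (induction k) (auto simp: s.hom_add)
      \<comment> \<open>Euler's relation for G_i at the point F, solved for the terms with l >=
        1.\<close>
      have eu: "(\<Sum>l\<in>{1..m}. F l * ?s (pd l (G i))) = of_nat e * ?s (G i) - F 0 * ?s (pd 0 (G i))"
      proof -
        have "?s (\<Sum>l\<in>{..m}. mvar l * pd l (G i)) = ?s (of_nat e * G i)" using euler[OF G(1,2)] by simp
        then have "F 0 * ?s (pd 0 (G i)) + (\<Sum>l\<in>{1..m}. F l * ?s (pd l (G i))) = of_nat e * ?s (G i)"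
          unfolding at by (simp add: s.hom_sum s.hom_add s.hom_mult sn)
        then show ?thesis by (simp add: algebra_simps)
      qed
      have "F 0 * pd j (?C i) = F 0 * (?s (pd 0 (G i)) * pd j (F 0) + (\<Sum>l\<in>{1..m}. ?s (pd l (G i)) * pd j (F l)))"
        unfolding pd_chain[OF G(2) finite_atMost] at by simp
      also have "\<dots> = ?s (G i) * (of_nat e * pd j (F 0)) - (\<Sum>l\<in>{1..m}. F l * ?s (pd l (G i))) * pd j (F 0)
         + (\<Sum>l\<in>{1..m}. F 0 * (?s (pd l (G i)) * pd j (F l)))"
        unfolding eu by (simp add: algebra_simps sum_distrib_left)
      also have "\<dots> = ?s (G i) * (of_nat e * pd j (F 0)) + (\<Sum>k\<in>{1..m}. ?s (pd k (G i)) * (F 0 * pd j (F k) - F k * pd j (F 0)))"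
      proof -
        have "(\<Sum>k\<in>{1..m}. ?s (pd k (G i)) * (F 0 * pd j (F k) - F k * pd j (F 0))) =
          (\<Sum>l\<in>{1..m}. F 0 * (?s (pd l (G i)) * pd j (F l))) - (\<Sum>l\<in>{1..m}. F l * ?s (pd l (G i))) * pd j (F 0)"
          by (simp add: sum_distrib_right sum_distrib_left sum_subtractf[symmetric] right_diff_distrib ac_simps)
        then show ?thesis by simp
      qed
      also have "\<dots> = (Y * Z) $$ (i, j)" unfolding 2 using ij False by (simp add: Y_def Z_def)
      finally show ?thesis unfolding 1 using False by simp
    qed
  qed (auto simp: jmat_def S_def Y_def Z_def)
  then have e1: "jac m ?C * F 0 ^ m = ?s (jac m G) * det Z"
    unfolding jac_def[of m ?C] dS[symmetric] dY[symmetric]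
    by (simp add: det_mult[OF jmat_carrier c(1), symmetric] det_mult[OF c(2,3), symmetric])
  have BW: "(B * jmat m F) $$ (i, j) = (if i = 0 then jmat m F $$ (0, j) else F 0 * jmat m F $$ (i, j) - F i * jmat m F $$ (0, j))"
    if ij: "i \<le> m" "j \<le> m" for i j
  proof -
    have "(B * jmat m F) $$ (i, j) = (\<Sum>k\<le>m. (if k = i then (if i = 0 then 1 else F 0) * jmat m F $$ (i, j) else 0) + (if k = 0 \<and> i \<noteq> 0 then - F i * jmat m F $$ (0, j) else 0))"
      unfolding mat_mult_index[OF c(4) jmat_carrier ij] using ij by (intro sum.cong) (auto simp: B_def)
    then show ?thesis using ij by (simp add: sum.distrib)
  qed
  have Je: "jmat m F $$ (i, j) = (if j = 0 then F i else pd j (F i))" if "i \<le> m" "j \<le> m" for i j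
    using that by (simp add: jmat_def)
  have cBW: "B * jmat m F \<in> carrier_mat ?n ?n" using c(4) jmat_carrier by (rule mult_carrier_mat)
  have "(B * jmat m F) $$ (0, 0) * det Z = Z $$ (0, 0) * det (B * jmat m F)"
    by (rule det_first_column[OF c(3) cBW]) (simp_all add: BW Z_def Je mult.commute del: index_mult_mat)
  then have "F 0 * det Z = det (B * jmat m F)" by (simp add: BW Je Z_def del: index_mult_mat)
  also have "\<dots> = F 0 ^ m * jac m F" by (simp add: det_mult[OF c(4) jmat_carrier] dB jac_def)
  finally have e2: "F 0 * det Z = F 0 ^ m * jac m F" .
  have "F 0 ^ m * (F 0 * jac m ?C) = F 0 * (?s (jac m G) * det Z)" using e1 by (simp add: ac_simps)
  also have "\<dots> = ?s (jac m G) * (F 0 * det Z)" by (simp add: ac_simps)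
  also have "\<dots> = F 0 ^ m * (?s (jac m G) * jac m F)" unfolding e2 by (simp add: ac_simps)
  finally show ?thesis using F0 by simp
qed


text \<open>The matrix of a linear map is its coefficient matrix times the matrix \<open>H\<close>
  of the identity, and \<open>H\<close> is lower triangular with determinant x_0.\<close>

lemma jac_lin:
  assumes AB: "matinv m A B" shows "\<exists>c. c \<noteq> 0 \<and> jac m (lin m A) = mconst c * mvar 0"
proof -
  define H where "H = mat (Suc m) (Suc m) (\<lambda>(i, j). if j = 0 then mvar i else if i = j then 1 else (0 :: 'a mpoly))"
  define a where "a C = mat (Suc m) (Suc m) (\<lambda>(i, j). C i j)" for C :: "nat \<Rightarrow> nat \<Rightarrow> 'a"
  define AA where "AA = mat (Suc m) (Suc m) (\<lambda>(i, j). mconst (a A $$ (i, j)))"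
  have c: "H \<in> carrier_mat (Suc m) (Suc m)" "AA \<in> carrier_mat (Suc m) (Suc m)" "a A \<in> carrier_mat (Suc m) (Suc m)" "a B \<in> carrier_mat (Suc m) (Suc m)"
    by (simp_all add: H_def AA_def a_def)
  have "a A * a B = 1\<^sub>m (Suc m)"
  proof (rule eq_matI)
    fix i j assume "i < dim_row (1\<^sub>m (Suc m))" "j < dim_col (1\<^sub>m (Suc m))"
    then have ij: "i \<le> m" "j \<le> m" by simp_all
    show "(a A * a B) $$ (i, j) = 1\<^sub>m (Suc m) $$ (i, j)"
      unfolding mat_mult_index[OF c(3,4) ij] using AB ij by (simp add: a_def matinv_def)
  qed (simp_all add: a_def)
  then have "det (a A) * det (a B) = 1" using det_mult[OF c(3,4)] by simp
  then have nz: "det (a A) \<noteq> 0" by auto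
  have "jmat m (lin m A) = AA * H"
  proof (rule eq_matI)
    fix i j assume "i < dim_row (AA * H)" "j < dim_col (AA * H)"
    then have ij: "i \<le> m" "j \<le> m" by (simp_all add: AA_def H_def)
    show "jmat m (lin m A) $$ (i, j) = (AA * H) $$ (i, j)"
    proof (cases "j = 0")
      case True
      then show ?thesis unfolding mat_mult_index[OF c(2,1) ij] using ij by (simp add: jmat_def lin_def AA_def H_def a_def)
    next
      case False
      have "(AA * H) $$ (i, j) = (\<Sum>k\<le>m. if k = j then mconst (A i j) else 0)"
        unfolding mat_mult_index[OF c(2,1) ij] using ij False by (intro sum.cong) (auto simp: AA_def H_def a_def)
      moreover have "pd j (lin m A i) = (\<Sum>k\<le>m. mconst (A i k) * (if k = j then 1 else 0))"
        using ij by (simp add: lin_def pd_sum pd_mult pd_mvar)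
      moreover have "\<dots> = (\<Sum>k\<le>m. if k = j then mconst (A i j) else 0)" by (intro sum.cong) auto
      ultimately show ?thesis using ij False by (simp add: jmat_def)
    qed
  qed (auto simp: jmat_def AA_def H_def)
  then have "jac m (lin m A) = det AA * det H" by (simp add: jac_def det_mult[OF c(2,1)])
  moreover have "det H = mvar 0" using det_lower[OF c(1)] by (simp add: H_def)
  moreover have "det AA = mconst (det (a A))" unfolding AA_def by (rule hom_det[OF comm_ring_hom_mconst c(3), symmetric])
  ultimately show ?thesis using nz by auto
qed

text \<open>Multiplying row i by x_i, and column j >= 1 by x_j, leaves only the entries 0 and P, the
  product of all variables. Subtracting column 0 from the others makes the matrix triangular, with
  diagonal P, -P, ..., -P. The factors on the left undo the scalings, whose determinants are P and P
  / x_0.\<close>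

lemma jac_std: "(\<Prod>i\<le>m. mvar i) ^ 2 * jac m (std_tuple m) = mvar 0 * ((-1) ^ m * (\<Prod>i\<le>m. mvar i) ^ Suc m :: 'a::field mpoly)"
proof -
  let ?n = "Suc m" and ?P = "\<Prod>i\<le>m. mvar i :: 'a mpoly"
  let ?F = "std_tuple m :: 'a tuple"
  define L where "L = mat ?n ?n (\<lambda>(i, j). if i = j then (mvar i :: 'a mpoly) else 0)"
  define R where "R = mat ?n ?n (\<lambda>(i, j). if i = j then (if i = 0 then 1 else mvar i :: 'a mpoly) else 0)"
  define V where "V = mat ?n ?n (\<lambda>(i, j). if i = j then 1 else if i = 0 then -1 else (0 :: 'a mpoly))"
  define E where "E = mat ?n ?n (\<lambda>(i, j). if j = 0 then ?P else if i = j then - ?P else 0)"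
  have c: "L \<in> carrier_mat ?n ?n" "R \<in> carrier_mat ?n ?n" "V \<in> carrier_mat ?n ?n" "E \<in> carrier_mat ?n ?n"
    by (simp_all add: L_def R_def V_def E_def)
  have PF: "?P = mvar i * ?F i" if "i \<le> m" for i
    using prod.remove[of "{0..m}" i "\<lambda>i. mvar i :: 'a mpoly"] that by (simp add: std_tuple_def atLeast0AtMost)
  have mvF: "i \<notin> mvars (?F i)" for i
  proof -
    have "mvars (\<Prod>j\<in>{0..m} - {i}. mvar j :: 'a mpoly) \<subseteq> - {i}" by (rule mvars_prod) auto
    then show ?thesis by (auto simp: std_tuple_def)
  qed
  have pdP: "pd j ?P = ?F j" if "j \<le> m" for j
    unfolding PF[OF that] by (simp add: pd_mult pd_mvar pd_const[OF mvF])
  have pdF: "mvar i * pd j (?F i) * mvar j = (if i = j then 0 else ?P)" if "i \<le> m" "j \<le> m" for i j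
  proof (cases "i = j")
    case True then show ?thesis by (simp add: pd_const[OF mvF])
  next
    case False
    have "?F j = mvar i * pd j (?F i)" unfolding pdP[OF that(2), symmetric] using False by (subst PF[OF that(1)]) (simp add: pd_mult pd_mvar)
    then show ?thesis using False PF[OF that(2)] by (simp add: mult.commute)
  qed
  have J: "(L * jmat m ?F * R) $$ (i, j) = (if j = 0 then ?P else if i = j then 0 else ?P)" if ij: "i \<le> m" "j \<le> m" for i j
  proof -
    have LJ: "(L * jmat m ?F) $$ (i, k) = mvar i * jmat m ?F $$ (i, k)" if k: "k \<le> m" for k
    proof -
      have "(L * jmat m ?F) $$ (i, k) = (\<Sum>l\<le>m. if l = i then mvar i * jmat m ?F $$ (i, k) else 0)"
        unfolding mat_mult_index[OF c(1) jmat_carrier ij(1) k] using ij by (intro sum.cong) (auto simp: L_def)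
      then show ?thesis using ij by simp
    qed
    have "(L * jmat m ?F * R) $$ (i, j) = (\<Sum>l\<le>m. if l = j then mvar i * jmat m ?F $$ (i, j) * (if j = 0 then 1 else mvar j) else 0)"
      unfolding mat_mult_index[OF mult_carrier_mat[OF c(1) jmat_carrier] c(2) ij]
      using ij by (intro sum.cong) (auto simp: R_def LJ simp del: index_mult_mat)
    also have "\<dots> = mvar i * jmat m ?F $$ (i, j) * (if j = 0 then 1 else mvar j)" using ij by simp
    also have "\<dots> = (if j = 0 then ?P else if i = j then 0 else ?P)"
      using ij PF[OF ij(1)] pdF[OF ij] by (auto simp: jmat_def)
    finally show ?thesis .
  qed
  have cJ: "L * jmat m ?F * R \<in> carrier_mat ?n ?n" by (intro mult_carrier_mat[OF mult_carrier_mat[OF c(1) jmat_carrier] c(2)])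
  have "L * jmat m ?F * R * V = E"
  proof (rule eq_matI)
    fix i j assume "i < dim_row E" "j < dim_col E"
    then have ij: "i \<le> m" "j \<le> m" by (simp_all add: E_def)
    have "(L * jmat m ?F * R * V) $$ (i, j) = (\<Sum>k\<le>m. (if k = j then (L * jmat m ?F * R) $$ (i, j) else 0) + (if k = 0 \<and> j \<noteq> 0 then - ?P else 0))"
      unfolding mat_mult_index[OF cJ c(3) ij] using ij by (intro sum.cong) (auto simp: V_def J simp del: index_mult_mat)
    also have "\<dots> = E $$ (i, j)" using ij by (auto simp: sum.distrib J E_def simp del: index_mult_mat)
    finally show "(L * jmat m ?F * R * V) $$ (i, j) = E $$ (i, j)" .
  qed (auto simp: L_def V_def E_def)
  then have "det L * jac m ?F * det R * det V = det E"
    unfolding jac_def by (simp add: det_mult[OF cJ c(3), symmetric] det_mult[OF mult_carrier_mat[OF c(1) jmat_carrier] c(2), symmetric] det_mult[OF c(1) jmat_carrier, symmetric])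
  moreover have at: "{..m} = insert 0 {1..m}" by auto
  have "det L = ?P" unfolding at using det_upper[OF c(1)] by (simp add: L_def)
  moreover have "mvar 0 * det R = ?P" unfolding at using det_upper[OF c(2)] by (simp add: R_def)
  moreover have "det V = 1" using det_upper[OF c(3)] by (simp add: V_def)
  moreover have "det E = ?P * (- ?P) ^ m" using det_lower[OF c(4)] by (simp add: E_def)
  ultimately have *: "?P * jac m ?F * det R * 1 = ?P * (- ?P) ^ m" by (simp only:)
  have "?P * jac m ?F * (mvar 0 * det R) = mvar 0 * (?P * jac m ?F * det R * 1)" by (simp add: ac_simps)
  also have "\<dots> = mvar 0 * (?P * (- ?P) ^ m)" by (simp only: *)
  finally have "?P * jac m ?F * ?P = mvar 0 * (?P * (- ?P) ^ m)" using \<open>mvar 0 * det R = ?P\<close> by simp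
  then show ?thesis by (simp add: power2_eq_square power_minus[of ?P] ac_simps)
qed

section \<open>Jacobians modulo squares\<close>

lemma sum_delta_mult: "i \<le> m \<Longrightarrow> (\<Sum>k\<le>(m::nat). (if i = k then 1 else 0) * f k) = (f i :: 'b::comm_ring_1)"
proof -
  assume "i \<le> m"
  have "(\<Sum>k\<le>m. (if i = k then 1 else 0) * f k) = (\<Sum>k\<le>m. if k = i then f i else 0)" by (intro sum.cong) auto
  then show ?thesis using \<open>i \<le> m\<close> by simp
qed

text \<open>The product of x_0 and \<open>jac m F\<close> is a constant times a square of a rational
  function. The factor x_0 compensates the x_0 in the Jacobian of the identity. Requiring u and v to
  be forms ensures that they stay nonzero when a dominant map is substituted.\<close>

definition square_jac :: "nat \<Rightarrow> 'a::field tuple \<Rightarrow> bool"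
  where "square_jac m F \<longleftrightarrow> (\<exists>c u v a b. c \<noteq> 0 \<and> u \<noteq> 0 \<and> v \<noteq> 0 \<and> homogeneous a u \<and> homogeneous b v \<and>
     mvars u \<subseteq> {0..m} \<and> mvars v \<subseteq> {0..m} \<and> mvar 0 * jac m F * u\<^sup>2 = mconst c * v\<^sup>2)"

lemma square_jacI:
  assumes "c \<noteq> 0" "u \<noteq> 0" "v \<noteq> 0" "homogeneous a u" "homogeneous b v"
     "mvars u \<subseteq> {0..m}" "mvars v \<subseteq> {0..m}" "mvar 0 * jac m F * u\<^sup>2 = mconst c * v\<^sup>2"
  shows "square_jac m F"
  using assms unfolding square_jac_def by blast

lemma dominant_nonzero: "dominant m F \<Longrightarrow> i \<le> m \<Longrightarrow> F i \<noteq> 0"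
  using generic_nonzero[of m "\<lambda>i. tf (F i)" i] by (simp add: dominant_def)

lemma dominant_subst:
  assumes F: "dominant m F" and u: "homogeneous a u" "mvars u \<subseteq> {0..m}" "u \<noteq> 0"
  shows "mp_eval mconst F u \<noteq> 0" "\<exists>b. homogeneous b (mp_eval mconst F u)" "mvars (mp_eval mconst F u) \<subseteq> {0..m}"
proof -
  obtain d where d: "\<And>i. homogeneous d (F i)" "\<And>i. mvars (F i) \<subseteq> {0..m}" using dominantE[OF F] by metis
  have "pev (\<lambda>i. tf (F i)) u \<noteq> 0" using F u unfolding dominant_def generic_def by blast
  then show "mp_eval mconst F u \<noteq> 0" using tf_mp_eval[of F u] by auto
  show "\<exists>b. homogeneous b (mp_eval mconst F u)" using homogeneous_mp_eval[OF u(1), where F = F and d = d] d by blast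
  show "mvars (mp_eval mconst F u) \<subseteq> {0..m}" using d by (intro mvars_mp_eval)
qed

lemma dominant_comp_jac:
  assumes F: "dominant m F" and G: "dominant m G"
  shows "F 0 * jac m (tuple_comp G F) = mp_eval mconst F (jac m G) * jac m F"
proof -
  obtain e where e: "\<And>i. homogeneous e (G i)" "\<And>i. mvars (G i) \<subseteq> {0..m}" using dominantE[OF G] by metis
  have "tuple_comp G F = (\<lambda>i. mp_eval mconst F (G i))" using tuple_comp_Proj[OF dominant_reps[OF G]] by auto
  then show ?thesis using jac_comp[where F = F and G = G and e = e and m = m, OF dominant_nonzero[OF F le0]] e by (simp add: atLeast0AtMost)
qed

lemma mvars_mult_subset: "mvars p \<subseteq> V \<Longrightarrow> mvars q \<subseteq> V \<Longrightarrow> mvars (p * q) \<subseteq> V" for p q :: "'a::comm_ring_1 mpoly"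
  using mvars_mult[of p q] by blast

text \<open>Modulo squares the quantity x_0 jac is multiplicative: the F_0 in the chain rule is
  exactly what the factor x_0 becomes when F is substituted into the equation for G.\<close>

lemma square_jac_comp:
  assumes F: "dominant m F" and G: "dominant m G" and sF: "square_jac m F" and sG: "square_jac m G"
  shows "square_jac m (tuple_comp G F)"
proof -
  let ?s = "mp_eval mconst F"
  interpret s: comm_ring_hom ?s by (rule mconst.comm_ring_hom_mp_eval)
  obtain d where d: "\<And>i. homogeneous d (F i)" "\<And>i. mvars (F i) \<subseteq> {0..m}" using dominantE[OF F] by metis
  obtain c u v a b where f: "c \<noteq> 0" "u \<noteq> 0" "v \<noteq> 0" "homogeneous a u" "homogeneous b v" "mvars u \<subseteq> {0..m}" "mvars v \<subseteq> {0..m}"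
    "mvar 0 * jac m F * u\<^sup>2 = mconst c * v\<^sup>2" using sF unfolding square_jac_def by blast
  obtain c' u' v' a' b' where g: "c' \<noteq> 0" "u' \<noteq> 0" "v' \<noteq> 0" "homogeneous a' u'" "homogeneous b' v'" "mvars u' \<subseteq> {0..m}" "mvars v' \<subseteq> {0..m}"
    "mvar 0 * jac m G * u'\<^sup>2 = mconst c' * v'\<^sup>2" using sG unfolding square_jac_def by blast
  note su = dominant_subst[OF F g(4,6,2)] and sv = dominant_subst[OF F g(5,7,3)]
  obtain a2 b2 where ab: "homogeneous a2 (?s u')" "homogeneous b2 (?s v')" using su sv by blast
  have "?s (mvar 0 * jac m G * u'\<^sup>2) = ?s (mconst c' * v'\<^sup>2)" using g(8) by simp
  then have g': "F 0 * ?s (jac m G) * (?s u')\<^sup>2 = mconst c' * (?s v')\<^sup>2" by (simp add: s.hom_mult s.hom_power)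
  have "mvar 0 * jac m (tuple_comp G F) * (F 0 * ?s u' * u)\<^sup>2 = (F 0 * jac m (tuple_comp G F)) * (F 0 * (?s u')\<^sup>2) * (mvar 0 * u\<^sup>2)"
    by (simp add: power2_eq_square ac_simps)
  also have "\<dots> = (F 0 * ?s (jac m G) * (?s u')\<^sup>2) * (mvar 0 * jac m F * u\<^sup>2)"
    unfolding dominant_comp_jac[OF F G] by (simp add: ac_simps)
  also have "\<dots> = mconst (c * c') * (?s v' * v)\<^sup>2" unfolding f(8) g' by (simp add: power2_eq_square mconst_mult ac_simps)
  finally have eq: "mvar 0 * jac m (tuple_comp G F) * (F 0 * ?s u' * u)\<^sup>2 = mconst (c * c') * (?s v' * v)\<^sup>2" .
  show ?thesis
  proof (rule square_jacI[OF _ _ _ _ _ _ _ eq])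
    show "homogeneous (d + a2 + a) (F 0 * ?s u' * u)" "homogeneous (b2 + b) (?s v' * v)"
      using d ab f by (auto intro!: homogeneous_mult)
    show "mvars (F 0 * ?s u' * u) \<subseteq> {0..m}" "mvars (?s v' * v) \<subseteq> {0..m}"
      by (intro mvars_mult_subset d(2) su(3) sv(3) f(6,7))+
  qed (use f g su sv dominant_nonzero[OF F le0] in auto)
qed

text \<open>The chain rule solved for the inner map. With G F the identity or one of its multiples,
  this treats inverses.\<close>

lemma square_jac_right_factor:
  assumes F: "dominant m F" and G: "dominant m G" and sG: "square_jac m G" and sGF: "square_jac m (tuple_comp G F)"
  shows "square_jac m F"
proof -
  let ?s = "mp_eval mconst F"
  interpret s: comm_ring_hom ?s by (rule mconst.comm_ring_hom_mp_eval)
  obtain d where d: "\<And>i. homogeneous d (F i)" "\<And>i. mvars (F i) \<subseteq> {0..m}" using dominantE[OF F] by metis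
  obtain c u v a b where f: "c \<noteq> 0" "u \<noteq> 0" "v \<noteq> 0" "homogeneous a u" "homogeneous b v" "mvars u \<subseteq> {0..m}" "mvars v \<subseteq> {0..m}"
    "mvar 0 * jac m (tuple_comp G F) * u\<^sup>2 = mconst c * v\<^sup>2" using sGF unfolding square_jac_def by blast
  obtain c' u' v' a' b' where g: "c' \<noteq> 0" "u' \<noteq> 0" "v' \<noteq> 0" "homogeneous a' u'" "homogeneous b' v'" "mvars u' \<subseteq> {0..m}" "mvars v' \<subseteq> {0..m}"
    "mvar 0 * jac m G * u'\<^sup>2 = mconst c' * v'\<^sup>2" using sG unfolding square_jac_def by blast
  note su = dominant_subst[OF F g(4,6,2)] and sv = dominant_subst[OF F g(5,7,3)]
  obtain a2 b2 where ab: "homogeneous a2 (?s u')" "homogeneous b2 (?s v')" using su sv by blast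
  have "?s (mvar 0 * jac m G * u'\<^sup>2) = ?s (mconst c' * v'\<^sup>2)" using g(8) by simp
  then have g': "F 0 * ?s (jac m G) * (?s u')\<^sup>2 = mconst c' * (?s v')\<^sup>2" by (simp add: s.hom_mult s.hom_power)
  have "mconst c' * (mvar 0 * jac m F * (?s v' * u)\<^sup>2) = (mconst c' * (?s v')\<^sup>2) * (mvar 0 * jac m F * u\<^sup>2)"
    by (simp add: power2_eq_square ac_simps)
  also have "\<dots> = (F 0 * jac m (tuple_comp G F)) * (F 0 * (?s u')\<^sup>2) * (mvar 0 * u\<^sup>2)"
    unfolding g'[symmetric] dominant_comp_jac[OF F G] by (simp add: ac_simps)
  also have "\<dots> = (mvar 0 * jac m (tuple_comp G F) * u\<^sup>2) * (F 0 * ?s u')\<^sup>2" by (simp add: power2_eq_square ac_simps)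
  also have "\<dots> = mconst c' * (mconst (c / c') * (v * (F 0 * ?s u'))\<^sup>2)"
  proof -
    have "mconst c = mconst c' * mconst (c / c')" using g(1) by (simp add: mconst_mult[symmetric])
    then show ?thesis unfolding f(8) by (simp add: power2_eq_square ac_simps)
  qed
  finally have eq: "mvar 0 * jac m F * (?s v' * u)\<^sup>2 = mconst (c / c') * (v * (F 0 * ?s u'))\<^sup>2" using g(1) by simp
  show ?thesis
  proof (rule square_jacI[OF _ _ _ _ _ _ _ eq])
    show "homogeneous (b2 + a) (?s v' * u)" "homogeneous (b + (d + a2)) (v * (F 0 * ?s u'))"
      using d ab f by (auto intro!: homogeneous_mult)
    show "mvars (?s v' * u) \<subseteq> {0..m}" "mvars (v * (F 0 * ?s u')) \<subseteq> {0..m}"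
      by (intro mvars_mult_subset d(2) su(3) sv(3) f(6,7))+
  qed (use f g su sv dominant_nonzero[OF F le0] in auto)
qed

text \<open>The tuples F_0 G and G_0 F coincide, so the Jacobians of F and G differ by the powers of
  exponent m + 1 of F_0 and G_0, which are squares for odd m. This makes the property independent of
  the representative.\<close>

lemma square_jac_proportional:
  assumes m: "odd m" and sF: "square_jac m F" and FG: "proportional F G"
    and F0: "F 0 \<noteq> 0" "homogeneous d (F 0)" "mvars (F 0) \<subseteq> {0..m}" and G0: "G 0 \<noteq> 0" "homogeneous e (G 0)" "mvars (G 0) \<subseteq> {0..m}"
  shows "square_jac m G"
proof -
  have "even (Suc m)" using m by simp
  then obtain k where k: "Suc m = 2 * k" by (rule evenE)
  obtain c u v a b where f: "c \<noteq> 0" "u \<noteq> 0" "v \<noteq> 0" "homogeneous a u" "homogeneous b v" "mvars u \<subseteq> {0..m}" "mvars v \<subseteq> {0..m}"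
    "mvar 0 * jac m F * u\<^sup>2 = mconst c * v\<^sup>2" using sF unfolding square_jac_def by blast
  have "(\<lambda>i. F 0 * G i) = (\<lambda>i. G 0 * F i)" using FG by (auto simp: proportional_def ac_simps)
  then have "jac m (\<lambda>i. F 0 * G i) = jac m (\<lambda>i. G 0 * F i)" by (rule arg_cong)
  then have "F 0 ^ (2 * k) * jac m G = G 0 ^ (2 * k) * jac m F" unfolding jac_scale k .
  then have j: "jac m G * (F 0 ^ k)\<^sup>2 = jac m F * (G 0 ^ k)\<^sup>2" by (simp add: power_mult[symmetric] mult.commute)
  have "mvar 0 * jac m G * (F 0 ^ k * u)\<^sup>2 = mvar 0 * u\<^sup>2 * (jac m G * (F 0 ^ k)\<^sup>2)" by (simp add: power_mult_distrib ac_simps)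
  also have "\<dots> = (mvar 0 * jac m F * u\<^sup>2) * (G 0 ^ k)\<^sup>2" unfolding j by (simp add: ac_simps)
  also have "\<dots> = mconst c * (v * G 0 ^ k)\<^sup>2" unfolding f(8) by (simp add: power_mult_distrib ac_simps)
  finally have eq: "mvar 0 * jac m G * (F 0 ^ k * u)\<^sup>2 = mconst c * (v * G 0 ^ k)\<^sup>2" .
  show ?thesis
  proof (rule square_jacI[OF _ _ _ _ _ _ _ eq])
    show "homogeneous (d * k + a) (F 0 ^ k * u)" "homogeneous (b + e * k) (v * G 0 ^ k)"
      using F0 G0 f by (auto intro!: homogeneous_mult homogeneous_power)
    show "mvars (F 0 ^ k * u) \<subseteq> {0..m}" "mvars (v * G 0 ^ k) \<subseteq> {0..m}"
      by (intro mvars_mult_subset order_trans[OF mvars_power] F0(3) G0(3) f(6,7))+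
  qed (use f F0 G0 in auto)
qed

lemma square_jac_dominant:
  assumes m: "odd m" and sF: "square_jac m F" and FG: "peq (\<lambda>i. tf (F i)) (\<lambda>i. tf (G i))"
    and F: "F \<in> rat_reps (Proj m) (Proj m)" and G: "dominant m G"
  shows "square_jac m G"
proof -
  have G0: "G 0 \<noteq> 0" by (rule dominant_nonzero[OF G le0])
  then have F0: "F 0 \<noteq> 0" using peq_nonzero[OF peq_sym[OF FG], of 0] by simp
  obtain e where e: "homogeneous e (G 0)" "mvars (G 0) \<subseteq> {0..m}" using dominantE[OF G] by metis
  have "\<exists>d. \<forall>i. homogeneous d (F i)" "\<forall>i. mvars (F i) \<subseteq> {0..m}" using F by (simp_all add: rat_reps_def)
  then obtain d where d: "homogeneous d (F 0)" "mvars (F 0) \<subseteq> {0..m}" by blast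
  show ?thesis
    by (rule square_jac_proportional[where F = F and G = G, OF m sF _ F0 d G0 e]) (use FG in \<open>simp add: proportional_iff peq_vprop\<close>)
qed

lemma square_jac_lin: assumes "matinv m A B" shows "square_jac m (lin m A)"
proof -
  obtain c where c: "c \<noteq> 0" "jac m (lin m A) = mconst c * mvar 0" using jac_lin[OF assms] by blast
  have eq: "mvar 0 * jac m (lin m A) * 1\<^sup>2 = mconst c * (mvar 0)\<^sup>2" by (simp add: c(2) power2_eq_square ac_simps)
  show ?thesis by (rule square_jacI[OF c(1) _ _ _ _ _ _ eq]) (auto intro: homogeneous_1 homogeneous_mvar)
qed

lemma square_jac_std: assumes m: "odd m" shows "square_jac m (std_tuple m :: 'a::field tuple)"
proof -
  let ?P = "\<Prod>i\<le>m. mvar i :: 'a mpoly"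
  have "even (Suc m)" using m by simp
  then obtain k where k: "Suc m = 2 * k" by (rule evenE)
  have "mvar 0 * jac m (std_tuple m :: 'a tuple) * ?P\<^sup>2 = mvar 0 * (mvar 0 * ((-1) ^ m * ?P ^ Suc m))"
    unfolding jac_std[symmetric] by (simp add: ac_simps)
  also have "\<dots> = (-1) ^ m * (mvar 0 * ?P ^ k)\<^sup>2"
    unfolding k by (simp add: power2_eq_square power_mult power_mult_distrib ac_simps)
  also have "(-1 :: 'a mpoly) ^ m = mconst (-1)" using m mconst.hom_uminus[of "1 :: 'a"] by simp
  finally have eq: "mvar 0 * jac m (std_tuple m :: 'a tuple) * ?P\<^sup>2 = mconst (-1) * (mvar 0 * ?P ^ k)\<^sup>2" .
  have hP: "homogeneous (\<Sum>i\<le>m. 1) ?P" by (rule homogeneous_prod) simp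
  have vP: "mvars ?P \<subseteq> {0..m}" by (auto intro!: mvars_prod)
  show ?thesis
  proof (rule square_jacI[OF _ _ _ _ _ _ _ eq])
    show "homogeneous (\<Sum>i\<le>m. 1) ?P" by (rule hP)
    show "homogeneous (1 + (\<Sum>i\<le>m. 1) * k) (mvar 0 * ?P ^ k :: 'a mpoly)"
      by (intro homogeneous_mult homogeneous_power hP) simp
    show "mvars (mvar 0 * ?P ^ k :: 'a mpoly) \<subseteq> {0..m}"
      by (intro mvars_mult_subset order_trans[OF mvars_power] vP) auto
  qed (use vP in \<open>auto simp: prod_zero_iff\<close>)
qed

lemma square_jac_G_group:
  fixes f :: "'a::field ratmap"
  assumes m: "odd m" and f: "f \<in> G_group m" "F \<in> f"
  shows "square_jac m F"
proof -
  let ?B = "Bir (Proj m) :: 'a ratmap monoid"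
  interpret B: group ?B by (rule group_Bir)
  have m1: "m \<ge> 1" using m by (cases m) auto
  note gens = G_generators[OF m1]
  have step: "square_jac m F" if "h \<in> carrier ?B" "F \<in> h" "F' \<in> h" "square_jac m F'" for h :: "'a ratmap" and F F'
  proof -
    have "peq (\<lambda>i. tf (F' i)) (\<lambda>i. tf (F i))" using that by (intro RatMaps_peq[of h]) (auto simp: Bir_def birational_def)
    then show ?thesis using square_jac_dominant[OF m that(4)] Bir_member(1)[OF that(1)] dominant_reps that by blast
  qed
  have gen: "square_jac m F" if h: "h \<in> insert (std_involution m) (Aut_Proj m)" and F: "F \<in> h" for h :: "'a ratmap" and F
  proof -
    have hB: "h \<in> carrier ?B" using h gens by blast
    show ?thesis
    proof (cases "h = std_involution m")
      case True
      then have "std_tuple m \<in> h" using rat_class_self[OF std_tuple_reps] by (simp add: std_involution_std_tuple)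
      then show ?thesis using step[OF hB F] square_jac_std[OF m] by blast
    next
      case False
      then have "h \<in> Aut_Proj m" using h by simp
      then obtain A A' where A: "matinv m A A'" "h = pclass m (lin m A)" by (rule Aut_Proj_linear[OF _ m1])
      then have "lin m A \<in> h" using rat_class_self[OF lin_reps[OF A(1)]] by simp
      then show ?thesis using step[OF hB F] square_jac_lin[OF A(1)] by blast
    qed
  qed
  have idI: "matinv m (\<lambda>i j. if i = j then 1 else 0 :: 'a) (\<lambda>i j. if i = j then 1 else 0)"
    by (simp add: matinv_def sum_delta_mult)
  have idl: "lin m (\<lambda>i j. if i = j then 1 else 0 :: 'a) = id_tuple (Proj m)"
    by (auto simp: lin_def if_distrib[of mconst] sum_delta_mult cong: if_cong)
  have sid: "square_jac m F" if "F \<in> \<one>\<^bsub>?B\<^esub>" for F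
  proof (rule step[OF B.one_closed that])
    show "id_tuple (Proj m) \<in> \<one>\<^bsub>?B\<^esub>" using rat_class_self[OF dominant_reps[OF dominant_id]] by (simp add: Bir_def rat_id_def)
    show "square_jac m (id_tuple (Proj m) :: 'a tuple)" using square_jac_lin[OF idI] by (simp only: idl)
  qed
  have "f \<in> generate ?B (insert (std_involution m) (Aut_Proj m))" using f by (simp add: G_group_def)
  then have "f \<in> carrier ?B \<and> (\<forall>F\<in>f. square_jac m F)"
  proof (induction rule: generate.induct)
    case one then show ?case using sid by auto
  next
    case (incl h) then show ?case using gen gens by blast
  next
    \<comment> \<open>The product of h and its inverse is the identity, so the inverse is the right
      factor of a composite with square Jacobian.\<close>
    case (inv h)
    have h: "h \<in> carrier ?B" using inv gens by blast
    show ?case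
    proof (intro conjI ballI)
      show ih: "inv\<^bsub>?B\<^esub> h \<in> carrier ?B" using h by simp
      fix F assume F: "F \<in> inv\<^bsub>?B\<^esub> h"
      obtain G where G: "G \<in> h" "dominant m G" "h = pclass m G" by (rule Bir_obtain[OF h])
      have dF: "dominant m F" "inv\<^bsub>?B\<^esub> h = pclass m F" using Bir_member[OF ih F] by auto
      have "\<one>\<^bsub>?B\<^esub> = h \<otimes>\<^bsub>?B\<^esub> inv\<^bsub>?B\<^esub> h" using h by simp
      also have "\<dots> = pclass m (tuple_comp G F)" unfolding dF(2) by (subst G(3)) (rule mult_Bir[OF dF(1) G(2)])
      finally have "tuple_comp G F \<in> \<one>\<^bsub>?B\<^esub>" using rat_class_self[OF dominant_reps[OF dominant_tuple_comp[OF dF(1) G(2)]]] by simp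
      then show "square_jac m F" using square_jac_right_factor[OF dF(1) G(2) gen[OF inv G(1)]] sid by blast
    qed
  next
    case (eng h1 h2)
    obtain F1 where F1: "F1 \<in> h1" "dominant m F1" "h1 = pclass m F1" using Bir_obtain eng by blast
    obtain F2 where F2: "F2 \<in> h2" "dominant m F2" "h2 = pclass m F2" using Bir_obtain eng by blast
    have c: "h1 \<otimes>\<^bsub>?B\<^esub> h2 \<in> carrier ?B" using eng by simp
    have "h1 \<otimes>\<^bsub>?B\<^esub> h2 = pclass m (tuple_comp F1 F2)" unfolding F1(3) F2(3) by (rule mult_Bir[OF F2(2) F1(2)])
    then have "tuple_comp F1 F2 \<in> h1 \<otimes>\<^bsub>?B\<^esub> h2" using rat_class_self[OF dominant_reps[OF dominant_tuple_comp[OF F2(2) F1(2)]]] by simp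
    moreover have "square_jac m (tuple_comp F1 F2)" using square_jac_comp[OF F2(2) F1(2)] eng F1 F2 by blast
    ultimately show ?case using step[OF c] c by blast
  qed
  then show ?thesis using f(2) by blast
qed

text \<open>The map \<open>x_m \<mapsto> x_1 x_m / x_0\<close>.\<close>

definition shear_tuple :: "nat \<Rightarrow> 'a::field tuple"
  where "shear_tuple m = (\<lambda>i. if i < m then mvar 0 * mvar i else if i = m then mvar 1 * mvar m else 0)"

text \<open>The Jacobian is x_1 x_0^(m+1), so the defining equation would equate an odd and an even
  degree in x_1.\<close>

lemma not_square_jac_shear:
  assumes m: "odd m" "m \<ge> 3" shows "\<not> square_jac m (shear_tuple m :: 'a::field tuple)"
proof
  assume "square_jac m (shear_tuple m :: 'a tuple)"
  then obtain c u v where f: "c \<noteq> 0" "u \<noteq> 0" "v \<noteq> 0" "mvar 0 * jac m (shear_tuple m :: 'a tuple) * u\<^sup>2 = mconst c * v\<^sup>2"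
    unfolding square_jac_def by blast
  let ?A = "jmat m (shear_tuple m) :: 'a mpoly mat"
  have "det ?A = ?A $$ (0, 0) * (\<Prod>i\<in>{1..m}. ?A $$ (i, i))"
    by (rule det_lower[OF jmat_carrier]) (use m in \<open>auto simp: jmat_def shear_tuple_def pd_mult pd_mvar\<close>)
  also have "{1..m} = insert m {1..<m}" using m by auto
  also have "?A $$ (0, 0) * (\<Prod>i\<in>insert m {1..<m}. ?A $$ (i, i)) = (mvar 0)\<^sup>2 * (mvar 1 * (\<Prod>i\<in>{1..<m}. mvar 0))"
    using m by (auto simp: jmat_def shear_tuple_def pd_mult pd_mvar power2_eq_square)
  finally have J: "jac m (shear_tuple m :: 'a tuple) = mvar 1 * mvar 0 ^ (m + 1)"
    using m by (simp add: jac_def power_add[symmetric] ac_simps)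
  have d0: "deg_in 1 (mvar 0 ^ k :: 'a mpoly) = 0" for k
    using mvars_power[of "mvar 0 :: 'a mpoly" k] by (auto simp: deg_in_eq_0_iff)
  have d1: "deg_in 1 (mvar 1 :: 'a mpoly) = 1" by (simp add: split_var_mvar)
  have d2: "deg_in 1 (mconst c) = 0" by (simp add: split_var_mconst)
  have sq: "deg_in 1 (w\<^sup>2) = 2 * deg_in 1 w" if "w \<noteq> 0" for w :: "'a mpoly"
    using that by (simp add: power2_eq_square deg_in_mult)
  have "mvar 1 * (mvar 0 ^ (m + 2) * u\<^sup>2) = mconst c * v\<^sup>2" using f(4) unfolding J by (simp add: ac_simps)
  moreover have "deg_in 1 (mvar 1 * (mvar 0 ^ (m + 2) * u\<^sup>2)) = 1 + (0 + 2 * deg_in 1 u)"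
    using f(2) by (subst deg_in_mult, simp, simp, subst deg_in_mult, simp, simp, simp only: d0 d1 sq)
  moreover have "deg_in 1 (mconst c * v\<^sup>2) = 2 * deg_in 1 v"
    using f(1,3) d2 by (subst deg_in_mult, simp, simp, simp only: sq)
  ultimately have "1 + 2 * deg_in 1 u = 2 * deg_in 1 v" by simp
  then show False by presburger
qed

subsection \<open>Maps acting on generic points\<close>

text \<open>Lets a formula with denominators describe a rational map without a choice of polynomial
  components; it only has to be right at generic vectors, up to a common factor.\<close>

definition acts :: "nat \<Rightarrow> ('a::field) ratmap \<Rightarrow> ((nat \<Rightarrow> 'a mpoly fract) \<Rightarrow> nat \<Rightarrow> 'a mpoly fract) \<Rightarrow> bool"
  where "acts m f \<Phi> \<longleftrightarrow> (\<forall>v. generic m v \<longrightarrow> (\<exists>F\<in>f. peq (\<Phi> v) (papp F v)))"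

definition in_G :: "nat \<Rightarrow> ((nat \<Rightarrow> 'a::field mpoly fract) \<Rightarrow> nat \<Rightarrow> 'a mpoly fract) \<Rightarrow> bool"
  where "in_G m \<Phi> \<longleftrightarrow> (\<exists>f\<in>G_group m. acts m f \<Phi>)"

lemma G_group_carrier: "m \<ge> 1 \<Longrightarrow> f \<in> G_group m \<Longrightarrow> f \<in> carrier (Bir (Proj m))"
  by (rule subgroup.mem_carrier[OF subgroup_G_group])

lemma in_G_I: "f \<in> G_group m \<Longrightarrow> F \<in> f \<Longrightarrow> in_G m (papp F)"
  unfolding in_G_def acts_def by (intro bexI[of _ f] allI impI bexI[of _ F] peq_refl)

lemma in_G_generic:
  assumes m: "m \<ge> 1" and "in_G m \<Phi>" "generic m v" shows "generic m (\<Phi> v)"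
proof -
  obtain f where f: "f \<in> G_group m" "acts m f \<Phi>" using assms by (auto simp: in_G_def)
  then obtain F where F: "F \<in> f" "peq (\<Phi> v) (papp F v)" using assms(3) by (auto simp: acts_def)
  have "dominant m F" using Bir_member(1)[OF G_group_carrier[OF m f(1)] F(1)] .
  then show ?thesis by (rule generic_peq[OF generic_papp[OF _ assms(3)] F(2)])
qed

lemma in_G_comp:
  fixes \<Phi> \<Psi> :: "(nat \<Rightarrow> 'a::field mpoly fract) \<Rightarrow> nat \<Rightarrow> 'a mpoly fract"
  assumes m: "m \<ge> 1" and \<Phi>: "in_G m \<Phi>" and \<Psi>: "in_G m \<Psi>" shows "in_G m (\<lambda>v. \<Psi> (\<Phi> v))"
proof -
  let ?B = "Bir (Proj m) :: 'a ratmap monoid"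
  interpret G: subgroup "G_group m" ?B by (rule subgroup_G_group[OF m])
  obtain f where f: "f \<in> G_group m" "acts m f \<Phi>" using \<Phi> by (auto simp: in_G_def)
  obtain g where g: "g \<in> G_group m" "acts m g \<Psi>" using \<Psi> by (auto simp: in_G_def)
  have gf: "g \<otimes>\<^bsub>?B\<^esub> f \<in> G_group m" using f g by simp
  have "acts m (g \<otimes>\<^bsub>?B\<^esub> f) (\<lambda>v. \<Psi> (\<Phi> v))"
    unfolding acts_def
  proof (intro allI impI)
    fix v :: "nat \<Rightarrow> 'a mpoly fract" assume v: "generic m v"
    obtain F where F: "F \<in> f" "peq (\<Phi> v) (papp F v)" using f v by (auto simp: acts_def)
    obtain G where G: "G \<in> g" "peq (\<Psi> (\<Phi> v)) (papp G (\<Phi> v))" using g in_G_generic[OF m \<Phi> v] by (auto simp: acts_def)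
    have dF: "dominant m F" "f = pclass m F" and dG: "dominant m G" "g = pclass m G"
      using Bir_member[OF G.mem_carrier[OF f(1)] F(1)] Bir_member[OF G.mem_carrier[OF g(1)] G(1)] by auto
    have "tuple_comp G F \<in> g \<otimes>\<^bsub>?B\<^esub> f"
      unfolding dF(2) dG(2) mult_Bir[OF dF(1) dG(1)]
      by (rule rat_class_self[OF dominant_reps[OF dominant_tuple_comp[OF dF(1) dG(1)]]])
    moreover have "peq (\<Psi> (\<Phi> v)) (papp (tuple_comp G F) v)"
      unfolding papp_tuple_comp[OF dominant_reps[OF dG(1)]]
      using peq_trans[OF G(2) papp_peq[OF dG(1) F(2)]] .
    ultimately show "\<exists>H\<in>g \<otimes>\<^bsub>?B\<^esub> f. peq (\<Psi> (\<Phi> v)) (papp H v)" by blast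
  qed
  then show ?thesis using gf by (auto simp: in_G_def)
qed

lemma in_G_cong:
  fixes \<Phi> \<Phi>' :: "(nat \<Rightarrow> 'a::field mpoly fract) \<Rightarrow> nat \<Rightarrow> 'a mpoly fract"
  assumes "in_G m \<Phi>" "\<And>v. generic m v \<Longrightarrow> peq (\<Phi>' v) (\<Phi> v)" shows "in_G m \<Phi>'"
proof -
  obtain f where f: "f \<in> G_group m" "acts m f \<Phi>" using assms(1) by (auto simp: in_G_def)
  have "acts m f \<Phi>'" unfolding acts_def
  proof (intro allI impI)
    fix v :: "nat \<Rightarrow> 'a mpoly fract" assume v: "generic m v"
    then obtain F where F: "F \<in> f" "peq (\<Phi> v) (papp F v)" using f(2) by (auto simp: acts_def)
    show "\<exists>F\<in>f. peq (\<Phi>' v) (papp F v)" using peq_trans[OF assms(2)[OF v] F(2)] F(1) by (intro bexI[of _ F])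
  qed
  then show ?thesis using f(1) by (auto simp: in_G_def)
qed

text \<open>A birational map is determined by its value at the tautological point, hence agrees with
  the element of \<open>G_group m\<close> that acts as \<Phi>.\<close>

lemma in_G_detect:
  assumes m: "m \<ge> 1" and f: "f \<in> carrier (Bir (Proj m))" "T \<in> f" and \<Phi>: "in_G m \<Phi>" "peq (\<lambda>i. tf (T i)) (\<Phi> (gpt m))"
  shows "f \<in> G_group m"
proof -
  obtain g where g: "g \<in> G_group m" "acts m g \<Phi>" using \<Phi> by (auto simp: in_G_def)
  then obtain F where F: "F \<in> g" "peq (\<Phi> (gpt m)) (papp F (gpt m))" using generic_gpt by (auto simp: acts_def)
  have dF: "dominant m F" "g = pclass m F" using Bir_member[OF G_group_carrier[OF m g(1)] F(1)] by auto
  have dT: "dominant m T" "f = pclass m T" using Bir_member[OF f] by auto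
  have "peq (papp T (gpt m)) (papp F (gpt m))" unfolding papp_gpt[OF dT(1)] using peq_trans[OF \<Phi>(2) F(2)] .
  then have "f = g" unfolding dF(2) dT(2) by (rule pclass_eqI[OF dT(1) dF(1)])
  then show ?thesis using g by simp
qed

lemma in_G_lin: "matinv m A B \<Longrightarrow> in_G m (lact kc m A)"
  using in_G_I[OF lin_G_group rat_class_self[OF lin_reps]] unfolding papp_lin .

lemma in_G_inverse: "in_G m (\<lambda>v i. if i \<le> m then 1 / v i else 0)"
proof (rule in_G_cong[OF in_G_I[OF std_G_group rat_class_self[OF std_tuple_reps]]])
  fix v :: "nat \<Rightarrow> 'a mpoly fract" assume v: "generic m v"
  have nz: "v i \<noteq> 0" if "i \<le> m" for i using generic_nonzero[OF v that] .
  have "(\<Prod>j\<le>m. v j) \<noteq> 0" using nz by (simp add: prod_zero_iff)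
  moreover have "papp (std_tuple m) v = (\<lambda>i. if i \<le> m then (\<Prod>j\<le>m. v j) / v i else 0)" by (rule papp_std_tuple[OF nz])
  ultimately show "peq (\<lambda>i. if i \<le> m then 1 / v i else 0) (papp (std_tuple m) v)"
    by (intro peqI[of "1 / (\<Prod>j\<le>m. v j)"]) (simp_all add: fun_eq_iff)
qed

section \<open>Elementary linear maps\<close>

lemma matinv_row:
  assumes i: "i \<le> m" and r: "r i \<noteq> (0 :: 'a::field)"
  shows "matinv m (\<lambda>a b. if a = i then r b else if a = b then 1 else 0)
      (\<lambda>a b. if a = i then (if b = i then 1 / r i else - r b / r i) else if a = b then 1 else 0)"
proof -
  have *: "(\<Sum>k\<le>m. (if a = i then r k else if a = k then 1 else 0) * (if k = i then s b else if k = b then 1 else 0)) = (if a = b then 1 else 0)"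
    if ab: "a \<le> m" "b \<le> m" and ri: "r i \<noteq> 0" and s: "\<And>b. s b = (if b = i then 1 / r i else - r b / r i)" for a b and r s :: "nat \<Rightarrow> 'a"
  proof (cases "a = i")
    case False
    have "(\<Sum>k\<le>m. (if a = i then r k else if a = k then 1 else 0) * (if k = i then s b else if k = b then 1 else 0))
       = (\<Sum>k\<le>m. (if a = k then 1 else 0) * (if k = i then s b else if k = b then 1 else 0))" using False by simp
    also have "\<dots> = (if a = b then 1 else 0)" by (subst sum_delta_mult[OF ab(1)]) (use False in simp)
    finally show ?thesis .
  next
    case True
    have "(\<Sum>k\<le>m. r k * (if k = i then s b else if k = b then 1 else 0)) = (\<Sum>k\<le>m. (if k = i then r i * s b else 0) + (if k = b \<and> b \<noteq> i then r b else 0))"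
      by (intro sum.cong) auto
    also have "\<dots> = r i * s b + (if b \<noteq> i then r b else 0)" using i ab by (simp add: sum.distrib)
    also have "\<dots> = (if a = b then 1 else 0)" using True ri by (auto simp: s)
    finally show ?thesis using True by simp
  qed
  let ?s = "\<lambda>b. if b = i then 1 / r i else - r b / r i"
  have rs: "r b = (if b = i then 1 / ?s i else - ?s b / ?s i)" for b using r by auto
  have si: "?s i \<noteq> 0" using r by simp
  show ?thesis unfolding matinv_def
  proof (intro allI impI conjI)
    fix a b assume ab: "a \<le> m" "b \<le> m"
    show "(\<Sum>k\<le>m. (if a = i then r k else if a = k then 1 else 0) * (if k = i then ?s b else if k = b then 1 else 0)) = (if a = b then 1 else 0)"
      by (rule *[where r = r and s = ?s, OF ab r refl])
    show "(\<Sum>k\<le>m. (if a = i then ?s k else if a = k then 1 else 0) * (if k = i then r b else if k = b then 1 else 0)) = (if a = b then 1 else 0)"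
      by (rule *[where r = ?s and s = r, OF ab si rs])
  qed
qed

lemma in_G_row:
  assumes i: "i \<le> m" and r: "r i \<noteq> 0" shows "in_G m (\<lambda>v. v(i := (\<Sum>b\<le>m. kc (r b) * v b)))"
proof (rule in_G_cong[OF in_G_lin[OF matinv_row[OF i, of r, OF r]]])
  fix v :: "nat \<Rightarrow> 'a mpoly fract" assume v: "generic m v"
  have "lact kc m (\<lambda>a b. if a = i then r b else if a = b then 1 else 0) v = v(i := (\<Sum>b\<le>m. kc (r b) * v b))"
  proof
    fix a
    show "lact kc m (\<lambda>a b. if a = i then r b else if a = b then 1 else 0) v a = (v(i := (\<Sum>b\<le>m. kc (r b) * v b))) a"
    proof (cases "a \<le> m \<and> a \<noteq> i")
      case True
      then have "lact kc m (\<lambda>a b. if a = i then r b else if a = b then 1 else 0) v a = (\<Sum>b\<le>m. kc (if a = b then 1 else 0) * v b)"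
        unfolding lact_def by simp
      also have "\<dots> = (\<Sum>b\<le>m. (if a = b then 1 else 0) * v b)" by (intro sum.cong refl) simp
      finally have "lact kc m (\<lambda>a b. if a = i then r b else if a = b then 1 else 0) v a = (\<Sum>b\<le>m. (if a = b then 1 else 0) * v b)" .
      then show ?thesis using True sum_delta_mult[of a m v] by simp
    next
      case False
      have z: "v a = 0" if "a > m" using v that by (simp add: generic_def)
      consider "a = i" | "a > m" "a \<noteq> i" using False by linarith
      then show ?thesis
      proof cases
        case 1
        then show ?thesis using i unfolding lact_def by simp
      next
        case 2
        then show ?thesis using z unfolding lact_def by simp
      qed
    qed
  qed
  then show "peq (v(i := (\<Sum>b\<le>m. kc (r b) * v b))) (lact kc m (\<lambda>a b. if a = i then r b else if a = b then 1 else 0) v)" by (simp only: peq_refl)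
qed

lemma in_G_add:
  assumes ij: "i \<le> m" "j \<le> m" "i \<noteq> j" shows "in_G m (\<lambda>v. v(i := v i + kc c * v j))"
proof -
  have "in_G m (\<lambda>v. v(i := (\<Sum>b\<le>m. kc (if b = i then 1 else if b = j then c else 0) * v b)))"
    by (rule in_G_row[OF ij(1)]) simp
  moreover have "(\<Sum>b\<le>m. kc (if b = i then 1 else if b = j then c else 0) * v b) = v i + kc c * v j" for v :: "nat \<Rightarrow> 'a mpoly fract"
  proof -
    have "(\<Sum>b\<le>m. kc (if b = i then 1 else if b = j then c else 0) * v b) = (\<Sum>b\<le>m. (if b = i then v i else 0) + (if b = j then kc c * v j else 0))"
      using ij by (intro sum.cong) auto
    then show ?thesis using ij by (simp add: sum.distrib)
  qed
  ultimately show ?thesis by simp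
qed

lemma in_G_scale:
  assumes i: "i \<le> m" and c: "c \<noteq> 0" shows "in_G m (\<lambda>v. v(i := kc c * v i))"
proof -
  have "in_G m (\<lambda>v. v(i := (\<Sum>b\<le>m. kc (if b = i then c else 0) * v b)))"
    by (rule in_G_row[OF i]) (simp add: c)
  moreover have "(\<Sum>b\<le>m. kc (if b = i then c else 0) * v b) = kc c * v i" for v :: "nat \<Rightarrow> 'a mpoly fract"
  proof -
    have "(\<Sum>b\<le>m. kc (if b = i then c else 0) * v b) = (\<Sum>b\<le>m. if b = i then kc c * v i else 0)"
      by (intro sum.cong) auto
    then show ?thesis using i by simp
  qed
  ultimately show ?thesis by simp
qed

definition swap_mat :: "nat \<Rightarrow> nat \<Rightarrow> nat \<Rightarrow> nat \<Rightarrow> 'a::field"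
  where "swap_mat i j a b = (if Transposition.transpose i j a = b then 1 else 0)"

lemma transpose_le: "i \<le> m \<Longrightarrow> j \<le> m \<Longrightarrow> a \<le> m \<Longrightarrow> Transposition.transpose i j a \<le> (m :: nat)"
  by (simp add: Transposition.transpose_def)

lemma matinv_swap:
  assumes "i \<le> m" "j \<le> m" shows "matinv m (swap_mat i j :: nat \<Rightarrow> nat \<Rightarrow> 'a::field) (swap_mat i j)"
proof -
  have "(\<Sum>k\<le>m. swap_mat i j a k * swap_mat i j k b) = (if a = b then 1 else 0 :: 'a)" if "a \<le> m" for a b
    unfolding swap_mat_def by (subst sum_delta_mult[OF transpose_le[OF assms that]]) simp
  then show ?thesis by (simp add: matinv_def)
qed

lemma lact_swap:
  assumes "i \<le> m" "j \<le> m" "\<And>a. a > m \<Longrightarrow> v a = 0"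
  shows "lact kc m (swap_mat i j) v = v(i := v j, j := v i)"
proof
  fix a
  show "lact kc m (swap_mat i j) v a = (v(i := v j, j := v i)) a"
  proof (cases "a \<le> m")
    case True
    have "lact kc m (swap_mat i j) v a = (\<Sum>b\<le>m. (if Transposition.transpose i j a = b then 1 else 0) * v b)"
      using True by (auto simp: lact_def swap_mat_def intro!: sum.cong)
    also have "\<dots> = v (Transposition.transpose i j a)" by (rule sum_delta_mult[OF transpose_le[OF assms(1,2) True]])
    finally show ?thesis by (auto simp: Transposition.transpose_def)
  next
    case False then show ?thesis using assms by (auto simp: lact_def)
  qed
qed

lemma in_G_swap:
  assumes "i \<le> m" "j \<le> m" shows "in_G m (\<lambda>v. v(i := v j, j := v i))"
proof (rule in_G_cong[OF in_G_lin[OF matinv_swap[OF assms]]])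
  fix v :: "nat \<Rightarrow> 'a mpoly fract" assume "generic m v"
  then show "peq (v(i := v j, j := v i)) (lact kc m (swap_mat i j) v)"
    using lact_swap[OF assms, of v] by (simp add: generic_def)
qed

section \<open>Inversions, scalings and shears in G_m\<close>

context
  fixes m :: nat
  assumes m: "m \<ge> 1"
begin

text \<open>The conjugate of x_i -> x_i + c x_j by the standard involution. On x_i it acts as the
  Moebius transformation with matrix (1, 0; c / x_j, 1).\<close>

lemma in_G_lower:
  assumes ij: "i \<le> m" "j \<le> m" "i \<noteq> j" shows "in_G m (\<lambda>v. v(i := v i * v j / (v j + kc c * v i)))"
proof (rule in_G_cong[OF in_G_comp[OF m in_G_comp[OF m in_G_inverse in_G_add[OF ij, of c]] in_G_inverse]])
  fix v :: "nat \<Rightarrow> 'a mpoly fract" assume v: "generic m v"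
  have nz: "v k \<noteq> 0" if "k \<le> m" for k using generic_nonzero[OF v that] .
  have z: "v k = 0" if "k > m" for k using v that by (simp add: generic_def)
  have "1 / v i + kc c * (1 / v j) = (v j + kc c * v i) / (v i * v j)"
    using nz ij by (simp add: field_simps)
  then have "1 / (1 / v i + kc c * (1 / v j)) = v i * v j / (v j + kc c * v i)" by simp
  then have "v(i := v i * v j / (v j + kc c * v i)) = (\<lambda>k. if k \<le> m then 1 / ((\<lambda>i. if i \<le> m then 1 / v i else 0)
    (i := (if i \<le> m then 1 / v i else 0) + kc c * (if j \<le> m then 1 / v j else 0))) k else 0)"
    using ij z by (intro ext) auto
  then show "peq (v(i := v i * v j / (v j + kc c * v i))) (\<lambda>k. if k \<le> m then 1 / ((\<lambda>i. if i \<le> m then 1 / v i else 0)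
    (i := (if i \<le> m then 1 / v i else 0) + kc c * (if j \<le> m then 1 / v j else 0))) k else 0)" by simp
qed

text \<open>The product of elementary matrices \<open>(1, L; 0, 1) (1, 0; -1/L, 1) (1, L; 0, 1) = (0, L; -1/L, 0)\<close> with \<open>L = x_j\<close>.\<close>

lemma in_G_quadratic:
  assumes ij: "i \<le> m" "j \<le> m" "i \<noteq> j" shows "in_G m (\<lambda>v. v(i := (v j)\<^sup>2 / v i))"
proof -
  \<comment> \<open>As a Moebius transformation the product sends x_i to -x_j^2 / x_i; a final
    scaling by -1 corrects the sign.\<close>
  have "(- 1 :: 'a) \<noteq> 0" by simp
  from in_G_comp[OF m in_G_comp[OF m in_G_comp[OF m in_G_add[OF ij, of 1] in_G_lower[OF ij, of "-1"]] in_G_add[OF ij, of 1]] in_G_scale[OF ij(1) this]]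
  show ?thesis
  proof (rule in_G_cong)
    fix v :: "nat \<Rightarrow> 'a mpoly fract" assume v: "generic m v"
    have nz: "v k \<noteq> 0" if "k \<le> m" for k using generic_nonzero[OF v that] .
    have "(v j)\<^sup>2 / v i = - ((v i + v j) * v j / (v j - (v i + v j)) + v j)"
      using nz ij by (simp add: field_simps power2_eq_square)
    then show "peq (v(i := (v j)\<^sup>2 / v i)) ((\<lambda>v. v(i := kc (- 1) * v i)) ((\<lambda>v. v(i := v i + kc 1 * v j)) ((\<lambda>v. v(i := v i * v j / (v j + kc (- 1) * v i))) (v(i := v i + kc 1 * v j)))))"
      using ij by (simp add: kc.hom_uminus)
  qed
qed

text \<open>Two inversions x_i -> x_k^2 / x_i and x_i -> x_j^2 / x_i in succession. Their composite
  scales by a square, which is why the next lemmas are about squares of ratios.\<close>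

lemma in_G_scale_square:
  assumes "i \<le> m" "j \<le> m" "k \<le> m" "i \<noteq> j" "i \<noteq> k" shows "in_G m (\<lambda>v. v(i := v i * (v j / v k)\<^sup>2))"
proof (rule in_G_cong[OF in_G_comp[OF m in_G_quadratic[OF assms(1,3,5)] in_G_quadratic[OF assms(1,2,4)]]])
  fix v :: "nat \<Rightarrow> 'a mpoly fract" assume "generic m v"
  have "v i * (v j / v k)\<^sup>2 = (v j)\<^sup>2 / ((v k)\<^sup>2 / v i)" by (simp add: power_divide)
  then show "peq (v(i := v i * (v j / v k)\<^sup>2)) ((v(i := (v k)\<^sup>2 / v i))(i := ((v(i := (v k)\<^sup>2 / v i)) j)\<^sup>2 / (v(i := (v k)\<^sup>2 / v i)) i))"
    using assms by simp
qed

text \<open>Conjugation by x_a -> x_a + s x_b turns the ratio x_a / x_b into x_a / x_b + s.\<close>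

lemma in_G_scale_square_sum:
  assumes "i \<le> m" "a \<le> m" "b \<le> m" "i \<noteq> a" "i \<noteq> b" "a \<noteq> b"
  shows "in_G m (\<lambda>v. v(i := v i * ((v a + kc s * v b) / v b)\<^sup>2))" "in_G m (\<lambda>v. v(i := v i * (v b / (v a + kc s * v b))\<^sup>2))"
proof -
  note c = in_G_add[OF assms(2,3,6)]
  show "in_G m (\<lambda>v. v(i := v i * ((v a + kc s * v b) / v b)\<^sup>2))"
  proof (rule in_G_cong[OF in_G_comp[OF m in_G_comp[OF m c[of s] in_G_scale_square[OF assms(1,2,3,4,5)]] c[of "- s"]]])
    fix v :: "nat \<Rightarrow> 'a mpoly fract"
    have "v(i := v i * ((v a + kc s * v b) / v b)\<^sup>2) = (\<lambda>v. v(a := v a + kc (- s) * v b)) ((\<lambda>v. v(i := v i * (v a / v b)\<^sup>2)) (v(a := v a + kc s * v b)))"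
      using assms by (intro ext) (simp add: kc.hom_uminus)
    then show "peq (v(i := v i * ((v a + kc s * v b) / v b)\<^sup>2)) ((\<lambda>v. v(a := v a + kc (- s) * v b)) ((\<lambda>v. v(i := v i * (v a / v b)\<^sup>2)) (v(a := v a + kc s * v b))))"
      by (simp only: peq_refl)
  qed
  show "in_G m (\<lambda>v. v(i := v i * (v b / (v a + kc s * v b))\<^sup>2))"
  proof (rule in_G_cong[OF in_G_comp[OF m in_G_comp[OF m c[of s] in_G_scale_square[OF assms(1,3,2,5,4)]] c[of "- s"]]])
    fix v :: "nat \<Rightarrow> 'a mpoly fract"
    have "v(i := v i * (v b / (v a + kc s * v b))\<^sup>2) = (\<lambda>v. v(a := v a + kc (- s) * v b)) ((\<lambda>v. v(i := v i * (v b / v a)\<^sup>2)) (v(a := v a + kc s * v b)))"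
      using assms by (intro ext) (simp add: kc.hom_uminus)
    then show "peq (v(i := v i * (v b / (v a + kc s * v b))\<^sup>2)) ((\<lambda>v. v(a := v a + kc (- s) * v b)) ((\<lambda>v. v(i := v i * (v b / v a)\<^sup>2)) (v(a := v a + kc s * v b))))"
      by (simp only: peq_refl)
  qed
qed

text \<open>The addition of c x_k to x_i is conjugated by a scaling of x_i by a square, which leaves
  x_k, x_a and x_b alone and thus multiplies only the added term.\<close>

lemma in_G_add_square:
  assumes "i \<le> m" "k \<le> m" "a \<le> m" "b \<le> m" "i \<noteq> a" "i \<noteq> b" "a \<noteq> b" "i \<noteq> k" "k \<noteq> a" "k \<noteq> b"
  shows "in_G m (\<lambda>v. v(i := v i + kc c * ((v a + kc s * v b) / v b)\<^sup>2 * v k))"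
proof (rule in_G_cong[OF in_G_comp[OF m in_G_comp[OF m in_G_scale_square_sum(2)[OF assms(1,3,4,5,6,7), of s] in_G_add[OF assms(1,2,8), of c]] in_G_scale_square_sum(1)[OF assms(1,3,4,5,6,7), of s]]])
  fix v :: "nat \<Rightarrow> 'a mpoly fract" assume v: "generic m v"
  have "generic m (v(a := v a + kc s * v b))" by (rule in_G_generic[OF m in_G_add[OF assms(3,4,7)] v])
  then have "(v(a := v a + kc s * v b)) a \<noteq> 0" by (rule generic_nonzero[OF _ assms(3)])
  then have nz: "v a + kc s * v b \<noteq> 0" by simp
  have b: "v b \<noteq> 0" using generic_nonzero[OF v] assms by simp
  define P where "P = (v a + kc s * v b) / v b"
  define Q where "Q = v b / (v a + kc s * v b)"
  have QP: "Q\<^sup>2 * P\<^sup>2 = 1" unfolding power_mult_distrib[symmetric] using nz b by (simp add: P_def Q_def)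
  have "(v i * Q\<^sup>2 + kc c * v k) * P\<^sup>2 = v i * (Q\<^sup>2 * P\<^sup>2) + kc c * P\<^sup>2 * v k"
    by (simp add: distrib_right distrib_left mult_ac)
  then have e: "(v i * Q\<^sup>2 + kc c * v k) * P\<^sup>2 = v i + kc c * P\<^sup>2 * v k" unfolding QP by simp
  have "(\<lambda>v. v(i := v i * ((v a + kc s * v b) / v b)\<^sup>2)) ((\<lambda>v. v(i := v i + kc c * v k)) (v(i := v i * (v b / (v a + kc s * v b))\<^sup>2)))
    = v(i := (v i * Q\<^sup>2 + kc c * v k) * P\<^sup>2)"
    using assms unfolding P_def Q_def by (intro ext) simp
  then have "v(i := v i + kc c * ((v a + kc s * v b) / v b)\<^sup>2 * v k) = (\<lambda>v. v(i := v i * ((v a + kc s * v b) / v b)\<^sup>2)) ((\<lambda>v. v(i := v i + kc c * v k)) (v(i := v i * (v b / (v a + kc s * v b))\<^sup>2)))"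
    unfolding e unfolding P_def by (rule sym)
  then show "peq (v(i := v i + kc c * ((v a + kc s * v b) / v b)\<^sup>2 * v k)) ((\<lambda>v. v(i := v i * ((v a + kc s * v b) / v b)\<^sup>2)) ((\<lambda>v. v(i := v i + kc c * v k)) (v(i := v i * (v b / (v a + kc s * v b))\<^sup>2))))"
    by (simp only: peq_refl)
qed

context
  assumes two: "(2 :: 'a::field) \<noteq> 0"
begin

text \<open>Here characteristic \<open>\<noteq> 2\<close> enters: \<open>4 \<mu> = (\<mu> + 1)\<^sup>2 - (\<mu> - 1)\<^sup>2\<close>.\<close>

lemma in_G_add_ratio:
  assumes "i \<le> m" "k \<le> m" "a \<le> m" "b \<le> m" "i \<noteq> a" "i \<noteq> b" "a \<noteq> b" "i \<noteq> k" "k \<noteq> a" "k \<noteq> b"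
  shows "in_G m (\<lambda>v :: nat \<Rightarrow> 'a mpoly fract. v(i := v i + kc c * (v a / v b) * v k))"
proof (rule in_G_cong[OF in_G_comp[OF m in_G_add_square[OF assms, of "c / 4" 1] in_G_add_square[OF assms, of "- (c / 4)" "-1"]]])
  fix v :: "nat \<Rightarrow> 'a mpoly fract" assume v: "generic m v"
  have b: "v b \<noteq> 0" using generic_nonzero[OF v] assms by simp
  have four: "(4 :: 'a) \<noteq> 0" using mult_eq_0_iff[of "2 :: 'a" 2] two by simp
  define d where "d = kc (c / 4)"
  have c4: "kc c = 4 * d"
  proof -
    have "x + x + x + x = 4 * x" for x :: 'a by simp
    then have "c / 4 + c / 4 + c / 4 + c / 4 = 4 * (c / 4)" .
    also have "\<dots> = c" using four by simp
    finally have "kc c = kc (c / 4 + c / 4 + c / 4 + c / 4)" by (rule arg_cong[OF sym])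
    also have "\<dots> = d + d + d + d" by (simp only: kc.hom_add d_def)
    finally show ?thesis by simp
  qed
  define \<mu> where "\<mu> = v a / v b"
  have q: "(v a + v b) / v b = \<mu> + 1" "(v a - v b) / v b = \<mu> - 1"
    using b by (simp_all add: \<mu>_def add_divide_distrib diff_divide_distrib)
  have "4 * d * \<mu> = d * (\<mu> + 1)\<^sup>2 - d * (\<mu> - 1)\<^sup>2" by (simp add: power2_eq_square algebra_simps)
  then have e: "v i + kc c * \<mu> * v k = v i + d * (\<mu> + 1)\<^sup>2 * v k + - d * (\<mu> - 1)\<^sup>2 * v k"
    unfolding c4 by (simp only: left_diff_distrib) simp
  have "(\<lambda>v. v(i := v i + kc (- (c / 4)) * ((v a + kc (- 1) * v b) / v b)\<^sup>2 * v k)) (v(i := v i + kc (c / 4) * ((v a + kc 1 * v b) / v b)\<^sup>2 * v k))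
     = v(i := v i + d * ((v a + v b) / v b)\<^sup>2 * v k + - d * ((v a - v b) / v b)\<^sup>2 * v k)"
    using assms by (intro ext) (simp add: kc.hom_uminus d_def)
  also have "\<dots> = v(i := v i + kc c * (v a / v b) * v k)" unfolding q unfolding e[symmetric] unfolding \<mu>_def ..
  finally have eq: "v(i := v i + kc c * (v a / v b) * v k) = (\<lambda>v. v(i := v i + kc (- (c / 4)) * ((v a + kc (- 1) * v b) / v b)\<^sup>2 * v k)) (v(i := v i + kc (c / 4) * ((v a + kc 1 * v b) / v b)\<^sup>2 * v k))" ..
  show "peq (v(i := v i + kc c * (v a / v b) * v k)) ((\<lambda>v. v(i := v i + kc (- (c / 4)) * ((v a + kc (- 1) * v b) / v b)\<^sup>2 * v k)) (v(i := v i + kc (c / 4) * ((v a + kc 1 * v b) / v b)\<^sup>2 * v k)))"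
    unfolding eq by (rule peq_refl)
qed

text \<open>Put \<mu> = x_a / x_b. The product of (1, \<mu>; 0, 1), (1, 0; -1/\<mu>, 1) and (1,
  \<mu>; 0, 1), now acting linearly on (x_i, x_k), is (0, \<mu>; -1/\<mu>, 0). An exchange and a
  sign turn it into diag(1/\<mu>, \<mu>). Scaling x_i by the square of \<mu> gives diag(\<mu>,
  \<mu>).\<close>

lemma in_G_scale_pair:
  assumes "i \<le> m" "k \<le> m" "a \<le> m" "b \<le> m" "i \<noteq> a" "i \<noteq> b" "a \<noteq> b" "i \<noteq> k" "k \<noteq> a" "k \<noteq> b"
  shows "in_G m (\<lambda>v :: nat \<Rightarrow> 'a mpoly fract. v(i := v a / v b * v i, k := v a / v b * v k))"
proof -
  note A = in_G_add_ratio[OF assms, of 1]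
  \<comment> \<open>Here \<open>i\<close> and \<open>k\<close> as well as \<open>a\<close> and
    \<open>b\<close> are exchanged: this is x_k -> x_k - (x_b / x_a) x_i.\<close>
  note B = in_G_add_ratio[OF assms(2,1,4,3,10,9) assms(7)[symmetric] assms(8)[symmetric] assms(6,5), of "-1"]
  have m1: "(- 1 :: 'a) \<noteq> 0" by simp
  show ?thesis
  proof (rule in_G_cong[OF in_G_comp[OF m in_G_comp[OF m in_G_comp[OF m in_G_comp[OF m in_G_comp[OF m A B] A] in_G_swap[OF assms(1,2)]]
      in_G_scale[OF assms(1) m1]] in_G_scale_square[OF assms(1,3,4,5,6)]]])
    fix v :: "nat \<Rightarrow> 'a mpoly fract" assume v: "generic m v"
    have ab: "v a \<noteq> 0" "v b \<noteq> 0" using generic_nonzero[OF v] assms by auto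
    let ?a = "\<lambda>v :: nat \<Rightarrow> 'a mpoly fract. v(i := v i + kc 1 * (v a / v b) * v k)"
    let ?b = "\<lambda>v :: nat \<Rightarrow> 'a mpoly fract. v(k := v k + kc (- 1) * (v b / v a) * v i)"
    let ?w = "\<lambda>v :: nat \<Rightarrow> 'a mpoly fract. v(i := v k, k := v i)"
    let ?c = "\<lambda>v :: nat \<Rightarrow> 'a mpoly fract. v(i := kc (- 1) * v i)"
    let ?q = "\<lambda>v :: nat \<Rightarrow> 'a mpoly fract. v(i := v i * (v a / v b)\<^sup>2)"
    define \<mu> where "\<mu> = v a / v b"
    define \<nu> where "\<nu> = v b / v a"
    have mn: "\<nu> * \<mu> = 1" "\<mu> * \<nu> = 1" using ab by (simp_all add: \<mu>_def \<nu>_def)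
    have e: "v k - \<nu> * (v i + \<mu> * v k) = - (\<nu> * v i)" "v i + \<mu> * v k + \<mu> * - (\<nu> * v i) = \<mu> * v k" "\<nu> * v i * \<mu>\<^sup>2 = \<mu> * v i"
    proof -
      have "v k - \<nu> * (v i + \<mu> * v k) = v k - (\<nu> * v i + (\<nu> * \<mu>) * v k)" by (simp only: distrib_left mult.assoc)
      then show "v k - \<nu> * (v i + \<mu> * v k) = - (\<nu> * v i)" by (simp add: mn)
      have "v i + \<mu> * v k + \<mu> * - (\<nu> * v i) = v i + \<mu> * v k - (\<mu> * \<nu>) * v i" by (simp add: mult.assoc)
      then show "v i + \<mu> * v k + \<mu> * - (\<nu> * v i) = \<mu> * v k" by (simp add: mn)
      have "\<nu> * v i * \<mu>\<^sup>2 = (\<nu> * \<mu>) * (\<mu> * v i)" by (simp only: power2_eq_square ac_simps)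
      then show "\<nu> * v i * \<mu>\<^sup>2 = \<mu> * v i" by (simp add: mn)
    qed
    have 1: "?b (?a v) = v(i := v i + \<mu> * v k, k := v k - \<nu> * (v i + \<mu> * v k))"
      using assms by (intro ext) (simp add: kc.hom_uminus \<mu>_def \<nu>_def)
    have 2: "?a (?b (?a v)) = v(i := v i + \<mu> * v k + \<mu> * - (\<nu> * v i), k := - (\<nu> * v i))"
      unfolding 1 e(1) using assms by (intro ext) (simp add: \<mu>_def)
    have 3: "?c (?w (?a (?b (?a v)))) = v(i := \<nu> * v i, k := \<mu> * v k)"
      unfolding 2 e(2) using assms by (intro ext) (simp add: kc.hom_uminus)
    have "?q (?c (?w (?a (?b (?a v))))) = v(i := \<nu> * v i * \<mu>\<^sup>2, k := \<mu> * v k)"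
      unfolding 3 using assms by (intro ext) (simp add: \<mu>_def)
    then have 4: "?q (?c (?w (?a (?b (?a v))))) = v(i := v a / v b * v i, k := v a / v b * v k)"
      unfolding e(3) unfolding \<mu>_def .
    show "peq (v(i := v a / v b * v i, k := v a / v b * v k)) (?q (?c (?w (?a (?b (?a v))))))"
      unfolding 4 by (rule peq_refl)
  qed
qed

lemma in_G_scale_pairs:
  "2 + 2 * r \<le> m \<Longrightarrow> in_G m (\<lambda>(v :: nat \<Rightarrow> 'a mpoly fract) l. if 2 \<le> l \<and> l < 2 + 2 * r then v 0 / v 1 * v l else v l)"
proof (induction r)
  case 0
  have "in_G m (\<lambda>v :: nat \<Rightarrow> 'a mpoly fract. v(0 := kc 1 * v 0))" by (rule in_G_scale) auto
  then show ?case
  proof (rule in_G_cong)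
    fix v :: "nat \<Rightarrow> 'a mpoly fract"
    have "(\<lambda>l. if 2 \<le> l \<and> l < 2 + 2 * 0 then v 0 / v 1 * v l else v l) = v" "v(0 := kc 1 * v 0) = v" by (auto intro!: ext)
    then show "peq (\<lambda>l. if 2 \<le> l \<and> l < 2 + 2 * 0 then v 0 / v 1 * v l else v l) (v(0 := kc 1 * v 0))"
      by (simp only: peq_refl)
  qed
next
  case (Suc r)
  let ?i = "2 + 2 * r"
  have i: "?i \<le> m" "Suc ?i \<le> m" using Suc.prems by auto
  have ne: "?i \<noteq> 0" "?i \<noteq> 1" "(0 :: nat) \<noteq> 1" "?i \<noteq> Suc ?i" "Suc ?i \<noteq> 0" "Suc ?i \<noteq> 1" by auto
  show ?case
  proof (rule in_G_cong[OF in_G_comp[OF m Suc.IH in_G_scale_pair[OF i le0 m ne]]])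
    show "2 + 2 * r \<le> m" by (rule i(1))
    fix v :: "nat \<Rightarrow> 'a mpoly fract"
    let ?v = "\<lambda>l. if 2 \<le> l \<and> l < 2 + 2 * r then v 0 / v 1 * v l else v l"
    have "(\<lambda>l. if 2 \<le> l \<and> l < 2 + 2 * Suc r then v 0 / v 1 * v l else v l) = ?v(?i := ?v 0 / ?v 1 * ?v ?i, Suc ?i := ?v 0 / ?v 1 * ?v (Suc ?i))"
      by (intro ext) (auto simp: less_Suc_eq)
    then show "peq (\<lambda>l. if 2 \<le> l \<and> l < 2 + 2 * Suc r then v 0 / v 1 * v l else v l) (?v(?i := ?v 0 / ?v 1 * ?v ?i, Suc ?i := ?v 0 / ?v 1 * ?v (Suc ?i)))"
      by (simp only: peq_refl)
  qed
qed

text \<open>After the paired scalings, the inversion of x_1 and the exchange, the vector is (x_0^2 /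
  x_1, x_0, (x_0 / x_1) x_2, ..., (x_0 / x_1) x_(m-1), x_m). This is x_0 / x_1 times the value of
  the shear.\<close>

lemma shear_proportional:
  fixes v :: "nat \<Rightarrow> 'f::field"
  assumes nz: "v 0 \<noteq> 0" "v 1 \<noteq> 0" and r: "m = 2 + 2 * r"
    and p: "p = (\<lambda>l. if 2 \<le> l \<and> l < 2 + 2 * r then v 0 / v 1 * v l else v l)"
    and q: "q = p(1 := (p 0)\<^sup>2 / p 1)" and w: "w = q(0 := q 1, 1 := q 0)"
  shows "l \<le> m \<Longrightarrow> (v(m := v m * v 1 / v 0)) l = (v 1 / v 0) * w l"
proof -
  assume lm: "l \<le> m"
  have p0: "p 0 = v 0" "p 1 = v 1" by (simp_all add: p)
  consider "l = 0" | "l = 1" | "2 \<le> l" "l < m" | "2 \<le> l" "l = m" using lm by linarith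
  then show ?thesis
  proof cases
    case 1
    have "w 0 = (v 0)\<^sup>2 / v 1" using p0 by (simp add: w q)
    then show ?thesis using nz 1 r by (simp add: power2_eq_square)
  next
    case 2
    have "w 1 = v 0" using p0 by (simp add: w q)
    then show ?thesis using nz 2 r by simp
  next
    case 3
    then have "w l = v 0 / v 1 * v l" by (simp add: w q p r)
    then show ?thesis using nz 3 by simp
  next
    case 4
    then have "w l = v l" by (simp add: w q p r)
    then show ?thesis using 4 by simp
  qed
qed

text \<open>As \<open>m\<close> is even, the coordinates other than \<open>x_m\<close> can be scaled by \<open>x_0 / x_1\<close> in pairs.\<close>

lemma in_G_shear:
  assumes ev: "even m" shows "in_G m (\<lambda>v :: nat \<Rightarrow> 'a mpoly fract. v(m := v m * v 1 / v 0))"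
proof -
  have m2: "m \<ge> 2" using ev m by (cases "m = 1") auto
  obtain k where "m = 2 * k" using ev by (rule evenE)
  then have "m = 2 + 2 * (k - 1)" using m2 by simp
  then obtain r where r: "m = 2 + 2 * r" by blast
  have 01: "(1 :: nat) \<noteq> 0" by simp
  have rm: "2 + 2 * r \<le> m" using r by simp
  have c1: "in_G m (\<lambda>(v :: nat \<Rightarrow> 'a mpoly fract) l. if 2 \<le> l \<and> l < 2 + 2 * r then v 0 / v 1 * v l else v l)"
    by (rule in_G_scale_pairs[OF rm])
  have c2: "in_G m (\<lambda>v :: nat \<Rightarrow> 'a mpoly fract. v(1 := (v 0)\<^sup>2 / v 1))"
    by (rule in_G_quadratic[OF m le0 01])
  have c3: "in_G m (\<lambda>v :: nat \<Rightarrow> 'a mpoly fract. v(0 := v 1, 1 := v 0))"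
    by (rule in_G_swap[OF le0 m])
  show ?thesis
  proof (rule in_G_cong[OF in_G_comp[OF m in_G_comp[OF m c1 c2] c3]])
    fix v :: "nat \<Rightarrow> 'a mpoly fract" assume v: "generic m v"
    have nz: "v 0 \<noteq> 0" "v 1 \<noteq> 0" using generic_nonzero[OF v] m by auto
    have z: "v l = 0" if "l > m" for l using v that by (simp add: generic_def)
    define p where "p = (\<lambda>l. if 2 \<le> l \<and> l < 2 + 2 * r then v 0 / v 1 * v l else v l)"
    define q where "q = p(1 := (p 0)\<^sup>2 / p 1)"
    define w where "w = q(0 := q 1, 1 := q 0)"
    have "(v(m := v m * v 1 / v 0)) l = (v 1 / v 0) * w l" for l
    proof (cases "l \<le> m")
      case True
      then show ?thesis by (rule shear_proportional[OF nz r p_def q_def w_def])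
    next
      case False
      then have l: "l > m" by simp
      then have "w l = v l" using m2 unfolding w_def q_def p_def r by simp
      then show ?thesis using l by (simp add: z)
    qed
    moreover have "v 1 / v 0 \<noteq> 0" using nz by simp
    ultimately have "peq (v(m := v m * v 1 / v 0)) w" by (intro peqI) 
    then show "peq (v(m := v m * v 1 / v 0)) ((\<lambda>v. v(0 := v 1, 1 := v 0)) ((\<lambda>v. v(1 := (v 0)\<^sup>2 / v 1)) (\<lambda>l. if 2 \<le> l \<and> l < 2 + 2 * r then v 0 / v 1 * v l else v l)))"
      unfolding w_def q_def p_def .
  qed
qed

lemma in_G_shear_var:
  assumes ev: "even m" and j: "1 \<le> j" "j < m" shows "in_G m (\<lambda>v :: nat \<Rightarrow> 'a mpoly fract. v(m := v m * v j / v 0))"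
proof -
  have jm: "j \<le> m" using j by simp
  show ?thesis
  proof (rule in_G_cong[OF in_G_comp[OF m in_G_comp[OF m in_G_swap[OF m jm] in_G_shear[OF ev]] in_G_swap[OF m jm]]])
    fix v :: "nat \<Rightarrow> 'a mpoly fract"
    have "v(m := v m * v j / v 0) = (\<lambda>v. v(1 := v j, j := v 1)) ((\<lambda>v. v(m := v m * v 1 / v 0)) (v(1 := v j, j := v 1)))"
      using j by (intro ext) auto
    then show "peq (v(m := v m * v j / v 0)) ((\<lambda>v. v(1 := v j, j := v 1)) ((\<lambda>v. v(m := v m * v 1 / v 0)) (v(1 := v j, j := v 1))))"
      by (simp only: peq_refl)
  qed
qed

end

end

text \<open>A linear change of coordinates that fixes x_0 makes the linear form a coordinate x_j
  with j >= 1, which reduces the claim to a conjugate of \<open>in_G_shear_var\<close>. If the form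
  is a multiple of x_0, no such j exists, and the map is a scaling.\<close>

lemma in_G_shear_linear:
  fixes c :: "nat \<Rightarrow> 'a::field"
  assumes two: "(2 :: 'a) \<noteq> 0" and n: "odd n" and c: "\<exists>j\<le>n. c j \<noteq> 0"
  shows "in_G (Suc n) (\<lambda>v :: nat \<Rightarrow> 'a mpoly fract. v(Suc n := v (Suc n) * (\<Sum>j\<le>n. kc (c j) * v j) / v 0))"
proof (cases "\<exists>j. 1 \<le> j \<and> j \<le> n \<and> c j \<noteq> 0")
  case False
  have c0: "c 0 \<noteq> 0"
  proof -
    obtain j where "j \<le> n" "c j \<noteq> 0" using c by blast
    then show ?thesis using False by (cases "j = 0") auto
  qed
  show ?thesis
  proof (rule in_G_cong[OF in_G_scale[OF le_refl c0]])
    fix v :: "nat \<Rightarrow> 'a mpoly fract" assume v: "generic (Suc n) v"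
    have "(\<Sum>j\<le>n. kc (c j) * v j) = (\<Sum>j\<le>n. if j = 0 then kc (c 0) * v 0 else 0)"
      using False by (intro sum.cong) auto
    then have "(\<Sum>j\<le>n. kc (c j) * v j) = kc (c 0) * v 0" by simp
    then show "peq (v(Suc n := v (Suc n) * (\<Sum>j\<le>n. kc (c j) * v j) / v 0)) (v(Suc n := kc (c 0) * v (Suc n)))"
      using generic_nonzero[OF v, of 0] by (simp add: mult.commute)
  qed
next
  case True
  then obtain j where j: "1 \<le> j" "j \<le> n" "c j \<noteq> 0" by blast
  have m: "Suc n \<ge> 1" "even (Suc n)" "j \<le> Suc n" "j < Suc n" using n j by auto
  define r where "r b = (if b \<le> n then c b else 0)" for b
  \<comment> \<open>The row of the inverse matrix: it solves the linear form for x_j.\<close>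
  define s where "s b = (if b = j then 1 / c j else if b \<le> n then - (c b / c j) else 0)" for b
  have rj: "r j \<noteq> 0" "s j \<noteq> 0" using j by (simp_all add: r_def s_def)
  have rs: "(\<Sum>b\<le>Suc n. kc (r b) * v b) = (\<Sum>j\<le>n. kc (c j) * v j)" for v :: "nat \<Rightarrow> 'a mpoly fract"
    by (simp add: r_def)
  show ?thesis
  proof (rule in_G_cong[OF in_G_comp[OF m(1) in_G_comp[OF m(1) in_G_row[where r = r, OF m(3) rj(1)] in_G_shear_var[OF m(1) two m(2) j(1) m(4)]] in_G_row[where r = s, OF m(3) rj(2)]]])
    fix v :: "nat \<Rightarrow> 'a mpoly fract" assume v: "generic (Suc n) v"
    let ?L = "\<Sum>j\<le>n. kc (c j) * v j"
    let ?w = "(\<lambda>v. v(Suc n := v (Suc n) * v j / v 0)) (v(j := ?L))"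
    have w: "?w = v(j := ?L, Suc n := v (Suc n) * ?L / v 0)" using j by auto
    have L: "?L = kc (c j) * v j + (\<Sum>b\<in>{..n} - {j}. kc (c b) * v b)" using j by (intro sum.remove) auto
    have kcj: "kc (1 / c j) * kc (c j) = 1" using j by (simp add: kc.hom_mult[symmetric])
    have "(\<Sum>b\<le>Suc n. kc (s b) * ?w b) = (\<Sum>b\<le>n. kc (s b) * ?w b)" using j by (simp add: s_def)
    also have "\<dots> = kc (s j) * ?w j + (\<Sum>b\<in>{..n} - {j}. kc (s b) * ?w b)" using j by (intro sum.remove) auto
    also have "\<dots> = kc (1 / c j) * ?L + (\<Sum>b\<in>{..n} - {j}. - (kc (1 / c j) * (kc (c b) * v b)))"
    proof -
      have "kc (s b) * ?w b = - (kc (1 / c j) * (kc (c b) * v b))" if "b \<in> {..n} - {j}" for b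
      proof -
        have "kc (s b) = kc (- (1 / c j * c b))" using that by (simp add: s_def)
        then have "kc (s b) = - (kc (1 / c j) * kc (c b))" by (simp only: kc.hom_uminus kc.hom_mult)
        then show ?thesis using that unfolding w by (simp add: mult.assoc)
      qed
      then show ?thesis using j unfolding w by (simp add: s_def)
    qed
    also have "\<dots> = kc (1 / c j) * (?L - (\<Sum>b\<in>{..n} - {j}. kc (c b) * v b))"
      by (simp add: sum_negf sum_distrib_left right_diff_distrib)
    also have "\<dots> = (kc (1 / c j) * kc (c j)) * v j" unfolding L by simp
    finally have S: "(\<Sum>b\<le>Suc n. kc (s b) * ?w b) = v j" unfolding kcj by simp
    have "v(Suc n := v (Suc n) * ?L / v 0) = ?w(j := (\<Sum>b\<le>Suc n. kc (s b) * ?w b))" unfolding S using j by auto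
    then show "peq (v(Suc n := v (Suc n) * ?L / v 0)) ((\<lambda>v. v(j := (\<Sum>b\<le>Suc n. kc (s b) * v b))) ((\<lambda>v. v(Suc n := v (Suc n) * v j / v 0)) (v(j := (\<Sum>b\<le>Suc n. kc (r b) * v b)))))"
      unfolding rs by (simp only: peq_refl)
  qed
qed

section \<open>Suspensions of the generators\<close>

lemma matinv_extend:
  assumes AB: "matinv n A B"
  shows "matinv (Suc n) (\<lambda>a b. if a \<le> n \<and> b \<le> n then A a b else if a = b then 1 else 0)
     (\<lambda>a b. if a \<le> n \<and> b \<le> n then B a b else if a = b then 1 else 0)"
proof -
  have *: "(\<Sum>k\<le>Suc n. (if a \<le> n \<and> k \<le> n then C a k else if a = k then 1 else 0) * (if k \<le> n \<and> b \<le> n then D k b else if k = b then 1 else 0))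
     = (if a = b then 1 else 0)"
    if "a \<le> Suc n" "b \<le> Suc n" and CD: "\<And>a b. a \<le> n \<Longrightarrow> b \<le> n \<Longrightarrow> (\<Sum>k\<le>n. C a k * D k b) = (if a = b then 1 else 0)" for a b and C D :: "nat \<Rightarrow> nat \<Rightarrow> 'a"
  proof -
    have "(\<Sum>k\<le>n. (if a \<le> n \<and> k \<le> n then C a k else if a = k then 1 else 0) * (if k \<le> n \<and> b \<le> n then D k b else if k = b then 1 else 0))
      = (if a \<le> n \<and> b \<le> n then (\<Sum>k\<le>n. C a k * D k b) else 0)"
    proof (cases "a \<le> n \<and> b \<le> n")
      case True then show ?thesis by (auto intro!: sum.cong)
    next
      case False
      then show ?thesis using that by (auto intro!: sum.neutral)
    qed
    then show ?thesis using that(1,2) CD[of a b] by (auto simp: le_Suc_eq)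
  qed
  show ?thesis using AB unfolding matinv_def by (intro allI impI conjI *) blast+
qed

text \<open>With m = n + 1, dividing the suspension by x_0 leaves A x in the first coordinates and
  x_m (A x)_0 / x_0 in the last one. This is a shear by the linear form (A x)_0, followed by A
  extended by 1.\<close>

lemma in_G_suspend_lin:
  fixes A :: "nat \<Rightarrow> nat \<Rightarrow> 'a::field"
  assumes two: "(2 :: 'a) \<noteq> 0" and n: "odd n" and AB: "matinv n A B"
  shows "in_G (Suc n) (suspend n (lact kc n A))"
proof -
  have m: "Suc n \<ge> 1" by simp
  have "\<exists>j\<le>n. A 0 j \<noteq> 0"
  proof (rule ccontr)
    assume "\<not> ?thesis" then have "(\<Sum>k\<le>n. A 0 k * B k 0) = 0" by (intro sum.neutral) auto
    then show False using AB by (simp add: matinv_def)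
  qed
  note T = in_G_shear_linear[OF two n this]
  let ?A = "\<lambda>a b. if a \<le> n \<and> b \<le> n then A a b else if a = b then 1 else 0"
  show ?thesis
  proof (rule in_G_cong[OF in_G_comp[OF m T in_G_lin[OF matinv_extend[OF AB]]]])
    fix v :: "nat \<Rightarrow> 'a mpoly fract" assume v: "generic (Suc n) v"
    have v0: "v 0 \<noteq> 0" using generic_nonzero[OF v] by simp
    let ?w = "v(Suc n := v (Suc n) * (\<Sum>j\<le>n. kc (A 0 j) * v j) / v 0)"
    have "suspend n (lact kc n A) v i = v 0 * lact kc (Suc n) ?A ?w i" for i
    proof -
      consider "i \<le> n" | "i = Suc n" | "i > Suc n" by linarith
      then show ?thesis
      proof cases
        case 1
        have "(\<Sum>j\<le>n. kc (?A i j) * ?w j) = (\<Sum>j\<le>n. kc (A i j) * v j)" using 1 by (intro sum.cong) auto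
        then show ?thesis using 1 by (simp add: suspend_def lact_def)
      next
        case 2
        have "(\<Sum>j\<le>n. kc (?A i j) * ?w j) = 0" using 2 by (intro sum.neutral) auto
        then show ?thesis using 2 v0 by (simp add: suspend_def lact_def)
      next
        case 3 then show ?thesis by (simp add: suspend_def lact_def)
      qed
    qed
    then show "peq (suspend n (lact kc n A) v) (lact kc (Suc n) ?A ?w)" using v0 by (intro peqI[of "v 0"])
  qed
qed

text \<open>Up to a common factor the suspension is 1 / x_i for i <= n and x_m / x_0^2 for m = n +
  1. So it is the inversion x_m -> x_0^2 / x_m followed by the standard involution.\<close>

lemma in_G_suspend_std: "in_G (Suc n) (suspend n (papp (std_tuple n)))"
proof -
  have m: "Suc n \<ge> 1" by simp
  have ij: "Suc n \<le> Suc n" "0 \<le> Suc n" "Suc n \<noteq> 0" by auto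
  show ?thesis
  proof (rule in_G_cong[OF in_G_comp[OF m in_G_quadratic[OF m ij] in_G_inverse]])
    fix v :: "nat \<Rightarrow> 'a mpoly fract" assume v: "generic (Suc n) v"
    have nz: "v i \<noteq> 0" if "i \<le> Suc n" for i using generic_nonzero[OF v that] .
    let ?P = "\<Prod>j\<le>n. v j"
    have P: "?P \<noteq> 0" using nz by (simp add: prod_zero_iff)
    have e: "papp (std_tuple n) v = (\<lambda>i. if i \<le> n then ?P / v i else 0)" by (rule papp_std_tuple) (use nz in simp)
    have "suspend n (papp (std_tuple n)) v i = (v 0 * ?P) * (if i \<le> Suc n then 1 / (v(Suc n := (v 0)\<^sup>2 / v (Suc n))) i else 0)" for i
      using nz P by (auto simp: suspend_def e[THEN fun_cong] power2_eq_square field_simps le_Suc_eq)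
    then show "peq (suspend n (papp (std_tuple n)) v) (\<lambda>i. if i \<le> Suc n then 1 / (v(Suc n := (v 0)\<^sup>2 / v (Suc n))) i else 0)"
      using nz P by (intro peqI[of "v 0 * ?P"]) auto
  qed
qed

text \<open>Suspension is compatible with composition up to a common factor: the x_0 that it
  introduces leaves the homogeneous F as a power.\<close>

lemma in_G_suspend_comp:
  assumes \<Phi>: "in_G (Suc n) (suspend n \<Phi>)" and F: "F \<in> rat_reps (Proj n) (Proj n)" and \<Psi>: "in_G (Suc n) (suspend n (papp F))"
  shows "in_G (Suc n) (suspend n (\<lambda>v. papp F (\<Phi> v)))"
proof -
  have m: "Suc n \<ge> 1" by simp
  obtain d where d: "\<And>i. homogeneous d (F i)" using F by (auto simp: rat_reps_def)
  have Fv: "mvars (F i) \<subseteq> {0..n}" for i using F by (simp add: rat_reps_def)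
  show ?thesis
  proof (rule in_G_cong[OF in_G_comp[OF m \<Phi> \<Psi>]])
    fix v :: "nat \<Rightarrow> 'a mpoly fract" assume v: "generic (Suc n) v"
    have v0: "v 0 \<noteq> 0" using generic_nonzero[OF v] by simp
    have "suspend n \<Phi> v 0 \<noteq> 0" using generic_nonzero[OF in_G_generic[OF m \<Phi> v]] by simp
    then have P0: "\<Phi> v 0 \<noteq> 0" by (auto simp: suspend_def)
    have pe: "pev (suspend n \<Phi> v) (F i) = v 0 ^ d * pev (\<Phi> v) (F i)" for i
    proof -
      have "pev (suspend n \<Phi> v) (F i) = pev (\<lambda>l. v 0 * \<Phi> v l) (F i)"
        by (rule mp_eval_cong) (use Fv[of i] in \<open>auto simp: suspend_def\<close>)
      then show ?thesis using kc.mp_eval_homogeneous_scale[OF d] by simp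
    qed
    have "suspend n (papp F) (suspend n \<Phi> v) i = (\<Phi> v 0 * v 0 ^ d) * suspend n (\<lambda>v. papp F (\<Phi> v)) v i" for i
      by (simp add: suspend_def[of n "papp F"] suspend_def[of n "\<lambda>v. papp F (\<Phi> v)"] pe) (simp add: suspend_def)
    then have "peq (suspend n (papp F) (suspend n \<Phi> v)) (suspend n (\<lambda>v. papp F (\<Phi> v)) v)"
      using P0 v0 by (intro peqI[of "\<Phi> v 0 * v 0 ^ d"]) auto
    then show "peq (suspend n (\<lambda>v. papp F (\<Phi> v)) v) (suspend n (papp F) (suspend n \<Phi> v))" by (rule peq_sym)
  qed
qed

text \<open>As \<open>\<iota>\<close> is a homomorphism, generators suffice. The inner coordinate
  changes M and N are suspended together with the generator, and the outer ones are linear maps of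
  the larger space.\<close>

lemma linear_embedding_odd:
  fixes \<iota> :: "'a::field ratmap \<Rightarrow> 'a ratmap"
  assumes n: "n \<ge> 1" "odd n" and \<iota>: "linear_embedding n \<iota>" and two: "(2 :: 'a) \<noteq> 0"
  shows "\<iota> ` G_group n \<subseteq> G_group (Suc n)"
proof -
  let ?B = "Bir (Proj n) :: 'a ratmap monoid" and ?B' = "Bir (Proj (Suc n)) :: 'a ratmap monoid"
  have m: "Suc n \<ge> 1" by simp
  obtain M N M' N' where MN: "matinv n M N" "matinv (Suc n) M' N'"
    and form: "\<And>\<phi> F. \<phi> \<in> carrier ?B \<Longrightarrow> F \<in> \<phi> \<Longrightarrow> \<exists>T\<in>\<iota> \<phi>. peq (\<lambda>i. tf (T i))
       (lact kc (Suc n) M' (suspend n (\<lambda>v. lact kc n N (papp F (lact kc n M v))) (lact kc (Suc n) N' (gpt (Suc n)))))"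
    using linear_embedding_formula[OF \<iota> n(1)] by metis
  interpret h: group_hom ?B ?B' \<iota>
    using \<iota> unfolding linear_embedding_def group_hom_def group_hom_axioms_def by (simp add: group_Bir)
  have gens: "insert (std_involution n) (Aut_Proj n) \<subseteq> carrier ?B" by (rule G_generators[OF n(1)])
  have gen: "\<iota> \<phi> \<in> G_group (Suc n)" if \<phi>: "\<phi> \<in> insert (std_involution n) (Aut_Proj n)" for \<phi>
  proof -
    have \<phi>B: "\<phi> \<in> carrier ?B" using \<phi> gens by blast
    have "\<exists>F. F \<in> \<phi> \<and> F \<in> rat_reps (Proj n) (Proj n) \<and> in_G (Suc n) (suspend n (papp F))"
    proof (cases "\<phi> = std_involution n")
      case True
      then have "std_tuple n \<in> \<phi>" using rat_class_self[OF std_tuple_reps] by (simp add: std_involution_std_tuple)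
      then show ?thesis using in_G_suspend_std std_tuple_reps by blast
    next
      case False
      then have "\<phi> \<in> Aut_Proj n" using \<phi> by simp
      then obtain A A' where A: "matinv n A A'" "\<phi> = pclass n (lin n A)" by (rule Aut_Proj_linear[OF _ n(1)])
      have "in_G (Suc n) (suspend n (papp (lin n A)))" using in_G_suspend_lin[OF two n(2) A(1)] by (simp only: papp_lin)
      then show ?thesis using A(2) rat_class_self[OF lin_reps[OF A(1)]] lin_reps[OF A(1)] by blast
    qed
    then obtain F where F: "F \<in> \<phi>" "F \<in> rat_reps (Proj n) (Proj n)" "in_G (Suc n) (suspend n (papp F))" by blast
    have sN: "in_G (Suc n) (suspend n (papp (lin n N)))"
      using in_G_suspend_lin[OF two n(2) matinv_sym[OF MN(1)]] by (simp only: papp_lin)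
    have 1: "in_G (Suc n) (suspend n (\<lambda>v. papp F (lact kc n M v)))"
      by (rule in_G_suspend_comp[OF in_G_suspend_lin[OF two n(2) MN(1)] F(2,3)])
    have "in_G (Suc n) (suspend n (\<lambda>v. papp (lin n N) (papp F (lact kc n M v))))"
      by (rule in_G_suspend_comp[OF 1 lin_reps[OF matinv_sym[OF MN(1)]] sN])
    then have 2: "in_G (Suc n) (suspend n (\<lambda>v. lact kc n N (papp F (lact kc n M v))))" by (simp only: papp_lin)
    note 3 = in_G_comp[OF m in_G_comp[OF m in_G_lin[OF matinv_sym[OF MN(2)]] 2] in_G_lin[OF MN(2)]]
    obtain T where T: "T \<in> \<iota> \<phi>" "peq (\<lambda>i. tf (T i))
       (lact kc (Suc n) M' (suspend n (\<lambda>v. lact kc n N (papp F (lact kc n M v))) (lact kc (Suc n) N' (gpt (Suc n)))))"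
      using form[OF \<phi>B F(1)] by blast
    show ?thesis by (rule in_G_detect[OF m h.hom_closed[OF \<phi>B] T(1) 3 T(2)])
  qed
  interpret G': subgroup "G_group (Suc n)" ?B' by (rule subgroup_G_group[OF m])
  have "\<iota> f \<in> G_group (Suc n)" if "f \<in> generate ?B (insert (std_involution n) (Aut_Proj n))" for f
    using that
  proof (induction rule: generate.induct)
    case one then show ?case using G'.one_closed by simp
  next
    case (incl h) then show ?case by (rule gen)
  next
    case (inv h)
    then have "h \<in> carrier ?B" using gens by blast
    then show ?case using gen[OF inv] by (simp add: h.hom_inv)
  next
    case (eng h1 h2)
    then have "h1 \<in> carrier ?B" "h2 \<in> carrier ?B" using group.generate_in_carrier[OF group_Bir gens] by blast+
    then show ?case using eng by (simp add: h.hom_mult)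
  qed
  then show ?thesis unfolding G_group_def[of n] by blast
qed

section \<open>The obstruction for even n\<close>

lemma shear_tuple_reps: assumes "m \<ge> 2" shows "shear_tuple m \<in> rat_reps (Proj m) (Proj m)"
proof -
  have "homogeneous 2 (shear_tuple m i :: 'a mpoly)" for i
  proof -
    have "homogeneous (Suc 0 + Suc 0) (mvar a * mvar b :: 'a mpoly)" for a b by (intro homogeneous_mult homogeneous_mvar)
    then show ?thesis by (simp add: shear_tuple_def numeral_2_eq_2)
  qed
  moreover have "mvars (shear_tuple m i :: 'a mpoly) \<subseteq> {0..m}" for i
    using assms unfolding shear_tuple_def by (auto dest!: subsetD[OF mvars_mult])
  moreover have "shear_tuple m 0 \<noteq> (0 :: 'a mpoly)" using assms by (simp add: shear_tuple_def)
  moreover have "shear_tuple m i = 0" if "i > m" for i using that by (simp add: shear_tuple_def)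
  ultimately show ?thesis unfolding rat_reps_def by auto
qed

lemma papp_shear: "papp (shear_tuple m) v = (\<lambda>i. if i < m then v 0 * v i else if i = m then v 1 * v m else 0)"
  by (auto simp: shear_tuple_def kc.mp_eval_mult kc.mp_eval_0)

text \<open>The image of a linear automorphism already leaves \<open>G_group (Suc n)\<close>. The
  automorphism is chosen so that its image is the suspension of the exchange of x_0 and x_1 up to
  linear maps of the larger space; after these are removed, the remaining map is the shear, whose
  Jacobian is not a square.\<close>

lemma linear_embedding_even:
  fixes \<iota> :: "'a::field ratmap \<Rightarrow> 'a ratmap"
  assumes n: "n \<ge> 2" "even n" and \<iota>: "linear_embedding n \<iota>"
  shows "\<not> \<iota> ` G_group n \<subseteq> G_group (Suc n)"
proof
  assume sub: "\<iota> ` G_group n \<subseteq> G_group (Suc n)"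
  let ?B = "Bir (Proj n) :: 'a ratmap monoid" and ?B' = "Bir (Proj (Suc n)) :: 'a ratmap monoid"
  let ?m = "Suc n"
  have n1: "n \<ge> 1" and m: "?m \<ge> 1" "odd ?m" "?m \<ge> 3" "?m \<ge> 2" using n by auto
  interpret G: subgroup "G_group n" ?B by (rule subgroup_G_group[OF n1])
  interpret G': subgroup "G_group ?m" ?B' by (rule subgroup_G_group[OF m(1)])
  obtain M N M' N' where MN: "matinv n M N" "matinv ?m M' N'"
    and form: "\<And>\<phi> F. \<phi> \<in> carrier ?B \<Longrightarrow> F \<in> \<phi> \<Longrightarrow> \<exists>T\<in>\<iota> \<phi>. peq (\<lambda>i. tf (T i))
       (lact kc ?m M' (suspend n (\<lambda>v. lact kc n N (papp F (lact kc n M v))) (lact kc ?m N' (gpt ?m))))"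
    using linear_embedding_formula[OF \<iota> n1] by metis
  have NM: "matinv n N M" "matinv ?m N' M'" using MN matinv_sym by auto
  let ?s = "swap_mat 0 1 :: nat \<Rightarrow> nat \<Rightarrow> 'a"
  have s: "matinv n ?s ?s" "matinv ?m ?s ?s" using n1 by (auto intro!: matinv_swap)
  note dl = Bir_lin(1)
  \<comment> \<open>Conjugation by M cancels the inner coordinate changes of the embedding formula,
    so that the plain exchange gets suspended.\<close>
  define F where "F = tuple_comp (lin n M) (tuple_comp (lin n ?s) (lin n N))"
  have dsN: "dominant n (tuple_comp (lin n ?s) (lin n N))" by (rule dominant_tuple_comp[OF dl[OF NM(1)] dl[OF s(1)]])
  have dF: "dominant n F" unfolding F_def by (rule dominant_tuple_comp[OF dsN dl[OF MN(1)]])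
  have "pclass n F = pclass n (lin n M) \<otimes>\<^bsub>?B\<^esub> (pclass n (lin n ?s) \<otimes>\<^bsub>?B\<^esub> pclass n (lin n N))"
    unfolding F_def mult_Bir[OF dl[OF NM(1)] dl[OF s(1)]] mult_Bir[OF dsN dl[OF MN(1)]] ..
  then have FG: "pclass n F \<in> G_group n" using lin_G_group[OF MN(1)] lin_G_group[OF NM(1)] lin_G_group[OF s(1)] by simp
  define z where "z = lact kc ?m N' (gpt ?m)"
  have H: "lact kc n N (papp F (lact kc n M v)) = lact kc n ?s v" for v
  proof -
    have "papp F (lact kc n M v) = lact kc n M (lact kc n ?s (lact kc n N (lact kc n M (trunc n v))))"
      unfolding F_def papp_tuple_comp[OF lin_reps[OF MN(1)]] papp_tuple_comp[OF lin_reps[OF s(1)]] papp_lin lact_trunc ..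
    also have "lact kc n N (lact kc n M (trunc n v)) = trunc n v"
      by (rule lact_lact[OF kc.comm_ring_hom_axioms NM(1)]) (simp add: trunc_def)
    finally have "lact kc n N (papp F (lact kc n M v)) = lact kc n N (lact kc n M (lact kc n ?s v))" by (simp only: lact_trunc)
    then show ?thesis using lact_lact[OF kc.comm_ring_hom_axioms NM(1), of "lact kc n ?s v"] by (simp add: lact_def)
  qed
  obtain T where T: "T \<in> \<iota> (pclass n F)" "peq (\<lambda>i. tf (T i)) (lact kc ?m M' (suspend n (lact kc n ?s) z))"
    using form[OF G.mem_carrier[OF FG] rat_class_self[OF dominant_reps[OF dF]]] unfolding H z_def by blast
  have \<iota>G: "\<iota> (pclass n F) \<in> G_group ?m" using sub FG by blast
  have dT: "dominant ?m T" "\<iota> (pclass n F) = pclass ?m T" using Bir_member[OF G'.mem_carrier[OF \<iota>G] T(1)] by auto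
  \<comment> \<open>Removes the outer change M' and exchanges x_0 and x_1 once more; what remains is
    the shear, still evaluated at z instead of the tautological point.\<close>
  define R where "R = tuple_comp (lin ?m ?s) (tuple_comp (lin ?m N') T)"
  have dNT: "dominant ?m (tuple_comp (lin ?m N') T)" by (rule dominant_tuple_comp[OF dT(1) dl[OF NM(2)]])
  have dR: "dominant ?m R" unfolding R_def by (rule dominant_tuple_comp[OF dNT dl[OF s(2)]])
  have "pclass ?m R = pclass ?m (lin ?m ?s) \<otimes>\<^bsub>?B'\<^esub> (pclass ?m (lin ?m N') \<otimes>\<^bsub>?B'\<^esub> pclass ?m T)"
    unfolding R_def mult_Bir[OF dT(1) dl[OF NM(2)]] mult_Bir[OF dNT dl[OF s(2)]] ..
  then have "pclass ?m R \<in> G_group ?m" using lin_G_group[OF NM(2)] lin_G_group[OF s(2)] \<iota>G dT(2) by simp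
  then have sqR: "square_jac ?m R" using square_jac_G_group[OF m(2)] rat_class_self[OF dominant_reps[OF dR]] by blast
  have sz: "suspend n (lact kc n ?s) z = (\<lambda>i. if i \<le> n then z 0 * lact kc n ?s z i else if i = ?m then z ?m * z 1 else 0)"
  proof -
    have "lact kc n ?s z 0 = z 1"
      using lact_swap[of 0 n 1 "trunc n z"] n1 unfolding lact_trunc by (simp add: trunc_def)
    then show ?thesis by (auto simp: suspend_def)
  qed
  have tR: "papp R (gpt ?m) = lact kc ?m ?s (lact kc ?m N' (\<lambda>i. tf (T i)))"
    unfolding R_def papp_tuple_comp[OF lin_reps[OF s(2)]] papp_tuple_comp[OF lin_reps[OF NM(2)]] papp_lin papp_gpt[OF dT(1)] ..
  have "peq (lact kc ?m ?s (lact kc ?m N' (\<lambda>i. tf (T i)))) (lact kc ?m ?s (lact kc ?m N' (lact kc ?m M' (suspend n (lact kc n ?s) z))))"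
    by (intro lact_peq T(2))
  also have "lact kc ?m N' (lact kc ?m M' (suspend n (lact kc n ?s) z)) = suspend n (lact kc n ?s) z"
    by (rule lact_lact[OF kc.comm_ring_hom_axioms NM(2)]) (simp add: suspend_def)
  also have "lact kc ?m ?s (suspend n (lact kc n ?s) z) = papp (shear_tuple ?m) z"
  proof -
    have z: "lact kc n ?s z i = (if i = 0 then z 1 else if i = 1 then z 0 else z i)" if "i \<le> n" for i
      using lact_swap[of 0 n 1 "trunc n z"] n1 that unfolding lact_trunc by (auto simp: trunc_def)
    have shear: "g(0 := g 1, 1 := g 0) = papp (shear_tuple ?m) z"
      if g: "g = (\<lambda>i. if i \<le> n then z 0 * S i else if i = ?m then z ?m * z 1 else 0)"
        and S: "\<And>i. i \<le> n \<Longrightarrow> S i = (if i = 0 then z 1 else if i = 1 then z 0 else z i)" for g S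
      unfolding papp_shear g using n1 by (intro ext) (auto simp: S mult.commute)
    have "lact kc ?m ?s (suspend n (lact kc n ?s) z) = (suspend n (lact kc n ?s) z)(0 := suspend n (lact kc n ?s) z 1, 1 := suspend n (lact kc n ?s) z 0)"
      by (rule lact_swap) (auto simp: suspend_def)
    also have "\<dots> = papp (shear_tuple ?m) z"
      by (rule shear[OF sz z])
    finally show ?thesis .
  qed
  finally have pR: "peq (\<lambda>i. tf (R i)) (papp (shear_tuple ?m) z)" unfolding tR[symmetric] papp_gpt[OF dR] .
  \<comment> \<open>The shear precomposed with N' represents the same map as R. Composing with M' on
    the right then recovers the shear tuple exactly, and both steps preserve
    \<open>square_jac\<close>.\<close>
  define V where "V = tuple_comp (shear_tuple ?m) (lin ?m N')"
  have "(\<lambda>i. tf (V i)) = papp (shear_tuple ?m) z"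
    unfolding V_def z_def tf_lin[symmetric] by (rule ext) (simp only: tuple_comp_Proj[OF shear_tuple_reps[OF m(4)]] tf_mp_eval)
  then have RV: "peq (\<lambda>i. tf (R i)) (\<lambda>i. tf (V i))" using pR by simp
  have gV: "generic ?m (\<lambda>i. tf (V i))" using generic_peq[OF _ peq_sym[OF RV]] dR by (simp add: dominant_def)
  have "V 0 \<noteq> 0" using generic_nonzero[OF gV, of 0] by simp
  then have "V \<in> rat_reps (Proj ?m) (Proj ?m)"
    unfolding V_def by (intro tuple_comp_reps[OF lin_reps[OF NM(2)] shear_tuple_reps[OF m(4)]]) auto
  then have dV: "dominant ?m V" using gV by (simp add: dominant_def)
  have "square_jac ?m V" by (rule square_jac_dominant[OF m(2) sqR RV dominant_reps[OF dR] dV])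
  then have sq: "square_jac ?m (tuple_comp V (lin ?m M'))"
    by (rule square_jac_comp[OF dl[OF MN(2)] dV square_jac_lin[OF MN(2)]])
  have dVM: "dominant ?m (tuple_comp V (lin ?m M'))" by (rule dominant_tuple_comp[OF dl[OF MN(2)] dV])
  have "papp (tuple_comp V (lin ?m M')) (gpt ?m) = papp (shear_tuple ?m) (lact kc ?m N' (lact kc ?m M' (gpt ?m)))"
    unfolding papp_tuple_comp[OF dominant_reps[OF dV]] unfolding V_def papp_tuple_comp[OF shear_tuple_reps[OF m(4)]] papp_lin ..
  also have "lact kc ?m N' (lact kc ?m M' (gpt ?m)) = (gpt ?m :: nat \<Rightarrow> 'a mpoly fract)"
    by (rule lact_lact[OF kc.comm_ring_hom_axioms NM(2)]) (simp add: gpt_def)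
  also have "papp (shear_tuple ?m) (gpt ?m) = (\<lambda>i. tf (shear_tuple ?m i :: 'a mpoly))"
    using shear_tuple_reps[where 'a = 'a, OF m(4)] by (intro ext pev_gpt) (auto simp: rat_reps_def)
  finally have eq: "(\<lambda>i. tf (tuple_comp V (lin ?m M') i)) = (\<lambda>i. tf (shear_tuple ?m i))" unfolding papp_gpt[OF dVM] .
  then have "tuple_comp V (lin ?m M') = shear_tuple ?m" by (simp add: fun_eq_iff)
  then show False using sq not_square_jac_shear[where 'a = 'a, OF m(2,3)] by simp
qed

theorem proposition5p2:
  fixes n :: nat and \<iota> :: "'a::field ratmap \<Rightarrow> 'a ratmap"
  assumes "n \<ge> 2" and "linear_embedding n \<iota>"
  shows "(even n \<longrightarrow> \<not> \<iota> ` G_group n \<subseteq> G_group (n + 1)) \<and>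
         (odd n \<and> CHAR('a) \<noteq> 2 \<longrightarrow> \<iota> ` G_group n \<subseteq> G_group (n + 1))"
proof (intro conjI impI)
  assume "even n"
  then show "\<not> \<iota> ` G_group n \<subseteq> G_group (n + 1)" using linear_embedding_even[OF assms(1) _ assms(2)] by simp
next
  assume n: "odd n \<and> CHAR('a) \<noteq> 2"
  have "(2 :: 'a) \<noteq> 0"
  proof
    assume "(2 :: 'a) = 0"
    then have "of_nat 2 = (0 :: 'a)" by simp
    then have d: "CHAR('a) dvd 2" by (simp only: of_nat_eq_0_iff_char_dvd)
    have "CHAR('a) \<le> 2" by (rule dvd_imp_le[OF d]) simp
    moreover have "CHAR('a) \<noteq> 0"
    proof
      assume "CHAR('a) = 0"
      then have "0 dvd (2 :: nat)" using d by (simp only:)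
      then show False by simp
    qed
    ultimately show False using n CHAR_not_1[where 'a = 'a] by linarith
  qed
  then show "\<iota> ` G_group n \<subseteq> G_group (n + 1)" using linear_embedding_odd[OF _ _ assms(2)] assms(1) n by simp
qed

end
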